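(* For every integer $m\ge2$ there exists a constant $C(m)>0$ depending only on $m$ such that the following holds. Let $k_1,k_2\ge1$ be integers with $k_1+k_2=m$, $0<p<1$, $a(p)=(1-p)^{k_1}p^{k_2}$, and let $n\ge m$ be an integer. Suppose $(n-m+1)a(p)\ge1$ and $m\,a(p)\le0.01$. Let $\mathrm H$ be the distribution of $N(n;k_1,k_2)=Y_m+Y_{m+1}+\dots+Y_n$ and put $$\tilde N=\frac{(n-m+1)^2}{(n-m+1)(2m-1)-m(m-1)},\quad N=\lfloor\tilde N\rfloor,\quad \bar p=\frac{(n-m+1)a(p)}{N}.$$ Then $$\Bigl|\,\|\mathrm H-\mathrm{Bi}(N,\bar p)\|-\tilde C_{TV}\frac{a^{3/2}(p)m(m-1)}{2\sqrt{n-m+1}}\Bigr|\le C(m)\frac{a^{3/2}(p)m(m-1)}{\sqrt{n-m+1}}\Bigl(\frac1{\sqrt{(n-m+1)a(p)}}+\frac1{\tilde N-1}+a(p)\Bigr),$$ where $\tilde C_{TV}=\frac13\sqrt{\frac2\pi}\,(1+4e^{-3/2})$.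
   Context: $\eta_1,\eta_2,\dots$ are independent Bernoulli variables with $P(\eta_i=1)=1-P(\eta_i=0)=p$, and for $j=m,m+1,\dots,n$ $$Y_j=(1-\eta_{j-m+1})\cdots(1-\eta_{j-k_2})\,\eta_{j-k_2+1}\cdots\eta_{j-1}\eta_j .$$ $I_a$ is the unit mass at $a$, $I=I_0$; products and powers of measures are convolutions; $\mathrm{Bi}(N,\bar p)=(I+\bar p(I_1-I))^N$ is the binomial distribution; $\|M\|=\sum_{k\in\mathbb Z}|M\{k\}|$ is the total variation norm. $a^s(p)$ means $(a(p))^s$. *)

theory Defs
  imports "HOL-Probability.Probability"
begin

(* Almost surely 0/1-valued: the two point probabilities add up to 1. *)
definition iid_bernoulli :: "'a measure \<Rightarrow> (nat \<Rightarrow> 'a \<Rightarrow> int) \<Rightarrow> real \<Rightarrow> bool" where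
  "iid_bernoulli M \<eta> p \<longleftrightarrow>
     prob_space M \<and>
     prob_space.indep_vars M (\<lambda>_. count_space UNIV) \<eta> {1..} \<and>
     (\<forall>i\<ge>1. measure M {\<omega> \<in> space M. \<eta> i \<omega> = 1} = p \<and>
            measure M {\<omega> \<in> space M. \<eta> i \<omega> = 0} = 1 - p)"

(* Y_j as a function of the realisation x of the sequence: k1 failures at the indices
   j-m+1, ..., j-k2 followed by k2 successes at j-k2+1, ..., j, where m = k1 + k2.
   It is used only for j \<ge> m, where the subtractions on nat are exact. *)
definition Y :: "nat \<Rightarrow> nat \<Rightarrow> (nat \<Rightarrow> int) \<Rightarrow> nat \<Rightarrow> int" where
  "Y k1 k2 x j =
     (\<Prod>i\<in>{j - (k1 + k2) + 1..j - k2}. 1 - x i) * (\<Prod>i\<in>{j - k2 + 1..j}. x i)"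

definition N_stat :: "nat \<Rightarrow> nat \<Rightarrow> nat \<Rightarrow> (nat \<Rightarrow> int) \<Rightarrow> int" where
  "N_stat k1 k2 n x = (\<Sum>j = k1 + k2..n. Y k1 k2 x j)"

definition H :: "'a measure \<Rightarrow> (nat \<Rightarrow> 'a \<Rightarrow> int) \<Rightarrow> nat \<Rightarrow> nat \<Rightarrow> nat \<Rightarrow> int measure" where
  "H M \<eta> k1 k2 n = distr M (count_space UNIV) (\<lambda>\<omega>. N_stat k1 k2 n (\<lambda>i. \<eta> i \<omega>))"

definition Bi :: "nat \<Rightarrow> real \<Rightarrow> int measure" where
  "Bi N p = measure_pmf (map_pmf int (binomial_pmf N p))"

(* Total variation norm of a finite signed measure on the integers, which is given by its
   point masses. No factor 1/2: two mutually singular probability measures differ by 2. *)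
definition tv_norm :: "(int \<Rightarrow> real) \<Rightarrow> real" where
  "tv_norm \<mu> = (\<Sum>\<^sub>\<infinity>k\<in>UNIV. \<bar>\<mu> k\<bar>)"

definition a_prob :: "nat \<Rightarrow> nat \<Rightarrow> real \<Rightarrow> real" where
  "a_prob k1 k2 p = (1 - p) ^ k1 * p ^ k2"

definition N_tilde :: "nat \<Rightarrow> nat \<Rightarrow> real" where
  "N_tilde m n =
     (real n - real m + 1)\<^sup>2 /
       ((real n - real m + 1) * (2 * real m - 1) - real m * (real m - 1))"

definition C_TV :: real where
  "C_TV = 1 / 3 * sqrt (2 / pi) * (1 + 4 * exp (- 3 / 2))"


text \<open>
  The law of the statistic depends only on the parameters, not on the underlying probability
  space, so the type of the sample space is immaterial in any statement about H.
\<close>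

lemma iid_bernoulli_marginal:
  assumes "iid_bernoulli M \<eta> p" "i \<ge> 1"
  shows "\<eta> i \<in> measurable M (count_space UNIV)"
    and "emeasure (distr M (count_space UNIV) (\<eta> i)) {k} =
           ennreal (if k = 1 then p else if k = 0 then 1 - p else 0)"
proof -
  interpret prob_space M using assms by (simp add: iid_bernoulli_def)
  have "indep_vars (\<lambda>_. count_space UNIV) \<eta> {1..}"
    using assms by (simp add: iid_bernoulli_def)
  then show meas: "\<eta> i \<in> measurable M (count_space UNIV)"
    using assms(2) by (auto simp: indep_vars_def)
  let ?A = "\<lambda>k. {\<omega> \<in> space M. \<eta> i \<omega> = k}"
  have sets: "?A k \<in> sets M" for k
    using measurable_sets[OF meas, of "{k}"] by (simp add: vimage_def Int_def conj_commute)
  have p1: "prob (?A 1) = p" and p0: "prob (?A 0) = 1 - p"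
    using assms by (auto simp: iid_bernoulli_def)
  have "prob (?A k) = 0" if "k \<noteq> 0" "k \<noteq> 1"
  proof -
    have "prob (?A 1 \<union> ?A 0 \<union> ?A k) = prob (?A 1 \<union> ?A 0) + prob (?A k)"
      using that by (intro finite_measure_Union sets.Un sets) auto
    also have "prob (?A 1 \<union> ?A 0) = prob (?A 1) + prob (?A 0)"
      by (intro finite_measure_Union sets) auto
    finally have "1 + prob (?A k) \<le> 1"
      using p1 p0 prob_le_1[of "?A 1 \<union> ?A 0 \<union> ?A k"] by simp
    then show ?thesis using measure_nonneg[of M "?A k"] by simp
  qed
  then have "prob (?A k) = (if k = 1 then p else if k = 0 then 1 - p else 0)"
    using p1 p0 by auto
  moreover have "emeasure (distr M (count_space UNIV) (\<eta> i)) {k} = emeasure M (?A k)"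
    by (subst emeasure_distr[OF meas]) (auto intro!: arg_cong[where f = "emeasure M"])
  ultimately show "emeasure (distr M (count_space UNIV) (\<eta> i)) {k} =
      ennreal (if k = 1 then p else if k = 0 then 1 - p else 0)"
    by (simp add: emeasure_eq_measure)
qed

lemma N_stat_cong:
  assumes "1 \<le> k1 + k2" "\<And>i. i \<in> {1..n} \<Longrightarrow> x i = y i"
  shows "N_stat k1 k2 n x = N_stat k1 k2 n y"
  unfolding N_stat_def Y_def
  by (intro sum.cong arg_cong2[where f = "(*)"] prod.cong refl) (use assms in auto)

lemma H_eq_PiM:
  assumes "iid_bernoulli M \<eta> p" "1 \<le> k1 + k2" "k1 + k2 \<le> n"
  shows "H M \<eta> k1 k2 n =
    distr (PiM {1..n} (\<lambda>i. distr M (count_space UNIV) (\<eta> i))) (count_space UNIV) (N_stat k1 k2 n)"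
proof -
  interpret prob_space M using assms by (simp add: iid_bernoulli_def)
  let ?I = "{1..n}" and ?C = "count_space UNIV :: int measure"
  let ?P = "PiM ?I (\<lambda>_. ?C)"
  have rv: "\<eta> i \<in> measurable M ?C" if "i \<in> ?I" for i
    using that iid_bernoulli_marginal(1)[OF assms(1)] by simp
  have "indep_vars (\<lambda>_. ?C) \<eta> ?I"
    using assms(1) by (auto simp: iid_bernoulli_def intro: indep_vars_subset)
  then have law: "distr M ?P (\<lambda>\<omega>. \<lambda>i\<in>?I. \<eta> i \<omega>) = PiM ?I (\<lambda>i. distr M ?C (\<eta> i))"
    using assms(2,3) by (subst (asm) indep_vars_iff_distr_eq_PiM') (use rv in auto)
  have P: "?P = count_space (PiE ?I (\<lambda>_. UNIV))"
    by (intro count_space_PiM_finite) auto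
  have "distr (distr M ?P (\<lambda>\<omega>. \<lambda>i\<in>?I. \<eta> i \<omega>)) ?C (N_stat k1 k2 n) =
      distr M ?C (N_stat k1 k2 n \<circ> (\<lambda>\<omega>. \<lambda>i\<in>?I. \<eta> i \<omega>))"
  proof (rule distr_distr)
    show "N_stat k1 k2 n \<in> measurable ?P ?C" unfolding P by simp
    show "(\<lambda>\<omega>. \<lambda>i\<in>?I. \<eta> i \<omega>) \<in> measurable M ?P"
      using rv by (intro measurable_restrict) auto
  qed
  also have "\<dots> = H M \<eta> k1 k2 n"
    unfolding H_def by (intro distr_cong refl) (auto intro!: N_stat_cong assms)
  finally show ?thesis by (simp only: law)
qed

lemma H_independent_of_space:
  fixes M :: "'a measure" and M' :: "'b measure"
  assumes "iid_bernoulli M \<eta> p" "iid_bernoulli M' \<eta>' p" "1 \<le> k1 + k2" "k1 + k2 \<le> n"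
  shows "H M \<eta> k1 k2 n = H M' \<eta>' k1 k2 n"
proof -
  have "distr M (count_space UNIV) (\<eta> i) = distr M' (count_space UNIV) (\<eta>' i)"
    if "i \<in> {1..n}" for i
    by (rule measure_eqI_countable[of _ UNIV])
       (use that iid_bernoulli_marginal(2)[OF assms(1)] iid_bernoulli_marginal(2)[OF assms(2)]
        in auto)
  then have "PiM {1..n} (\<lambda>i. distr M (count_space UNIV) (\<eta> i)) =
      PiM {1..n} (\<lambda>i. distr M' (count_space UNIV) (\<eta>' i))"
    by (intro PiM_cong refl)
  then show ?thesis
    by (simp only: H_eq_PiM[OF assms(1,3,4)] H_eq_PiM[OF assms(2,3,4)])
qed

text \<open>
  The library leaves the binomial distribution unspecified outside the unit interval; the
  hypotheses m \<le> n, L * a \<ge> 1 and m * a \<le> 0.01 keep its parameter inside.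
\<close>

lemma binomial_parameter_in_unit_interval:
  fixes m n :: nat and a :: real
  defines "L \<equiv> real n - real m + 1"
  assumes "2 \<le> m" "m \<le> n" "1 \<le> L * a" "real m * a \<le> 0.01"
  shows "1 < \<lfloor>N_tilde m n\<rfloor>" "L * a / real (nat \<lfloor>N_tilde m n\<rfloor>) \<in> {0..1}"
proof -
  let ?m = "real m"
  define D where "D = L * (2 * ?m - 1) - ?m * (?m - 1)"
  have L: "L \<ge> 1" using assms by simp
  have a: "0 < a" using L assms(4) by (smt (verit) mult_nonneg_nonpos)
  have "?m * 1 \<le> ?m * (L * a)" using assms by (intro mult_left_mono) auto
  also have "\<dots> = L * (?m * a)" by simp
  also have "\<dots> \<le> L * 0.01" using L assms by (intro mult_left_mono) auto
  finally have Lm: "100 * ?m \<le> L" by simp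
  have "?m * (?m - 1) \<le> L * (?m - 1)" using Lm assms by (intro mult_right_mono) auto
  moreover have "L * ?m > 0" using L assms by simp
  ultimately have D0: "D > 0" unfolding D_def by (simp add: algebra_simps)
  have "0 \<le> ?m * (?m - 1)" using assms by simp
  then have "D \<le> L * (2 * ?m)" unfolding D_def using L by (simp add: algebra_simps)
  moreover have "L * (2 * ?m) > 0" using \<open>L * ?m > 0\<close> by simp
  ultimately have "L\<^sup>2 / (L * (2 * ?m)) \<le> L\<^sup>2 / D"
    using D0 by (intro divide_left_mono) auto
  then have ge: "L / (2 * ?m) \<le> N_tilde m n"
    using L by (simp add: N_tilde_def D_def L_def power2_eq_square)
  have "50 \<le> L / (2 * ?m)" using Lm assms by (simp add: field_simps)
  with ge have Nt: "50 \<le> N_tilde m n" by simp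
  then show one: "1 < \<lfloor>N_tilde m n\<rfloor>" by linarith
  have "L * a = (L / ?m) * (?m * a)" using assms by simp
  also have "\<dots> \<le> (L / ?m) * 0.01" using L assms by (intro mult_left_mono) auto
  also have "\<dots> = L / (2 * ?m) / 50" by simp
  also have "\<dots> \<le> N_tilde m n - 1" proof -
    have "x / 50 \<le> y - 1" if "x \<le> y" "50 \<le> y" for x y :: real using that by linarith
    then show ?thesis using ge Nt by blast
  qed
  also have "\<dots> \<le> real (nat \<lfloor>N_tilde m n\<rfloor>)" by linarith
  finally have "L * a \<le> real (nat \<lfloor>N_tilde m n\<rfloor>)" .
  then show "L * a / real (nat \<lfloor>N_tilde m n\<rfloor>) \<in> {0..1}"
    using L a one by (simp add: divide_le_eq)
qed

end

theory Submission
  imports Defs "HOL-Computational_Algebra.Formal_Power_Series" "HOL-Real_Asymp.Real_Asymp"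
begin

text \<open>
  Since two successes \<open>Y\<^sub>i = Y\<^sub>j = 1\<close> are at least \<open>m\<close> apart, the probability generating functions
  satisfy \<open>G\<^sub>n = G\<^sub>n\<^sub>-\<^sub>1 + w G\<^sub>n\<^sub>-\<^sub>m\<close> with \<open>w = a u\<close>, \<open>u = X - 1\<close>. All computations take place in the
  Banach algebra of absolutely summable power series, whose norm is the total variation norm. The
  characteristic equation has a root \<open>x = exp l\<close> near 1, all other solutions of the recursion decay
  exponentially, and so \<open>G\<^sub>n\<close> is exponentially close to \<open>x\<^sup>n\<^sup>+\<^sup>1 / (1 + m (x - 1))\<close>. The logarithms of this
  element and of \<open>(1 + q u)\<^sup>N\<close> are expanded in powers of \<open>u\<close>: \<open>N\<close> is chosen so that the terms up to
  \<open>u\<^sup>2\<close> agree (up to rounding), and the \<open>u\<^sup>3\<close> terms differ by \<open>L a\<^sup>3 m (m - 1) / 6\<close>. Errors are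
  controlled by \<open>\<parallel>u exp (t u)\<parallel> \<le> t\<^sup>-\<^sup>1\<^sup>/\<^sup>2\<close>, where \<open>exp (t u)\<close> is the Poisson distribution. Finally,
  \<open>\<parallel>u\<^sup>3 exp (t u)\<parallel>\<close> is evaluated asymptotically by Stirling's formula.
\<close>

section \<open>Exponentials and logarithms in commutative Banach algebras\<close>

text \<open>The obstacle is uniformity in \<open>lam = L * a\<close>, which is unbounded. Both
  logarithms have the form lam u + u^2 z with the norm of z bounded by a multiple of lam, and the
  obvious norm bound on exp (u^2 z) grows exponentially with lam. Hence exp (u^2 z) is never
  estimated alone: its power series in u^2 is kept beside exp (lam u), and each surviving u^s is
  worth lam^(-s/2). This works as long as z has norm at most lam / 8, so every expansion comes in
  two forms: a short one, whose remainder has an explicit constant that m a <= 0.01 makes small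
  enough, and a long one, whose remainder only needs some constant depending on m. Since u is not
  invertible, the two are linked through identities multiplied by u^2. Origin of the constant: L a^3
  m (m - 1) / 6 times lam^(-3/2) is a^(3/2) m (m - 1) / (6 sqrt L), and the remaining factor 3
  \<open>C_TV\<close> is the integral of the absolute third derivative of the standard normal
  density, that is, the total variation of its second derivative, whose extrema lie at 0 and at plus
  and minus sqrt 3.\<close>

text \<open>\<open>z ^ j * expt j z\<close> is the remainder of the exponential series after \<open>j\<close> terms.\<close>

definition expt :: "nat \<Rightarrow> 'a \<Rightarrow> 'a::{real_normed_algebra_1,banach}" where
  "expt j z = (\<Sum>k. z ^ k /\<^sub>R fact (k + j))"

lemma fact_mult_le: "fact k * fact j \<le> (fact (k + j) :: real)"
proof -
  have "fact k * fact j \<le> (fact (k + j) :: nat)"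
    by (rule dvd_imp_le[OF fact_fact_dvd_fact]) simp
  then have "real (fact k * fact j) \<le> real (fact (k + j))" by (rule of_nat_mono)
  then show ?thesis by simp
qed

lemma norm_expt_term_le:
  fixes z :: "'a::{real_normed_algebra_1,banach}"
  shows "norm (z ^ k /\<^sub>R fact (k + j)) \<le> norm z ^ k /\<^sub>R fact k / fact j"
proof -
  have "norm (z ^ k /\<^sub>R fact (k + j)) \<le> norm z ^ k / fact (k + j)"
    using norm_power_ineq[of z k] by (simp add: divide_inverse mult_left_mono mult.commute)
  also have "... \<le> norm z ^ k / (fact k * fact j)"
    by (intro divide_left_mono fact_mult_le) auto
  finally show ?thesis by (simp add: field_simps)
qed

lemma expt_sums:
  fixes z :: "'a::{real_normed_algebra_1,banach}"
  shows "(\<lambda>k. z ^ k /\<^sub>R fact (k + j)) sums expt j z"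
  unfolding expt_def
proof (rule summable_sums, rule summable_comparison_test', rule summable_divide)
  show "summable (\<lambda>k. norm z ^ k /\<^sub>R fact k)" by (rule summable_exp_generic)
qed (rule norm_expt_term_le)

lemma norm_expt_le:
  fixes z :: "'a::{real_normed_algebra_1,banach}"
  shows "norm (expt j z) \<le> exp (norm z) / fact j"
proof -
  have e: "(\<lambda>k. norm z ^ k /\<^sub>R fact k / fact j) sums (exp (norm z) / fact j)"
    by (intro sums_divide exp_converges)
  have "norm (expt j z) \<le> (\<Sum>k. norm z ^ k /\<^sub>R fact k / fact j)"
    unfolding expt_def
    by (intro norm_suminf_le norm_expt_term_le sums_summable[OF e])
  then show ?thesis using sums_unique[OF e] by simp
qed

lemma expt_0 [simp]: "expt 0 z = exp z"
  by (simp add: expt_def exp_def)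

lemma expt_step:
  fixes z :: "'a::{real_normed_algebra_1,banach}"
  shows "expt j z = (1 / fact j) *\<^sub>R 1 + z * expt (Suc j) z"
proof -
  have "(\<lambda>k. z * (z ^ k /\<^sub>R fact (k + Suc j))) sums (z * expt (Suc j) z)"
    by (intro sums_mult expt_sums)
  then have "(\<lambda>k. z ^ Suc k /\<^sub>R fact (Suc k + j)) sums (z * expt (Suc j) z)" by simp
  then have "(\<lambda>k. z ^ k /\<^sub>R fact (k + j)) sums (z * expt (Suc j) z + z ^ 0 /\<^sub>R fact (0 + j))"
    by (subst (asm) sums_Suc_iff) simp
  from sums_unique2[OF expt_sums this] show ?thesis by (simp add: divide_inverse add.commute)
qed

lemma exp_eq_expt1: "exp z = 1 + z * expt 1 (z :: 'a::{real_normed_algebra_1,banach})"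
  using expt_step[of 0 z] by simp

lemma exp_eq_expt2: "exp z = 1 + z + z * z * expt 2 (z :: 'a::{real_normed_algebra_1,banach})"
  using expt_step[of 0 z] expt_step[of 1 z] by (simp add: algebra_simps numeral_2_eq_2)

text \<open>Source of most numerical constants: r = 1 / 10 gives 1.11 and r = 2 / 10 gives 1.24,
  each divided by \<open>fact j\<close>.\<close>

lemma norm_expt_le':
  fixes z :: "'a::{real_normed_algebra_1,banach}"
  assumes "norm z \<le> r" "r \<le> 1"
  shows "norm (expt j z) \<le> (1 + r + r\<^sup>2) / fact j"
proof -
  have "exp (norm z) \<le> exp r" using assms by simp
  also have "... \<le> 1 + r + r\<^sup>2" using assms norm_ge_zero[of z] by (intro exp_bound) linarith+
  finally have "exp (norm z) / fact j \<le> (1 + r + r\<^sup>2) / fact j" by (intro divide_right_mono) auto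
  then show ?thesis using norm_expt_le order_trans by blast
qed

text \<open>With the bounds as schematic variables, this rule and the next ones let
  \<open>intro\<close> walk the syntax tree of an element and assemble its bound. This is why
  constants further on are written in the shape of the elements that they bound.\<close>

lemma norm_mult_bound:
  fixes x y :: "'a::real_normed_algebra"
  assumes "norm x \<le> A" "norm y \<le> B"
  shows "norm (x * y) \<le> A * B"
  by (rule order_trans[OF norm_mult_ineq])
     (intro mult_mono assms norm_ge_zero order_trans[OF norm_ge_zero assms(1)])

lemma norm_add_bound:
  fixes x y :: "'a::real_normed_vector"
  assumes "norm x \<le> A" "norm y \<le> B"
  shows "norm (x + y) \<le> A + B"
  using assms norm_triangle_ineq[of x y] by linarith

lemma norm_diff_bound:
  fixes x y :: "'a::real_normed_vector"
  assumes "norm x \<le> A" "norm y \<le> B"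
  shows "norm (x - y) \<le> A + B"
  using assms norm_triangle_ineq4[of x y] by linarith

lemma norm_scaleR_bound:
  fixes x :: "'a::real_normed_vector"
  assumes "norm x \<le> A"
  shows "norm (c *\<^sub>R x) \<le> \<bar>c\<bar> * A"
  using assms by (simp add: mult_left_mono)

lemma norm_power_bound:
  fixes x :: "'a::real_normed_algebra_1"
  assumes "norm x \<le> A"
  shows "norm (x ^ k) \<le> A ^ k"
  by (rule order_trans[OF norm_power_ineq]) (intro power_mono assms norm_ge_zero)

lemmas norm_bounds = norm_mult_bound norm_add_bound norm_diff_bound norm_scaleR_bound norm_power_bound

text \<open>The class has no inverse operation, so the inverse is handed over as an element; it is
  the geometric series in - z.\<close>

lemma neumann_inverse:
  fixes z :: "'a::{real_normed_algebra_1,banach}"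
  assumes "norm z \<le> r" "r < 1"
  obtains v where "(1 + z) * v = 1" "norm v \<le> 1 / (1 - r)"
proof
  let ?z = "- z"
  have z: "norm ?z < 1" using assms by simp
  have s: "summable (\<lambda>i. ?z ^ i)" by (rule complete_algebra_summable_geometric[OF z])
  have "(\<Sum>i. ?z ^ i) = 1 + (\<Sum>i. ?z * ?z ^ i)"
    using suminf_split_head[OF s] by simp
  also have "(\<Sum>i. ?z * ?z ^ i) = ?z * (\<Sum>i. ?z ^ i)"
    by (rule suminf_mult[OF s])
  finally show "(1 + z) * (\<Sum>i. ?z ^ i) = 1" by (simp add: algebra_simps)
  have r: "0 \<le> r" using assms norm_ge_zero[of z] by linarith
  have g: "(\<lambda>i. r ^ i) sums (1 / (1 - r))" using assms r by (intro geometric_sums) simp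
  have "norm (\<Sum>i. ?z ^ i) \<le> (\<Sum>i. r ^ i)"
    by (intro norm_suminf_le sums_summable[OF g] norm_power_bound) (use assms in simp)
  then show "norm (\<Sum>i. ?z ^ i) \<le> 1 / (1 - r)" using sums_unique[OF g] by simp
qed

section \<open>The dominant root and its logarithm\<close>

class comm_banach_algebra = real_normed_algebra_1 + banach + comm_ring_1

text \<open>
  With \<open>c = m - 1\<close> and \<open>x = exp l\<close>, the equation \<open>exp (c l) (exp l - 1) = w\<close> reads \<open>x\<^sup>m - x\<^sup>m\<^sup>-\<^sup>1 = w\<close>;
  for \<open>c = 0\<close> its solution is the logarithm of \<open>1 + w\<close>.
\<close>

context
  fixes c :: real
  assumes c: "0 \<le> c"
begin

text \<open>The quotient (exp (c l) (exp l - 1) - l) / l^2, written as an entire function because l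
  need not be invertible.\<close>

definition log_quot :: "'a \<Rightarrow> 'a::comm_banach_algebra" where
  "log_quot l = expt 2 l + c *\<^sub>R (expt 1 (c *\<^sub>R l) * expt 1 l)"

lemma exp_eq_log_quot:
  fixes l :: "'a::comm_banach_algebra"
  shows "exp (c *\<^sub>R l) * (exp l - 1) = l + l * l * log_quot l"
proof -
  have 1: "expt 1 l = 1 + l * expt 2 l"
    using expt_step[of 1 l] by (simp add: numeral_2_eq_2)
  have "exp (c *\<^sub>R l) * (exp l - 1) = (1 + (c *\<^sub>R l) * expt 1 (c *\<^sub>R l)) * (l * expt 1 l)"
    unfolding exp_eq_expt1 by simp
  also have "... = l * expt 1 l + c *\<^sub>R (l * l * expt 1 (c *\<^sub>R l) * expt 1 l)"
    by (simp add: algebra_simps)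
  also have "l * expt 1 l = l + l * l * expt 2 l"
    by (subst 1) (simp add: algebra_simps)
  finally show ?thesis unfolding log_quot_def by (simp add: algebra_simps)
qed

lemma norm_small:
  fixes l :: "'a::comm_banach_algebra"
  assumes "norm l * (c + 1) \<le> 1 / 10"
  shows "norm l \<le> 1 / 10" "norm (c *\<^sub>R l) \<le> 1 / 10" "norm ((c + 1) *\<^sub>R l) \<le> 1 / 10"
proof -
  have "0 \<le> norm l * c" "0 \<le> norm l" using c by auto
  moreover have "norm l * (c + 1) = norm l * c + norm l" by (simp add: distrib_left)
  moreover have "norm (c *\<^sub>R l) = norm l * c" "norm ((c + 1) *\<^sub>R l) = norm l * (c + 1)"
    using c by (simp_all add: mult.commute)
  ultimately show "norm l \<le> 1 / 10" "norm (c *\<^sub>R l) \<le> 1 / 10" "norm ((c + 1) *\<^sub>R l) \<le> 1 / 10"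
    using assms by linarith+
qed

lemma norm_log_quot_le:
  fixes l :: "'a::comm_banach_algebra"
  assumes "norm l * (c + 1) \<le> 1 / 10"
  shows "norm (log_quot l) \<le> 1.25 * (c + 1)"
proof -
  note s = norm_small[OF assms]
  have "norm (expt 2 l) \<le> 1.11 / 2"
    using norm_expt_le'[OF s(1), of 2] by (simp add: power2_eq_square)
  moreover have "norm (expt 1 l) \<le> 1.11" "norm (expt 1 (c *\<^sub>R l)) \<le> 1.11"
    using norm_expt_le'[OF s(1), of 1] norm_expt_le'[OF s(2), of 1] by (simp_all add: power2_eq_square)
  ultimately have "norm (log_quot l) \<le> 1.11 / 2 + \<bar>c\<bar> * (1.11 * 1.11)"
    unfolding log_quot_def by (intro norm_bounds)
  also have "... \<le> 1.25 * (c + 1)" using c by simp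
  finally show ?thesis .
qed

text \<open>\<open>F\<close> has derivative 0 at 0. Instead of a mean value argument, the
  differences of exponentials are factored exactly, so that \<open>F l - F l'\<close> becomes - (l -
  l') \<open>?R\<close>; the linear parts cancel and every summand of \<open>?R\<close> contains a
  small factor.\<close>

lemma root_contraction:
  fixes l l' :: "'a::comm_banach_algebra"
  defines "F \<equiv> \<lambda>l::'a. l - exp (c *\<^sub>R l) * (exp l - 1)"
  assumes l: "norm l * (c + 1) \<le> 1 / 10" and l': "norm l' * (c + 1) \<le> 1 / 10"
  shows "norm (F l - F l') \<le> 1 / 2 * norm (l - l')"
proof -
  define d where "d = l - l'"
  note s = norm_small[OF l] and s' = norm_small[OF l']
  have ll: "l = l' + d" by (simp add: d_def)
  have d: "norm d \<le> 2 / 10" unfolding d_def using norm_triangle_ineq4[of l l'] s(1) s'(1) by linarith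
  have cd: "norm (c *\<^sub>R d) \<le> 2 / 10"
    unfolding d_def scaleR_diff_right using norm_triangle_ineq4[of "c *\<^sub>R l" "c *\<^sub>R l'"] s(2) s'(2) by linarith
  have e1: "exp (c *\<^sub>R l) - exp (c *\<^sub>R l') = exp (c *\<^sub>R l') * (c *\<^sub>R d * expt 1 (c *\<^sub>R d))"
  proof -
    have "exp (c *\<^sub>R l) = exp (c *\<^sub>R l') * exp (c *\<^sub>R d)"
      unfolding ll scaleR_add_right by (rule exp_add_commuting) (simp add: mult.commute)
    then show ?thesis unfolding exp_eq_expt1[of "c *\<^sub>R d"] by (simp add: algebra_simps)
  qed
  have e2: "exp l - exp l' = exp l' * (d * expt 1 d)"
  proof -
    have "exp l = exp l' * exp d"
      unfolding ll by (rule exp_add_commuting) (simp add: mult.commute)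
    then show ?thesis unfolding exp_eq_expt1[of d] by (simp add: algebra_simps)
  qed
  have e3: "exp (c *\<^sub>R l') * exp l' = exp ((c + 1) *\<^sub>R l')"
    by (subst exp_add_commuting[symmetric]) (auto simp: algebra_simps)
  have e4: "expt 1 d = 1 + d * expt 2 d"
    using expt_step[of 1 d] by (simp add: numeral_2_eq_2)
  let ?M = "(c + 1) *\<^sub>R l'"
  let ?R = "expt 1 (c *\<^sub>R d) * exp (c *\<^sub>R l') * (c *\<^sub>R l * expt 1 l)
      + (?M * expt 1 ?M + exp ?M * (d * expt 2 d))"
  have "F l - F l' = d - (exp (c *\<^sub>R l) - exp (c *\<^sub>R l')) * (exp l - 1) - exp (c *\<^sub>R l') * (exp l - exp l')"
    unfolding F_def d_def by (simp add: algebra_simps)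
  also have "... = d - exp (c *\<^sub>R l') * (c *\<^sub>R d * expt 1 (c *\<^sub>R d)) * (l * expt 1 l)
      - exp ?M * (d * expt 1 d)"
    unfolding e1 e2 e3[symmetric] mult.assoc unfolding exp_eq_expt1[of l] by simp
  also have "exp ?M * (d * expt 1 d) = d * (exp ?M + exp ?M * (d * expt 2 d))"
    unfolding e4 by (simp add: algebra_simps)
  also have "exp ?M + exp ?M * (d * expt 2 d) = 1 + ?M * expt 1 ?M + exp ?M * (d * expt 2 d)"
    using exp_eq_expt1[of ?M] by simp
  also have "d - exp (c *\<^sub>R l') * (c *\<^sub>R d * expt 1 (c *\<^sub>R d)) * (l * expt 1 l)
      - d * (1 + ?M * expt 1 ?M + exp ?M * (d * expt 2 d)) = - (d * ?R)"
    by (simp add: algebra_simps)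
  finally have eq: "F l - F l' = - (d * ?R)" .
  have b1: "norm (expt 1 l) \<le> 1.11" "norm (expt 1 ?M) \<le> 1.11" "norm (exp ?M) \<le> 1.11"
      "norm (exp (c *\<^sub>R l')) \<le> 1.11"
    using norm_expt_le'[OF s(1), of 1] norm_expt_le'[OF s'(3), of 1] norm_expt_le'[OF s'(3), of 0]
      norm_expt_le'[OF s'(2), of 0] by (simp_all add: power2_eq_square)
  have b2: "norm (expt 2 d) \<le> 0.62" "norm (expt 1 (c *\<^sub>R d)) \<le> 1.24"
    using norm_expt_le'[OF d, of 2] norm_expt_le'[OF cd, of 1] by (simp_all add: power2_eq_square)
  have "norm ?R \<le> 1.24 * 1.11 * (1 / 10 * 1.11) + (1 / 10 * 1.11 + 1.11 * (2 / 10 * 0.62))"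
    by (intro norm_add_bound norm_mult_bound b1 b2 s s' d)
  also have "... \<le> 1 / 2" by simp
  finally have "norm (F l - F l') \<le> norm d * (1 / 2)"
    unfolding eq norm_minus_cancel by (intro norm_mult_bound) auto
  then show ?thesis by (simp add: d_def)
qed

text \<open>The root is the fixed point of \<open>?T\<close>. On the ball of radius 1 / (10 (c + 1))
  the map is a contraction, and it maps the ball into itself because 1 / 20 + 1.25 / 100 < 1 / 10
  after scaling the norm by c + 1.\<close>

lemma root_exists:
  fixes w :: "'a::comm_banach_algebra"
  assumes w: "norm w * (c + 1) \<le> 1 / 20"
  obtains l where "exp (c *\<^sub>R l) * (exp l - 1) = w" "norm l * (c + 1) \<le> 1 / 10"
proof -
  let ?S = "cball (0::'a) (1 / 10 / (c + 1))"
  let ?T = "\<lambda>l::'a. w + (l - exp (c *\<^sub>R l) * (exp l - 1))"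
  have S: "l \<in> ?S \<longleftrightarrow> norm l * (c + 1) \<le> 1 / 10" for l
    using c by (simp add: pos_le_divide_eq divide_divide_eq_left field_simps)
  have map: "?T l \<in> ?S" if "l \<in> ?S" for l
  proof -
    have l: "norm l * (c + 1) \<le> 1 / 10" using that S by simp
    have "norm (?T l) = norm (w - l * l * log_quot l)"
      unfolding exp_eq_log_quot by (simp add: algebra_simps)
    also have "... \<le> norm w + norm l * norm l * (1.25 * (c + 1))"
      by (intro norm_bounds order_refl norm_log_quot_le l)
    finally have "norm (?T l) * (c + 1) \<le> (norm w + norm l * norm l * (1.25 * (c + 1))) * (c + 1)"
      using c by (intro mult_right_mono) auto
    also have "... = norm w * (c + 1) + 1.25 * (norm l * (c + 1)) * (norm l * (c + 1))"
      by (simp add: algebra_simps)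
    also have "... \<le> 1 / 20 + 1.25 * (1 / 10) * (1 / 10)"
      using l w c by (intro add_mono mult_mono) auto
    finally show ?thesis using S by simp
  qed
  have "\<exists>!l\<in>?S. ?T l = l"
  proof (rule Banach_fix[OF complete_eq_closed[THEN iffD2], of _ "1 / 2"])
    show "closed ?S" by simp
    show "?S \<noteq> {}" using c by simp
    show "?T ` ?S \<subseteq> ?S" using map by blast
    show "dist (?T l) (?T l') \<le> 1 / 2 * dist l l'" if "l \<in> ?S" "l' \<in> ?S" for l l'
      using root_contraction[of l l'] that[unfolded S] by (simp add: dist_norm)
  qed auto
  then obtain l where l: "l \<in> ?S" "?T l = l" by blast
  from l(2) have "exp (c *\<^sub>R l) * (exp l - 1) = w"
    by (metis add.commute add_diff_cancel_left' diff_add_cancel diff_eq_eq)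
  then show thesis using that l(1) S by blast
qed

text \<open>The quadratic Taylor remainder of \<open>log_quot\<close>, divided by l^2. The summand c
  / 4 is the product of the linear terms (c / 2) l and (1 / 2) l of the two factors.\<close>

definition log_quot2 :: "'a \<Rightarrow> 'a::comm_banach_algebra" where
  "log_quot2 l = expt 4 l + c *\<^sub>R (c\<^sup>2 *\<^sub>R expt 3 (c *\<^sub>R l) * expt 1 l
     + (1 + (c/2) *\<^sub>R l) * expt 3 l + (c / 4) *\<^sub>R 1)"

text \<open>The coefficients are those of exp ((c + 1) l) - exp (c l): ((c + 1)^2 - c^2) / 2 = 1/2 +
  c and ((c + 1)^3 - c^3) / 6 = 1/6 + c (c + 1) / 2.\<close>

lemma log_quot_expand:
  fixes l :: "'a::comm_banach_algebra"
  shows "log_quot l = (1/2 + c) *\<^sub>R 1 + (1/6 + c * (c + 1) / 2) *\<^sub>R l + l * l * log_quot2 l"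
proof -
  have 1: "expt 1 z = 1 + (1/2) *\<^sub>R z + z * z * expt 3 z" for z :: 'a
    using expt_step[of 1 z] expt_step[of 2 z]
    by (simp add: numeral_2_eq_2 numeral_3_eq_3 algebra_simps)
  have 2: "expt 2 l = (1/2) *\<^sub>R 1 + (1/6) *\<^sub>R l + l * l * expt 4 l"
    using expt_step[of 2 l] expt_step[of 3 l]
    by (simp add: eval_nat_numeral algebra_simps)
  have "log_quot l = expt 2 l + c *\<^sub>R ((1 + (c / 2) *\<^sub>R l) * expt 1 l + c\<^sup>2 *\<^sub>R (l * l * expt 3 (c *\<^sub>R l)) * expt 1 l)"
    unfolding log_quot_def 1[of "c *\<^sub>R l"] by (simp add: algebra_simps power2_eq_square)
  also have "(1 + (c / 2) *\<^sub>R l) * expt 1 l = (1 + (c / 2) *\<^sub>R l) * (1 + (1/2) *\<^sub>R l + l * l * expt 3 l)"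
    by (subst 1) simp
  also have "... = 1 + (c / 2 + 1 / 2) *\<^sub>R l + l * l * ((1 + (c / 2) *\<^sub>R l) * expt 3 l + (c / 4) *\<^sub>R 1)"
    by (simp add: algebra_simps)
  finally have "log_quot l = (1/2 + c) *\<^sub>R 1 + (1/6 + c * (c/2 + 1/2)) *\<^sub>R l + l * l * log_quot2 l"
    unfolding 2 log_quot2_def by (simp add: algebra_simps)
  then show ?thesis by (simp add: field_simps)
qed

lemma norm_log_quot2_le:
  fixes l :: "'a::comm_banach_algebra"
  assumes "norm l * (c + 1) \<le> 1 / 10"
  shows "norm (log_quot2 l) \<le> 2 + c * (4 * c\<^sup>2 + 5 + c)"
proof -
  note s = norm_small[OF assms]
  have b: "norm (expt 4 l) \<le> 2" "norm (expt 3 (c *\<^sub>R l)) \<le> 2" "norm (expt 1 l) \<le> 2" "norm (expt 3 l) \<le> 2"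
    using norm_expt_le'[OF s(1), of 4] norm_expt_le'[OF s(2), of 3] norm_expt_le'[OF s(1), of 1]
      norm_expt_le'[OF s(1), of 3]
    by (simp_all add: power2_eq_square fact_numeral)
  have s2: "norm ((c/2) *\<^sub>R l) \<le> 1" using s(2) by simp
  have "norm (log_quot2 l) \<le> 2 + \<bar>c\<bar> * (\<bar>c\<^sup>2\<bar> * 2 * 2 + (1 + 1) * 2 + \<bar>c / 4\<bar> * 1)"
    unfolding log_quot2_def by (intro norm_add_bound norm_mult_bound norm_scaleR_bound b s2) auto
  also have "... = 2 + c * (4 * c\<^sup>2 + 4 + c / 4)" using c by (simp add: algebra_simps)
  also have "... \<le> 2 + c * (4 * c\<^sup>2 + 5 + c)" using c by (intro add_mono mult_left_mono) auto
  finally show ?thesis .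
qed

text \<open>Inversion of w = l + g0 l^2 + g1 l^3 + ..., whose inverse series starts with w - g0 w^2
  + (2 g0^2 - g1) w^3. The remainder \<open>r\<close> carries an explicit bound because it must
  later fit under lam / 8; \<open>s\<close> only has to be bounded uniformly in w, hence
  \<open>C\<close> is quantified first.\<close>

lemma root_expansion:
  "\<exists>C. \<forall>w::'a::comm_banach_algebra. norm w * (c + 1) \<le> 1 / 20 \<longrightarrow>
     (\<exists>l r s. exp (c *\<^sub>R l) * (exp l - 1) = w \<and> norm l \<le> 6 / 5 * norm w \<and>
        l = w + w\<^sup>2 * r \<and> norm r \<le> 2 * (c + 1) \<and>
        l = w - (1/2 + c) *\<^sub>R w\<^sup>2 + (1/3 + 3/2 * c * (c + 1)) *\<^sub>R w ^ 3 + w ^ 4 * s \<and> norm s \<le> C)"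
proof -
  define g0 g1 K where "g0 = 1/2 + c" and "g1 = 1/6 + c * (c + 1) / 2"
    and "K = 2 + c * (4 * c\<^sup>2 + 5 + c)"
  \<comment> \<open>A bound for the element \<open>s\<close> defined below, obtained by replacing
    each factor of it by a norm bound.\<close>
  define C where "C = \<bar>2 * g0\<bar> * (2 * (\<bar>g1\<bar> * 1 + 1 * K) + 2 * (c + 1) * (1 + 2) * (1.25 * (c + 1)))
     + \<bar>g0\<bar> * (2 * (c + 1)) ^ 2 + \<bar>g1\<bar> * (2 * (c + 1) * (2 ^ 2 + 2 + 1)) + 2 ^ 4 * K"
  show ?thesis
  proof (intro exI[of _ C] allI impI)
    fix w :: 'a
    assume w: "norm w * (c + 1) \<le> 1 / 20"
    obtain l where leq: "exp (c *\<^sub>R l) * (exp l - 1) = w" and ln: "norm l * (c + 1) \<le> 1 / 10"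
      using root_exists[OF w] by blast
    define g where "g = log_quot l"
    define h where "h = log_quot2 l"
    have gn: "norm g \<le> 1.25 * (c + 1)" unfolding g_def by (rule norm_log_quot_le[OF ln])
    have hn: "norm h \<le> K" unfolding h_def K_def by (rule norm_log_quot2_le[OF ln])
    have gh: "g = g0 *\<^sub>R 1 + g1 *\<^sub>R l + l * l * h"
      unfolding g_def h_def g0_def g1_def by (rule log_quot_expand)
    have wl: "w = l * (1 + l * g)"
      using exp_eq_log_quot[of l] leq by (simp add: g_def algebra_simps)
    have "norm (l * g) \<le> norm l * (1.25 * (c + 1))" by (intro norm_mult_bound gn order_refl)
    also have "... \<le> 1 / 8" using ln by (simp add: algebra_simps)
    finally have lg: "norm (l * g) \<le> 1 / 8" .
    obtain v where v: "(1 + l * g) * v = 1" "norm v \<le> 8 / 7"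
      by (rule neumann_inverse[OF lg]) auto
    have lv: "l = w * v" unfolding wl using v(1) by (simp add: mult.assoc)
    define r where "r = - (v\<^sup>2 * g)"
    have l1: "l = w + w\<^sup>2 * r"
    proof -
      have "l + l * l * g = w" using wl by (simp add: algebra_simps)
      then have "l = w - l * l * g" by (metis add_diff_cancel_right')
      also have "l * l * g = (w * v) * (w * v) * g" using lv by simp
      finally show ?thesis by (simp add: r_def power2_eq_square algebra_simps)
    qed
    have "norm r \<le> (8 / 7)\<^sup>2 * (1.25 * (c + 1))"
      unfolding r_def norm_minus_cancel by (intro norm_bounds v gn)
    also have "... \<le> 2 * (c + 1)" using c by (simp add: power2_eq_square)
    finally have rn: "norm r \<le> 2 * (c + 1)" .
    have v1: "v = 1 + w * r"
    proof -
      have "v = 1 - l * g * v" using v(1) by (simp add: algebra_simps)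
      also have "l * g * v = w * v * g * v" using lv by simp
      finally show ?thesis by (simp add: r_def power2_eq_square algebra_simps)
    qed
    have ln1: "norm l \<le> 1" using norm_small[OF ln] by simp
    have vn: "norm v \<le> 2" using v(2) by simp
    \<comment> \<open>This is the quadratic rest of r = - v^2 g as a series in w: powers of v are
      expanded through w r = v - 1, and the one remaining linear occurrence of r is replaced by - g0
      - w B, where B is the bracket multiplied by 2 g0.\<close>
    define s where "s = (2 * g0) *\<^sub>R (v * (g1 *\<^sub>R 1 + l * h) + r * (1 + v) * g)
       - g0 *\<^sub>R r ^ 2 - g1 *\<^sub>R (r * (v ^ 2 + v + 1)) - v ^ 4 * h"
    have "norm s \<le> C"
      unfolding s_def C_def
      by (intro norm_add_bound norm_diff_bound norm_mult_bound norm_scaleR_bound norm_power_bound vn ln1 rn gn hn) auto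
    moreover have "l = w - g0 *\<^sub>R w\<^sup>2 + (2 * g0\<^sup>2 - g1) *\<^sub>R w ^ 3 + w ^ 4 * s"
    proof -
      \<comment> \<open>The real coefficients become algebra elements, so that ring normalisation
        treats them like every other factor.\<close>
      define G0 G1 where "G0 = (of_real g0 :: 'a)" and "G1 = (of_real g1 :: 'a)"
      have S: "g0 *\<^sub>R z = G0 * z" "g1 *\<^sub>R z = G1 * z" "(2 * g0) *\<^sub>R z = 2 * G0 * z"
        "(2 * g0\<^sup>2 - g1) *\<^sub>R z = (2 * G0\<^sup>2 - G1) * z" for z
        unfolding G0_def G1_def
        by (simp_all add: scaleR_conv_of_real)
      define B where "B = v * (G1 + l * h) + r * (1 + v) * g"
      have s: "s = 2 * G0 * B - G0 * r ^ 2 - G1 * (r * (v ^ 2 + v + 1)) - v ^ 4 * h"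
        unfolding s_def S B_def by simp
      have G: "g = G0 + G1 * l + l * l * h" using gh S by simp
      have wr: "w * r = v - 1" using v1 by simp
      have v2: "v * v = 1 + w * r * (1 + v)" unfolding wr by (simp add: algebra_simps)
      have "r = - ((1 + w * r * (1 + v)) * g)" unfolding v2[symmetric] by (simp add: r_def power2_eq_square)
      also have "... = - g - w * r * (1 + v) * g" by (simp add: algebra_simps)
      also have "- g = - G0 - G1 * (w * v) - (w * v) * l * h" using G lv by simp
      finally have r1: "r = - G0 - w * B" unfolding B_def by (simp add: algebra_simps)
      have v2': "v * v = 1 + 2 * w * r + w * w * r * r"
      proof -
        have "v * v = 1 + 2 * (w * r) + (w * r) * (w * r)" unfolding wr by (simp add: algebra_simps)
        then show ?thesis by (simp add: algebra_simps)
      qed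
      have v3: "v * v * v = 1 + w * r * (v * v + v + 1)" unfolding wr by (simp add: algebra_simps)
      have "r = - (v * v) * (G0 + G1 * (w * v) + (w * v) * (w * v) * h)"
        using G lv by (simp add: r_def power2_eq_square)
      also have "... = - G0 * (v * v) - G1 * w * (v * v * v) - w * w * (v * v * v * v) * h"
        by (simp add: algebra_simps)
      also have "... = - G0 * (1 + 2 * w * r + w * w * r * r) - G1 * w * (1 + w * r * (v * v + v + 1))
          - w * w * (v * v * v * v) * h"
        by (simp only: v2'[symmetric] v3[symmetric])
      also have "... = - G0 - 2 * G0 * w * r - G1 * w
          + w * w * (- G0 * r * r - G1 * r * (v * v + v + 1) - v * v * v * v * h)"
        by (simp add: algebra_simps)
      also have "2 * G0 * w * r = 2 * G0 * w * (- G0 - w * B)" by (simp only: r1[symmetric])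
      finally have r2: "r = - G0 + (2 * G0 * G0 - G1) * w + w * w * s"
        unfolding s by (simp add: algebra_simps power2_eq_square power4_eq_xxxx)
      have "l = w + w * w * (- G0 + (2 * G0 * G0 - G1) * w + w * w * s)"
        unfolding r2[symmetric] using l1 by (simp add: power2_eq_square)
      then show ?thesis unfolding S by (simp add: algebra_simps power2_eq_square power3_eq_cube power4_eq_xxxx)
    qed
    moreover have "2 * g0\<^sup>2 - g1 = 1/3 + 3/2 * c * (c + 1)"
      by (simp add: g0_def g1_def power2_eq_square field_simps)
    moreover have "norm l \<le> 6 / 5 * norm w"
    proof -
      have "norm l \<le> norm w * (8 / 7)" unfolding lv by (intro norm_mult_bound v) simp
      also have "... \<le> norm w * (6 / 5)" by (intro mult_left_mono) auto
      finally show ?thesis by simp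
    qed
    ultimately show "\<exists>l r s. exp (c *\<^sub>R l) * (exp l - 1) = w \<and> norm l \<le> 6 / 5 * norm w \<and>
        l = w + w\<^sup>2 * r \<and> norm r \<le> 2 * (c + 1) \<and>
        l = w - (1/2 + c) *\<^sub>R w\<^sup>2 + (1/3 + 3/2 * c * (c + 1)) *\<^sub>R w ^ 3 + w ^ 4 * s \<and> norm s \<le> C"
      using leq l1 rn unfolding g0_def by (intro exI[of _ l] exI[of _ r] exI[of _ s]) auto
  qed
qed

end

lemma log_one_plus_expansion:
  "\<exists>C. \<forall>w::'a::comm_banach_algebra. norm w \<le> 1 / 20 \<longrightarrow>
     (\<exists>l r s. exp l = 1 + w \<and> norm l \<le> 6 / 5 * norm w \<and> l = w + w\<^sup>2 * r \<and> norm r \<le> 2 \<and>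
        l = w - (1/2) *\<^sub>R w\<^sup>2 + (1/3) *\<^sub>R w ^ 3 + w ^ 4 * s \<and> norm s \<le> C)"
proof -
  obtain C where C: "\<forall>w::'a. norm w * (0 + 1) \<le> 1 / 20 \<longrightarrow>
     (\<exists>l r s. exp (0 *\<^sub>R l) * (exp l - 1) = w \<and> norm l \<le> 6 / 5 * norm w \<and>
        l = w + w\<^sup>2 * r \<and> norm r \<le> 2 * (0 + 1) \<and>
        l = w - (1/2 + 0) *\<^sub>R w\<^sup>2 + (1/3 + 3/2 * 0 * (0 + 1)) *\<^sub>R w ^ 3 + w ^ 4 * s \<and> norm s \<le> C)"
    using root_expansion[of 0, where 'a = 'a] by blast
  show ?thesis
  proof (intro exI[of _ C] allI impI)
    fix w :: 'a assume "norm w \<le> 1 / 20"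
    then have "norm w * (0 + 1) \<le> 1 / 20" by simp
    from C[rule_format, OF this] obtain l r s where "exp (0 *\<^sub>R l) * (exp l - 1) = w" "norm l \<le> 6 / 5 * norm w"
      "l = w + w\<^sup>2 * r" "norm r \<le> 2 * (0 + 1)"
      "l = w - (1/2 + 0) *\<^sub>R w\<^sup>2 + (1/3 + 3/2 * 0 * (0 + 1)) *\<^sub>R w ^ 3 + w ^ 4 * s" "norm s \<le> C" by blast
    then show "\<exists>l r s. exp l = 1 + w \<and> norm l \<le> 6 / 5 * norm w \<and> l = w + w\<^sup>2 * r \<and> norm r \<le> 2 \<and>
        l = w - (1/2) *\<^sub>R w\<^sup>2 + (1/3) *\<^sub>R w ^ 3 + w ^ 4 * s \<and> norm s \<le> C"
      by (intro exI[of _ l] exI[of _ r] exI[of _ s]) (simp add: algebra_simps)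
  qed
qed

section \<open>Smoothing\<close>

text \<open>Z is a power series in u^2 dominated coefficientwise by exp (T u^2). This keeps track of
  the powers of u, which smoothing can absorb, whereas a norm bound on Z would be exponential in
  T.\<close>

definition majorized :: "'a \<Rightarrow> real \<Rightarrow> 'a::comm_banach_algebra \<Rightarrow> bool" where
  "majorized u T Z \<longleftrightarrow> (\<exists>e. (\<forall>r. norm (e r) \<le> T ^ r / fact r) \<and> (\<lambda>r. u ^ (2 * r) * e r) sums Z)"

lemma majorized_expt:
  fixes z :: "'a::comm_banach_algebra"
  assumes "norm z \<le> T"
  shows "majorized u T (expt j (u\<^sup>2 * z))"
  unfolding majorized_def
proof (intro exI conjI allI)
  have T: "0 \<le> T" using assms norm_ge_zero order_trans by blast
  show "norm (z ^ r /\<^sub>R fact (r + j)) \<le> T ^ r / fact r" for r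
  proof -
    have "norm (z ^ r /\<^sub>R fact (r + j)) \<le> norm z ^ r /\<^sub>R fact r / fact j"
      by (rule norm_expt_term_le)
    also have "... \<le> T ^ r / fact r / 1"
      unfolding real_scaleR_def using T assms
      by (intro frac_le) (auto simp: divide_inverse mult.commute intro!: mult_left_mono power_mono)
    finally show ?thesis by simp
  qed
  show "(\<lambda>r. u ^ (2 * r) * (z ^ r /\<^sub>R fact (r + j))) sums expt j (u\<^sup>2 * z)"
    using expt_sums[where z = "u\<^sup>2 * z" and j = j] by (simp add: power_mult_distrib power_mult)
qed

lemma majorized_summable:
  fixes e :: "nat \<Rightarrow> 'a::comm_banach_algebra"
  assumes "\<And>r. norm (e r) \<le> T ^ r / fact r"
  shows "summable (\<lambda>r. norm (u ^ (2 * r) * e r))"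
proof (rule summable_comparison_test')
  show "summable (\<lambda>r. ((norm u)\<^sup>2 * T) ^ r /\<^sub>R fact r)" by (rule summable_exp_generic)
  show "norm (norm (u ^ (2 * r) * e r)) \<le> ((norm u)\<^sup>2 * T) ^ r /\<^sub>R fact r" for r
  proof -
    have "norm (u ^ (2 * r) * e r) \<le> norm u ^ (2 * r) * (T ^ r / fact r)"
      by (intro norm_mult_bound norm_power_bound assms order_refl)
    also have "... = ((norm u)\<^sup>2 * T) ^ r /\<^sub>R fact r"
      unfolding power_mult power_mult_distrib by (simp add: divide_inverse)
    finally show ?thesis by simp
  qed
qed

text \<open>The Cauchy product and the binomial theorem, as in exp (S u^2) exp (T u^2) = exp ((S +
  T) u^2).\<close>

lemma majorized_mult:
  fixes Z :: "'a::comm_banach_algebra"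
  assumes "majorized u S W" "majorized u T Z"
  shows "majorized u (S + T) (W * Z)"
proof -
  obtain e f where e: "\<And>r. norm (e r) \<le> S ^ r / fact r" "(\<lambda>r. u ^ (2 * r) * e r) sums W"
    and f: "\<And>r. norm (f r) \<le> T ^ r / fact r" "(\<lambda>r. u ^ (2 * r) * f r) sums Z"
    using assms unfolding majorized_def by blast
  have "(\<lambda>k. \<Sum>i\<le>k. (u ^ (2 * i) * e i) * (u ^ (2 * (k - i)) * f (k - i))) sums
      ((\<Sum>k. u ^ (2 * k) * e k) * (\<Sum>k. u ^ (2 * k) * f k))"
    by (intro Cauchy_product_sums majorized_summable[OF e(1)] majorized_summable[OF f(1)])
  moreover have "(\<Sum>i\<le>k. (u ^ (2 * i) * e i) * (u ^ (2 * (k - i)) * f (k - i))) =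
      u ^ (2 * k) * (\<Sum>i\<le>k. e i * f (k - i))" for k
    unfolding sum_distrib_left
  proof (rule sum.cong)
    fix i assume "i \<in> {..k}"
    then have "2 * k = 2 * i + 2 * (k - i)" by simp
    then have "u ^ (2 * k) = u ^ (2 * i) * u ^ (2 * (k - i))" by (metis power_add)
    then show "(u ^ (2 * i) * e i) * (u ^ (2 * (k - i)) * f (k - i)) = u ^ (2 * k) * (e i * f (k - i))"
      by (simp add: algebra_simps)
  qed simp
  ultimately have "(\<lambda>k. u ^ (2 * k) * (\<Sum>i\<le>k. e i * f (k - i))) sums (W * Z)"
    using e(2) f(2) by (simp add: sums_unique[symmetric])
  moreover have "norm (\<Sum>i\<le>k. e i * f (k - i)) \<le> (S + T) ^ k / fact k" for k
  proof -
    have "norm (\<Sum>i\<le>k. e i * f (k - i)) \<le> (\<Sum>i\<le>k. S ^ i / fact i * (T ^ (k - i) / fact (k - i)))"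
      by (intro sum_norm_le norm_mult_bound e f)
    also have "... = (\<Sum>i\<le>k. (of_nat (k choose i) * S ^ i * T ^ (k - i)) / fact k)"
      by (intro sum.cong refl) (simp add: binomial_fact)
    also have "... = (S + T) ^ k / fact k"
      by (simp add: binomial_ring sum_divide_distrib)
    finally show ?thesis .
  qed
  ultimately show ?thesis
    unfolding majorized_def by (intro exI[of _ "\<lambda>k. \<Sum>i\<le>k. e i * f (k - i)"]) auto
qed

text \<open>r^r / r! is a single term of the exponential series at r.\<close>

lemma power_self_le_exp_fact: "real r ^ r / fact r \<le> exp 1 ^ r"
proof -
  have "real r ^ r /\<^sub>R fact r \<le> (\<Sum>k. real r ^ k /\<^sub>R fact k)"
    using sum_le_suminf[OF summable_exp_generic, of "{r}" "real r"] by simp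
  then have "real r ^ r / fact r \<le> exp (real r)" by (simp add: exp_def divide_inverse mult.commute)
  then show ?thesis by (simp flip: exp_of_nat_mult)
qed

lemma exp_scaleR_nat:
  fixes z :: "'a::{real_normed_algebra_1,banach}"
  shows "exp (real k *\<^sub>R z) = exp z ^ k"
proof (induction k)
  case (Suc k)
  have "exp (real (Suc k) *\<^sub>R z) = exp (z + real k *\<^sub>R z)" by (simp add: scaleR_add_left)
  also have "... = exp z * exp (real k *\<^sub>R z)" by (rule exp_add_commuting) simp
  finally show ?case using Suc by simp
qed simp

text \<open>Isolates the two properties of the Poisson semigroup exp (t u) on which all error
  estimates rest: it has norm at most 1, and one difference gains a factor of order
  t^(-1/2).\<close>

locale smoothing =
  fixes u :: "'a::comm_banach_algebra"
  assumes norm_exp_le: "t \<ge> 0 \<Longrightarrow> norm (exp (t *\<^sub>R u)) \<le> 1"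
    and norm_u_exp_le: "t > 0 \<Longrightarrow> norm (u * exp (t *\<^sub>R u)) \<le> 1 / sqrt t"
begin

text \<open>Splitting exp (t u) into s equal factors gives each u its own exponential with time t /
  s.\<close>

lemma norm_u_power_exp_le:
  assumes "t > 0"
  shows "norm (u ^ s * exp (t *\<^sub>R u)) \<le> sqrt (real s / t) ^ s"
proof (cases "s = 0")
  case False
  have "u ^ s * exp (t *\<^sub>R u) = (u * exp ((t / real s) *\<^sub>R u)) ^ s"
    using False exp_scaleR_nat[of s "(t / real s) *\<^sub>R u"] by (simp add: power_mult_distrib)
  also have "norm ... \<le> (1 / sqrt (t / real s)) ^ s"
    by (intro norm_power_bound norm_u_exp_le) (use assms False in simp)
  finally show ?thesis by (simp add: real_sqrt_divide)
qed (use norm_exp_le assms in simp)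

text \<open>
  A quarter of \<open>exp (lam u)\<close> absorbs \<open>u\<^sup>s\<close>; the rest, cut into \<open>2 r\<close> equal pieces, absorbs the factor
  \<open>u\<^sup>2\<^sup>r\<close> of the \<open>r\<close>-th term. The resulting series is geometric with ratio \<open>exp 1 / 3\<close>.
\<close>

lemma majorized_smoothing:
  assumes Z: "majorized u T Z" and T: "0 \<le> T" "T \<le> lam / 8" and lam: "0 < lam"
  shows "norm (u ^ s * exp (lam *\<^sub>R u) * Z) \<le> 11 * sqrt (4 * real s / lam) ^ s"
proof -
  obtain e where e: "\<And>r. norm (e r) \<le> T ^ r / fact r" "(\<lambda>r. u ^ (2 * r) * e r) sums Z"
    using Z unfolding majorized_def by blast
  let ?A = "u ^ s * exp ((lam / 4) *\<^sub>R u)" and ?B = "exp ((3 * lam / 4) *\<^sub>R u)"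
  have split: "exp (lam *\<^sub>R u) = exp ((lam / 4) *\<^sub>R u) * ?B"
    by (subst exp_add_commuting[symmetric]) (auto simp flip: scaleR_add_left)
  have A: "norm ?A \<le> sqrt (4 * real s / lam) ^ s"
    using norm_u_power_exp_le[of "lam / 4" s] lam by (simp add: mult.commute)
  have s: "(\<lambda>r. ?B * (u ^ (2 * r) * e r)) sums (?B * Z)" by (intro sums_mult e)
  have le: "norm (?B * (u ^ (2 * r) * e r)) \<le> (exp 1 / 3) ^ r" for r
  proof -
    have "sqrt (real (2 * r) / (3 * lam / 4)) ^ (2 * r) = (8 * real r / (3 * lam)) ^ r"
      using lam unfolding power_mult by (subst real_sqrt_pow2) (simp_all add: mult.commute)
    then have "norm (u ^ (2 * r) * ?B) \<le> (8 * real r / (3 * lam)) ^ r"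
      using norm_u_power_exp_le[of "3 * lam / 4" "2 * r"] lam by simp
    then have "norm ((u ^ (2 * r) * ?B) * e r) \<le> (8 * real r / (3 * lam)) ^ r * (T ^ r / fact r)"
      by (intro norm_mult_bound e)
    \<comment> \<open>The bound lam / 8 on T is made for this step: it cancels the 8 / lam from the
      smoothing and leaves (r / 3)^r / r!, which is at most (exp 1 / 3)^r with exp 1 < 3.\<close>
    also have "... \<le> (8 * real r / (3 * lam)) ^ r * ((lam / 8) ^ r / fact r)"
      using T lam by (intro mult_left_mono divide_right_mono power_mono) auto
    also have "... = (real r ^ r / fact r) * (1 / 3) ^ r"
      using lam by (simp add: power_mult_distrib power_divide)
    also have "... \<le> exp 1 ^ r * (1 / 3) ^ r"
      by (intro mult_right_mono power_self_le_exp_fact) simp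
    finally show ?thesis by (simp add: power_divide mult_ac)
  qed
  \<comment> \<open>The factor 11 in the conclusion is 1 / (1 - 10 / 11).\<close>
  have e3: "exp 1 / 3 \<le> (10 / 11 :: real)" using e_less_272 by simp
  have g: "(\<lambda>r. (exp 1 / 3 :: real) ^ r) sums (1 / (1 - exp 1 / 3))"
    using e3 by (intro geometric_sums) simp
  have "norm (?B * Z) \<le> (\<Sum>r. (exp 1 / 3) ^ r)"
    unfolding sums_unique[OF s] by (intro norm_suminf_le le sums_summable[OF g])
  also have "... \<le> 11"
  proof -
    have "1 / (1 - exp 1 / 3) \<le> 1 / (1 / 11 :: real)" using e3 by (intro divide_left_mono) auto
    then show ?thesis using sums_unique[OF g] by simp
  qed
  finally have "norm (?A * (?B * Z)) \<le> sqrt (4 * real s / lam) ^ s * 11"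
    by (intro norm_mult_bound A)
  then show ?thesis unfolding split by (simp add: mult_ac)
qed

end

section \<open>The linear recursion\<close>

text \<open>
  The differences \<open>e j = G j - x G (j - 1)\<close> solve the recursion whose characteristic polynomial is the
  original one divided by \<open>t - x\<close>, hence they decay; dually, \<open>K\<close> is the combination of shifts that
  removes all solutions except multiples of \<open>x\<^sup>n\<close>.
\<close>

lemma dominant_root:
  fixes w l :: "'a::comm_banach_algebra" and G :: "nat \<Rightarrow> 'a" and m :: nat
  assumes m: "2 \<le> m"
    and root: "exp ((real m - 1) *\<^sub>R l) * (exp l - 1) = w" and l: "norm l * real m \<le> 1 / 10"
    and init: "\<And>j. j < m \<Longrightarrow> G j = 1" and rec: "\<And>n. m \<le> n \<Longrightarrow> G n = G (n - 1) + w * G (n - m)"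
    and \<theta>: "0 < \<theta>" "\<theta> ^ m = 1 / 2" and n: "m \<le> n"
  shows "norm (G n * (1 + real m *\<^sub>R (exp l - 1)) - exp (Suc n *\<^sub>R l)) \<le> 4 * (real m)\<^sup>2 * \<theta> ^ n"
proof -
  define x where "x = exp l"
  define y where "y = x - 1"
  have xpow: "exp (real k *\<^sub>R l) = x ^ k" for k
    by (simp add: x_def exp_scaleR_nat)
  have wy: "w = y * x ^ (m - 1)"
    using root m unfolding y_def x_def[symmetric]
    using xpow[of "m - 1"] by (simp add: of_nat_diff mult.commute)
  have xk: "norm (x ^ k) \<le> 1.11" if "k \<le> m" for k
  proof -
    have "norm (real k *\<^sub>R l) \<le> real m * norm l" using that by (simp add: mult_right_mono)
    also have "... \<le> 1 / 10" using l by (simp add: mult.commute)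
    finally have "norm (exp (real k *\<^sub>R l)) \<le> 1.11"
      using norm_expt_le'[of "real k *\<^sub>R l" "1/10" 0] by (simp add: power2_eq_square)
    then show ?thesis unfolding xpow .
  qed
  have yn: "norm y * real m \<le> 0.111"
  proof -
    have "norm l * 2 \<le> norm l * real m" using m by (intro mult_left_mono) auto
    then have l1: "norm l \<le> 1 / 10" using l by linarith
    have "y = l * expt 1 l" unfolding y_def x_def exp_eq_expt1[of l] by simp
    also have "norm ... \<le> norm l * 1.11"
      using norm_expt_le'[OF l1, of 1] by (intro norm_mult_bound) (auto simp: power2_eq_square)
    finally have "norm y * real m \<le> norm l * 1.11 * real m" by (intro mult_right_mono) auto
    then show ?thesis using l by (simp add: mult_ac)
  qed
  have \<theta>1: "\<theta> < 1"
  proof (rule ccontr)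
    assume "\<not> \<theta> < 1"
    then have "1 \<le> \<theta> ^ m" by (simp add: one_le_power)
    with \<theta> show False by simp
  qed
  have \<theta>mono: "\<theta> ^ i \<le> \<theta> ^ j" if "j \<le> i" for i j
    using that \<theta> \<theta>1 by (intro power_decreasing) auto
  define e where "e j = G j - x * G (j - 1)" for j
  have telescope: "x ^ i * G (k - i) = G k - (\<Sum>j<i. x ^ j * e (k - j))" for i k
  proof (induction i)
    case (Suc i)
    have "x ^ Suc i * G (k - Suc i) = x ^ i * (G (k - i) - e (k - i))"
      by (simp add: e_def algebra_simps)
    also have "... = G k - (\<Sum>j<i. x ^ j * e (k - j)) - x ^ i * e (k - i)"
      unfolding right_diff_distrib Suc ..
    finally show ?case by (simp add: algebra_simps)
  qed simp
  have erec: "e k = - y * (\<Sum>j<m - 1. x ^ j * e (k - 1 - j))" if "m \<le> k" for k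
  proof -
    have "x ^ (m - 1) * G (k - m) = G (k - 1) - (\<Sum>j<m - 1. x ^ j * e (k - 1 - j))"
      using telescope[of "m - 1" "k - 1"] m that by (simp add: Suc_diff_Suc numeral_2_eq_2)
    then have S: "(\<Sum>j<m - 1. x ^ j * e (k - 1 - j)) = G (k - 1) - x ^ (m - 1) * G (k - m)"
      by (simp only: eq_diff_eq add.commute)
    have "e k = G (k - 1) + y * x ^ (m - 1) * G (k - m) - x * G (k - 1)"
      unfolding e_def rec[OF that] wy ..
    then show ?thesis unfolding S by (simp add: y_def algebra_simps)
  qed
  \<comment> \<open>The recursion for \<open>e\<close> has m - 1 terms of total weight at most 1.11
    m |y|, which is below 1 / 2 = \<theta>^m. This pays for reaching back by as many as m
    indices.\<close>
  have ebound: "norm (e k) \<le> \<theta> ^ k" if "1 \<le> k" for k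
    using that
  proof (induction k rule: less_induct)
    case (less k)
    show ?case
    proof (cases "k < m")
      case True
      then have "e k = - y" using init[of k] init[of "k - 1"] by (simp add: e_def y_def)
      then have "norm (e k) = norm y" by simp
      also have "... \<le> norm y * real m" using m by (simp add: mult_left_mono[of 1 "real m" "norm y"] mult_le_cancel_left1)
      also have "... \<le> \<theta> ^ m" using yn \<theta> by simp
      also have "... \<le> \<theta> ^ k" using True by (intro \<theta>mono) simp
      finally show ?thesis .
    next
      case False
      have "norm (\<Sum>j<m - 1. x ^ j * e (k - 1 - j)) \<le> (\<Sum>j<m - 1. 1.11 * \<theta> ^ (k - m))"
      proof (intro sum_norm_le norm_mult_bound)
        fix j assume j: "j \<in> {..<m - 1}"
        show "norm (x ^ j) \<le> 1.11" using j by (intro xk) auto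
        have "norm (e (k - 1 - j)) \<le> \<theta> ^ (k - 1 - j)"
          using j False by (intro less) auto
        also have "... \<le> \<theta> ^ (k - m)" using j by (intro \<theta>mono) auto
        finally show "norm (e (k - 1 - j)) \<le> \<theta> ^ (k - m)" .
      qed
      also have "... \<le> real m * (1.11 * \<theta> ^ (k - m))"
        using \<theta> by (simp add: mult_right_mono)
      finally have "norm (e k) \<le> norm y * (real m * (1.11 * \<theta> ^ (k - m)))"
        unfolding erec[OF leI[OF False]] mult_minus_left norm_minus_cancel by (intro norm_mult_bound) auto
      also have "... = (norm y * real m) * 1.11 * \<theta> ^ (k - m)" by simp
      also have "... \<le> 1 / 2 * \<theta> ^ (k - m)" using yn \<theta> by (intro mult_right_mono) (simp_all add: mult.commute)
      also have "... = \<theta> ^ k"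
        unfolding \<theta>(2)[symmetric] power_add[symmetric] using False by simp
      finally show ?thesis .
    qed
  qed
  define K where "K k = x * G k + y * (\<Sum>i<m - 1. x ^ Suc i * G (k - Suc i))" for k
  have K: "K k = x ^ Suc k" if "m - 1 \<le> k" for k
    using that
  proof (induction k rule: dec_induct)
    case base
    have "(\<Sum>i<m - 1. x ^ Suc i * G (m - 1 - Suc i)) = (\<Sum>i<m - 1. x ^ Suc i)"
      using m by (intro sum.cong refl) (auto simp: init)
    also have "... = x * (\<Sum>i<m - 1. x ^ i)" by (simp add: sum_distrib_left)
    finally have "K (m - 1) = x * (1 + y * (\<Sum>i<m - 1. x ^ i))"
      unfolding K_def using m by (simp add: init algebra_simps)
    also have "y * (\<Sum>i<m - 1. x ^ i) = x ^ (m - 1) - 1"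
      unfolding y_def using power_diff_1_eq[of x "m - 1"] by simp
    finally show ?case by simp
  next
    case (step k)
    have k: "m \<le> Suc k" using step m by simp
    let ?S = "\<Sum>i<m - 1. x ^ Suc i * G (k - Suc i)"
    have mS: "m - 1 = Suc (m - 2)" using m by simp
    have "(\<Sum>i<m - 1. x ^ Suc i * G (Suc k - Suc i)) = x * G k + x * (\<Sum>i<m - 2. x ^ Suc i * G (k - Suc i))"
      unfolding mS sum.lessThan_Suc_shift by (simp add: sum_distrib_left mult_ac)
    also have "(\<Sum>i<m - 2. x ^ Suc i * G (k - Suc i)) = ?S - x ^ (m - 1) * G (Suc k - m)"
      unfolding mS sum.lessThan_Suc using m by (simp add: Suc_diff_Suc numeral_2_eq_2)
    finally have S: "(\<Sum>i<m - 1. x ^ Suc i * G (Suc k - Suc i)) = x * G k + x * (?S - x ^ (m - 1) * G (Suc k - m))" .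
    have "K (Suc k) = x * (G (Suc k) + y * G k + y * ?S - y * x ^ (m - 1) * G (Suc k - m))"
    proof -
      have "x * g + y * (x * h + x * (s - p * t)) = x * (g + y * h + y * s - y * p * t)" for g h s p t
        by (simp add: algebra_simps)
      then show ?thesis unfolding K_def S .
    qed
    also have "G (Suc k) = G k + y * x ^ (m - 1) * G (Suc k - m)"
      using rec[OF k] wy by simp
    finally have "K (Suc k) = x * (G k + y * G k + y * ?S)" by (simp add: algebra_simps)
    also have "... = x * K k" unfolding K_def y_def by (simp add: algebra_simps)
    finally show ?case using step by simp
  qed
  \<comment> \<open>Telescoping replaces every earlier G in K n by G n, up to decaying terms. The
    weights then add up to x + (m - 1) y = 1 + m y, which is the derivative of t^m - t^(m-1) at x,
    divided by x^(m-2): the usual residue factor of a simple root.\<close>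
  have "x ^ Suc n = x * G n + y * (\<Sum>i<m - 1. G n - (\<Sum>j<Suc i. x ^ j * e (n - j)))"
    using K[of n] n unfolding K_def telescope by simp
  also have "... = G n * (x + of_nat (m - 1) * y) - y * (\<Sum>i<m - 1. \<Sum>j<Suc i. x ^ j * e (n - j))"
    by (simp add: sum_subtractf algebra_simps)
  also have "x + of_nat (m - 1) * y = 1 + real m *\<^sub>R y"
    using m by (simp add: y_def of_nat_diff scaleR_conv_of_real algebra_simps)
  finally have "G n * (1 + real m *\<^sub>R y) - x ^ Suc n = y * (\<Sum>i<m - 1. \<Sum>j<Suc i. x ^ j * e (n - j))"
    by simp
  also have "norm ... \<le> 0.111 * (\<Sum>i<m - 1. \<Sum>j<Suc i. 1.11 * \<theta> ^ (n - (m - 1)))"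
  proof (intro norm_mult_bound sum_norm_le)
    show "norm y \<le> 0.111"
      using yn m mult_left_mono[of 1 "real m" "norm y"] by simp
    fix i j assume ij: "i \<in> {..<m - 1}" "j \<in> {..<Suc i}"
    show "norm (x ^ j) \<le> 1.11" using ij by (intro xk) auto
    have "norm (e (n - j)) \<le> \<theta> ^ (n - j)" using ij n m by (intro ebound) auto
    also have "... \<le> \<theta> ^ (n - (m - 1))" using ij n by (intro \<theta>mono) auto
    finally show "norm (e (n - j)) \<le> \<theta> ^ (n - (m - 1))" .
  qed
  also have "(\<Sum>i<m - 1. \<Sum>j<Suc i. 1.11 * \<theta> ^ (n - (m - 1))) \<le> (\<Sum>i<m. \<Sum>j<m. 1.11 * \<theta> ^ (n - m))"
  proof -
    have "(\<Sum>i<m - 1. \<Sum>j<Suc i. 1.11 * \<theta> ^ (n - (m - 1))) \<le> (\<Sum>i<m - 1. \<Sum>j<m. 1.11 * \<theta> ^ (n - m))"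
    proof (rule sum_mono)
      fix i assume i: "i \<in> {..<m - 1}"
      have "(\<Sum>j<Suc i. 1.11 * \<theta> ^ (n - (m - 1))) \<le> (\<Sum>j<Suc i. 1.11 * \<theta> ^ (n - m))"
        by (intro sum_mono mult_left_mono \<theta>mono) auto
      also have "... \<le> (\<Sum>j<m. 1.11 * \<theta> ^ (n - m))"
        using \<theta> i by (intro sum_mono2) auto
      finally show "(\<Sum>j<Suc i. 1.11 * \<theta> ^ (n - (m - 1))) \<le> (\<Sum>j<m. 1.11 * \<theta> ^ (n - m))" .
    qed
    also have "... \<le> (\<Sum>i<m. \<Sum>j<m. 1.11 * \<theta> ^ (n - m))"
      using \<theta> by (intro sum_mono2 sum_nonneg) auto
    finally show ?thesis .
  qed
  also have "(\<Sum>i<m. \<Sum>j<m. 1.11 * \<theta> ^ (n - m)) = 1.11 * (real m)\<^sup>2 * (2 * \<theta> ^ m) * \<theta> ^ (n - m)"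
    using \<theta> by (simp add: power2_eq_square)
  also have "... = 2.22 * (real m)\<^sup>2 * \<theta> ^ n"
    using power_add[of \<theta> m "n - m"] n by simp
  finally have fin: "norm (G n * (1 + real m *\<^sub>R y) - x ^ Suc n) \<le> 0.111 * (2.22 * (real m)\<^sup>2 * \<theta> ^ n)"
    by simp
  have "norm (G n * (1 + real m *\<^sub>R y) - x ^ Suc n) \<le> 4 * (real m)\<^sup>2 * \<theta> ^ n"
    using fin \<theta> by (elim order_trans) simp
  then show ?thesis using xpow[of "Suc n"] unfolding y_def x_def by simp
qed

text \<open>Since n + 1 = L + m, the approximation x^(n+1) / (1 + m (x - 1)) equals exp (L l) exp (m
  l - l'), where l' is the logarithm of the denominator. The first-order parts of m l and l' cancel,
  so the correction starts at w^2; its coefficient m (m - 1) / 2 is what puts - m (m - 1) into the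
  denominator of \<open>N_tilde\<close>.\<close>

lemma boundary_factor:
  fixes m :: real
  assumes m: "2 \<le> m"
  shows "\<exists>C. \<forall>w l r :: 'a::comm_banach_algebra.
    norm w * m \<le> 1 / 50 \<longrightarrow> l = w + w\<^sup>2 * r \<longrightarrow> norm r \<le> 2 * m \<longrightarrow>
    (\<exists>l' b s. exp l' = 1 + m *\<^sub>R (exp l - 1) \<and> norm l' \<le> 1 / 10 \<and> m *\<^sub>R l - l' = w\<^sup>2 * b \<and>
       norm b \<le> 3 * m\<^sup>2 \<and> w\<^sup>2 * b = (m * (m - 1) / 2) *\<^sub>R w\<^sup>2 + w ^ 3 * s \<and> norm s \<le> C)"
proof -
  obtain C0 where C0: "\<And>w::'a. norm w \<le> 1 / 20 \<Longrightarrow> \<exists>l r s. exp l = 1 + w \<and>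
     norm l \<le> 6 / 5 * norm w \<and> l = w + w\<^sup>2 * r \<and> norm r \<le> 2 \<and>
     l = w - (1/2) *\<^sub>R w\<^sup>2 + (1/3) *\<^sub>R w ^ 3 + w ^ 4 * s \<and> norm s \<le> C0"
    using log_one_plus_expansion[where 'a = 'a] by blast
  define C where "C = \<bar>m * (m - 1) / 2\<bar> * (2 * (2 * m) + 1 * (2 * m)\<^sup>2) + 2 ^ 3 * (\<bar>m\<bar> * 2
      + \<bar>m\<^sup>2 / 2\<bar> * (\<bar>2\<bar> * 1 + 1 * 1\<^sup>2) + \<bar>m ^ 3\<bar> * (2 ^ 3 * (\<bar>1/3\<bar> * 1 + 1 * C0)))"
  show ?thesis
  proof (intro exI[of _ C] allI impI)
    fix w l r :: 'a
    assume w: "norm w * m \<le> 1 / 50" and l: "l = w + w\<^sup>2 * r" and r: "norm r \<le> 2 * m"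
    have w1: "norm w \<le> 1 / 50"
      using w m mult_left_mono[of 1 m "norm w"] by simp
    define v where "v = 1 + w * r"
    have lv: "l = w * v" by (simp add: l v_def power2_eq_square algebra_simps)
    have "norm (w * r) \<le> norm w * (2 * m)" by (intro norm_mult_bound r order_refl)
    also have "... \<le> 4 / 100" using w by simp
    finally have wr: "norm (w * r) \<le> 4 / 100" .
    have v: "norm v \<le> 104 / 100" unfolding v_def using norm_triangle_ineq[of 1 "w * r"] wr by simp
    have ln: "norm l * m \<le> 21 / 1000" "norm l \<le> 1 / 50"
    proof -
      have "norm l \<le> norm w * (104 / 100)" unfolding lv by (intro norm_mult_bound v order_refl)
      then have "norm l * m \<le> norm w * (104 / 100) * m" using m by (intro mult_right_mono) auto
      then show *: "norm l * m \<le> 21 / 1000" using w by simp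
      have "norm l * 2 \<le> norm l * m" using m by (intro mult_left_mono) auto
      then show "norm l \<le> 1 / 50" using * by linarith
    qed
    define X where "X = expt 2 l"
    define e1 where "e1 = expt 1 l"
    define E3 where "E3 = expt 3 l"
    have e1X: "e1 = 1 + l * X" unfolding e1_def X_def using expt_step[of 1 l] by (simp add: numeral_2_eq_2)
    have XE: "X = (1/2) *\<^sub>R 1 + l * E3"
      unfolding X_def E3_def using expt_step[of 2 l] by (simp add: eval_nat_numeral)
    have expl: "exp l - 1 = l * e1" unfolding e1_def using exp_eq_expt1[of l] by simp
    have nX: "norm X \<le> 6 / 10" and ne1: "norm e1 \<le> 103 / 100" and nE3: "norm E3 \<le> 2"
      unfolding X_def e1_def E3_def
      using norm_expt_le'[OF ln(2), of 2] norm_expt_le'[OF ln(2), of 1] norm_expt_le'[OF ln(2), of 3]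
      by (simp_all add: power2_eq_square fact_numeral)
    define w2 where "w2 = m *\<^sub>R (l * e1)"
    have "norm (l * e1) \<le> norm l * (103 / 100)" by (intro norm_mult_bound ne1 order_refl)
    then have "norm w2 \<le> m * (norm l * (103 / 100))" unfolding w2_def using m by (simp add: mult_left_mono)
    also have "... \<le> 1 / 20" using ln(1) by (simp add: mult.commute)
    finally have w2: "norm w2 \<le> 1 / 20" .
    obtain l2 r2 s2 where l2: "exp l2 = 1 + w2" "norm l2 \<le> 6 / 5 * norm w2"
      "l2 = w2 + w2\<^sup>2 * r2" "norm r2 \<le> 2"
      "l2 = w2 - (1/2) *\<^sub>R w2\<^sup>2 + (1/3) *\<^sub>R w2 ^ 3 + w2 ^ 4 * s2" "norm s2 \<le> C0"
      using C0[OF w2] by blast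
    have "exp l2 = 1 + m *\<^sub>R (exp l - 1)" unfolding expl l2(1) w2_def ..
    moreover have "norm l2 \<le> 1 / 10" using l2(2) w2 by simp
    moreover define b where "b = - (v\<^sup>2 * (m *\<^sub>R X + m\<^sup>2 *\<^sub>R (e1\<^sup>2 * r2)))"
    have bl: "m *\<^sub>R l - l2 = w\<^sup>2 * b"
    proof -
      have "m *\<^sub>R l - l2 = - (l\<^sup>2 * (m *\<^sub>R X + m\<^sup>2 *\<^sub>R (e1\<^sup>2 * r2)))"
        unfolding l2(3) w2_def power2_eq_square by (subst (1) e1X) (simp add: algebra_simps)
      then show ?thesis unfolding b_def lv by (simp add: power_mult_distrib mult.assoc)
    qed
    moreover have "norm b \<le> 3 * m\<^sup>2"
    proof -
      have "norm b \<le> (104 / 100)\<^sup>2 * (\<bar>m\<bar> * (6 / 10) + \<bar>m\<^sup>2\<bar> * ((103 / 100)\<^sup>2 * 2))"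
        unfolding b_def norm_minus_cancel
        by (intro norm_add_bound norm_mult_bound norm_scaleR_bound norm_power_bound v nX ne1) (use l2(4) in simp)
      also have "... \<le> (104 / 100)\<^sup>2 * (m\<^sup>2 * (3 / 10) + m\<^sup>2 * ((103 / 100)\<^sup>2 * 2))"
        using m by (intro mult_left_mono add_mono) (auto simp: power2_eq_square)
      also have "... \<le> 3 * m\<^sup>2" by (simp add: power2_eq_square)
      finally show ?thesis .
    qed
    moreover define s where "s = (m * (m - 1) / 2) *\<^sub>R (2 *\<^sub>R r + w * r\<^sup>2)
        + v ^ 3 * ((- m) *\<^sub>R E3 + (m\<^sup>2 / 2) *\<^sub>R (2 *\<^sub>R X + l * X\<^sup>2) - (m ^ 3) *\<^sub>R (e1 ^ 3 * ((1/3) *\<^sub>R 1 + w2 * s2)))"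
    have "w\<^sup>2 * b = (m * (m - 1) / 2) *\<^sub>R w\<^sup>2 + w ^ 3 * s"
    proof -
      define k where "k = m * (m - 1) / 2"
      \<comment> \<open>The coefficient of l^2 collects - m / 2 from the exponential series and m^2
        / 2 from the logarithm.\<close>
      have "m *\<^sub>R l - l2 = m *\<^sub>R (l - l * e1) + (1/2) *\<^sub>R w2\<^sup>2 - w2 ^ 3 * ((1/3) *\<^sub>R 1 + w2 * s2)"
        unfolding l2(5) w2_def[symmetric] scaleR_diff_right
        by (simp add: algebra_simps power3_eq_cube power4_eq_xxxx w2_def[symmetric])
      also have "l - l * e1 = - (1/2) *\<^sub>R l\<^sup>2 - l ^ 3 * E3"
        unfolding e1X XE by (simp add: algebra_simps power3_eq_cube power2_eq_square)
      also have "w2\<^sup>2 = m\<^sup>2 *\<^sub>R (l\<^sup>2 * e1\<^sup>2)"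
        unfolding w2_def by (simp add: power2_eq_square algebra_simps)
      also have "e1\<^sup>2 = 1 + l * (2 *\<^sub>R X + l * X\<^sup>2)"
        unfolding e1X by (simp add: power2_eq_square algebra_simps scaleR_2)
      also have "w2 ^ 3 = m ^ 3 *\<^sub>R (l ^ 3 * e1 ^ 3)"
        unfolding w2_def by (simp add: power3_eq_cube algebra_simps)
      finally have "m *\<^sub>R l - l2 = k *\<^sub>R l\<^sup>2
          + l ^ 3 * ((- m) *\<^sub>R E3 + (m\<^sup>2 / 2) *\<^sub>R (2 *\<^sub>R X + l * X\<^sup>2) - (m ^ 3) *\<^sub>R (e1 ^ 3 * ((1/3) *\<^sub>R 1 + w2 * s2)))"
        (is "_ = _ + l ^ 3 * ?Z")
      proof -
        assume "m *\<^sub>R l - l2 = m *\<^sub>R (- (1/2) *\<^sub>R l\<^sup>2 - l ^ 3 * E3)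
          + (1/2) *\<^sub>R m\<^sup>2 *\<^sub>R (l\<^sup>2 * (1 + l * (2 *\<^sub>R X + l * X\<^sup>2)))
          - m ^ 3 *\<^sub>R (l ^ 3 * e1 ^ 3) * ((1/3) *\<^sub>R 1 + w2 * s2)"
        also have "... = (m\<^sup>2 / 2 - m / 2) *\<^sub>R l\<^sup>2 + l ^ 3 * ?Z"
        proof -
          have 1: "(1/2) *\<^sub>R m\<^sup>2 *\<^sub>R (l\<^sup>2 * (1 + l * q)) = (m\<^sup>2 / 2) *\<^sub>R l\<^sup>2 + l ^ 3 * ((m\<^sup>2 / 2) *\<^sub>R q)" for q
            by (simp add: algebra_simps power3_eq_cube power2_eq_square)
          have 2: "m *\<^sub>R (- (1/2) *\<^sub>R l\<^sup>2 - l ^ 3 * E3) = (- (m / 2)) *\<^sub>R l\<^sup>2 + l ^ 3 * ((- m) *\<^sub>R E3)"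
            by (simp add: algebra_simps)
          have 3: "m ^ 3 *\<^sub>R (l ^ 3 * e1 ^ 3) * z = l ^ 3 * (m ^ 3 *\<^sub>R (e1 ^ 3 * z))" for z
            by (simp add: mult.assoc)
          show ?thesis unfolding 1 2 3 by (simp only: distrib_left right_diff_distrib scaleR_diff_left scaleR_minus_left)
              (simp only: algebra_simps, simp)
        qed
        also have "m\<^sup>2 / 2 - m / 2 = k" by (simp add: k_def power2_eq_square algebra_simps diff_divide_distrib)
        finally show ?thesis .
      qed
      also have "l\<^sup>2 = w\<^sup>2 + w ^ 3 * (2 *\<^sub>R r + w * r\<^sup>2)"
        unfolding l by (simp add: power2_eq_square power3_eq_cube algebra_simps scaleR_2)
      also have "l ^ 3 = w ^ 3 * v ^ 3" unfolding lv by (rule power_mult_distrib)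
      finally show ?thesis unfolding bl[symmetric] s_def k_def[symmetric]
        by (simp add: distrib_left mult.assoc scaleR_add_right)
    qed
    moreover have "norm s \<le> C"
    proof -
      have b: "norm v \<le> 2" "norm E3 \<le> 2" "norm X \<le> 1" "norm l \<le> 1" "norm e1 \<le> 2" "norm w2 \<le> 1" "norm w \<le> 1"
        using v nE3 nX ln(2) ne1 w2 w1 by auto
      have "norm s \<le> \<bar>m * (m - 1) / 2\<bar> * (\<bar>2\<bar> * (2 * m) + 1 * (2 * m)\<^sup>2) + 2 ^ 3 * (\<bar>- m\<bar> * 2
          + \<bar>m\<^sup>2 / 2\<bar> * (\<bar>2\<bar> * 1 + 1 * 1\<^sup>2) + \<bar>m ^ 3\<bar> * (2 ^ 3 * (\<bar>1/3\<bar> * 1 + 1 * C0)))"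
        unfolding s_def
        by (intro norm_add_bound norm_diff_bound norm_mult_bound norm_scaleR_bound norm_power_bound b r l2(6)) simp
      then show ?thesis by (simp add: C_def)
    qed
    ultimately show "\<exists>l' b s. exp l' = 1 + m *\<^sub>R (exp l - 1) \<and> norm l' \<le> 1 / 10 \<and> m *\<^sub>R l - l' = w\<^sup>2 * b \<and>
       norm b \<le> 3 * m\<^sup>2 \<and> w\<^sup>2 * b = (m * (m - 1) / 2) *\<^sub>R w\<^sup>2 + w ^ 3 * s \<and> norm s \<le> C"
      by blast
  qed
qed

section \<open>Matching of the coefficients and sizes of the parameters\<close>

context
  fixes m n :: nat and a :: real
  assumes m: "2 \<le> m" and n: "m \<le> n" and La: "1 \<le> (real n - real m + 1) * a" and ma: "real m * a \<le> 1 / 100"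
begin

text \<open>Contains the reason for the choice of N. The u^2 coefficient of the logarithm is - (a^2
  / 2) (L (2 m - 1) - m (m - 1)) for the statistic and - lam q / 2 = - lam^2 / (2 N) for the
  binomial law; they agree at N = L^2 / (L (2 m - 1) - m (m - 1)). The ninth claim therefore
  measures the rounding of N alone. The tenth compares the u^3 coefficients, using that q is close
  to (2 m - 1) a.\<close>

lemma parameter_bounds:
  defines "L \<equiv> real n - real m + 1"
  defines "lam \<equiv> L * a" and "N \<equiv> real (nat \<lfloor>(L\<^sup>2 / (L * (2 * real m - 1) - real m * (real m - 1)))\<rfloor>)"
  defines "q \<equiv> lam / N"
  shows "0 < a" "a \<le> 1 / 200" "100 * real m \<le> L" "1 < N" "N * q = lam" "0 < q" "q \<le> 3 * real m * a" "q \<le> 21 / 1000"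
    and "\<bar>- L * (real m - 1/2) * a\<^sup>2 + real m * (real m - 1) / 2 * a\<^sup>2 + lam * q / 2\<bar> \<le> 3 * (real m)\<^sup>2 * a\<^sup>2"
    and "\<bar>L * a ^ 3 * (1/3 + 3/2 * (real m - 1) * real m) - lam * q\<^sup>2 / 3 - L * a ^ 3 * (real m * (real m - 1) / 6)\<bar>
      \<le> 10 * (real m) ^ 3 * a ^ 3"
proof -
  let ?m = "real m"
  have m2: "?m \<ge> 2" using m by simp
  have L1: "L \<ge> 1" using n by (simp add: L_def)
  have lam1: "1 \<le> lam" using La by (simp add: lam_def L_def)
  show a0: "0 < a"
  proof (rule ccontr)
    assume "\<not> 0 < a"
    then have "L * a \<le> 0" using L1 by (simp add: mult_nonneg_nonpos)
    then show False using lam1 by (simp add: lam_def)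
  qed
  have "2 * a \<le> ?m * a" using m2 a0 by (intro mult_right_mono) auto
  then show a200: "a \<le> 1 / 200" using ma by linarith
  have "?m * 1 \<le> ?m * lam" using lam1 m2 by (intro mult_left_mono) auto
  also have "... = L * (?m * a)" by (simp add: lam_def)
  also have "... \<le> L * (1 / 100)" using L1 ma by (intro mult_left_mono) auto
  finally show Lm: "100 * ?m \<le> L" by simp
  define k where "k = 2 * ?m - 1"
  define D where "D = L * k - ?m * (?m - 1)"
  \<comment> \<open>x is the reciprocal of the unrounded N, and y below that of N. As N q is fixed,
    q = lam y is linear in y, which makes reciprocals the convenient variables.\<close>
  define x where "x = k / L - ?m * (?m - 1) / L\<^sup>2"
  have k: "3 \<le> k" "k \<le> 2 * ?m" using m2 by (auto simp: k_def)
  have mm: "0 \<le> ?m * (?m - 1)" "?m * (?m - 1) \<le> ?m\<^sup>2" "?m * (?m - 1) \<le> ?m * k"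
    using m2 by (auto simp: power2_eq_square algebra_simps k_def)
  have L0: "L > 0" using L1 by simp
  have "?m * k * 1 \<le> L / 100 * k" using Lm k by (simp add: mult_right_mono)
  also have "... < L * k" using L0 k by simp
  finally have D0: "D > 0" unfolding D_def using mm by linarith
  have xD: "x = D / L\<^sup>2" unfolding x_def D_def using L0 by (simp add: field_simps power2_eq_square)
  have x0: "0 < x" using D0 L0 by (simp add: xD)
  have xk: "x \<le> k / L" using mm L0 by (simp add: x_def)
  have "k / L \<le> 2 * ?m / (100 * ?m)" using k Lm m2 L0 by (intro frac_le) auto
  then have kL: "k / L \<le> 1 / 50" using m2 by simp
  have x50: "x \<le> 1 / 50" using xk kL by linarith
  have T: "L\<^sup>2 / (L * (2 * ?m - 1) - ?m * (?m - 1)) = 1 / x"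
    unfolding xD D_def k_def by simp
  have T50: "50 \<le> 1 / x" using x0 x50 by (simp add: field_simps)
  have N: "N \<le> 1 / x" "1 / x - 1 < N" unfolding N_def T using T50 by linarith+
  show N1: "1 < N" using N T50 by linarith
  then show Nq: "N * q = lam" by (simp add: q_def)
  show "0 < q" using N1 lam1 by (simp add: q_def)
  define y where "y = 1 / N"
  have yx: "x \<le> y" using N(1) N1 x0 by (simp add: y_def field_simps)
  have y2: "y * (1 - x) \<le> x"
  proof -
    have "(1 / x - 1) * x \<le> N * x" using N(2) x0 by (intro mult_right_mono) auto
    then have "1 - x \<le> N * x" using x0 by (simp add: algebra_simps)
    then show ?thesis using N1 by (simp add: y_def divide_le_eq mult.commute)
  qed
  have y0: "0 < y" using N1 by (simp add: y_def)
  have y98: "y * (98 / 100) \<le> x"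
  proof -
    have "y * (98 / 100) \<le> y * (1 - x)" using y0 x50 by (intro mult_left_mono) auto
    then show ?thesis using y2 by linarith
  qed
  \<comment> \<open>Rounding moves N by less than 1, so the reciprocals differ only to second order;
    51 / 49 exceeds 1 / 0.98.\<close>
  have yxd: "y - x \<le> 51 / 49 * x\<^sup>2"
  proof -
    have "y - x \<le> y * x" using y2 by (simp add: algebra_simps)
    also have "... \<le> (51 / 49 * x) * x" using y98 x0 by (intro mult_right_mono) auto
    finally show ?thesis by (simp add: power2_eq_square)
  qed
  have qy: "q = lam * y" by (simp add: q_def y_def)
  have lamL: "lam * (k / L) = a * k" using L0 by (simp add: lam_def)
  have q1: "q * (98 / 100) \<le> a * k"
  proof -
    have "q * (98 / 100) = lam * (y * (98 / 100))" by (simp add: qy)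
    also have "... \<le> lam * (k / L)" by (intro mult_left_mono) (use y98 xk lam1 in linarith)+
    finally show ?thesis unfolding lamL .
  qed
  have ak: "a * k \<le> 2 * (?m * a)" using k a0 by simp
  show "q \<le> 21 / 1000" using q1 ak ma by linarith
  have am: "0 < ?m * a" using m2 a0 by simp
  show "q \<le> 3 * ?m * a" using q1 ak am by linarith
  have x2: "x\<^sup>2 \<le> 4 * ?m\<^sup>2 / L\<^sup>2"
  proof -
    have "x\<^sup>2 \<le> (2 * ?m / L)\<^sup>2"
      using xk x0 k L0 by (intro power_mono order_trans[OF xk] divide_right_mono) auto
    then show ?thesis by (simp add: power_divide power_mult_distrib)
  qed
  show "\<bar>- L * (?m - 1/2) * a\<^sup>2 + ?m * (?m - 1) / 2 * a\<^sup>2 + lam * q / 2\<bar> \<le> 3 * ?m\<^sup>2 * a\<^sup>2"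
  proof -
    have "lam\<^sup>2 * x = a\<^sup>2 * D" using L0 by (simp add: lam_def xD power_mult_distrib)
    moreover have "- L * (?m - 1/2) * a\<^sup>2 + ?m * (?m - 1) / 2 * a\<^sup>2 = - (a\<^sup>2 * D / 2)"
      by (simp add: D_def k_def field_simps)
    ultimately have e: "- L * (?m - 1/2) * a\<^sup>2 + ?m * (?m - 1) / 2 * a\<^sup>2 + lam * q / 2 = lam\<^sup>2 / 2 * (y - x)"
      unfolding qy by (simp add: right_diff_distrib power2_eq_square)
    have "\<bar>- L * (?m - 1/2) * a\<^sup>2 + ?m * (?m - 1) / 2 * a\<^sup>2 + lam * q / 2\<bar> = lam\<^sup>2 / 2 * (y - x)"
      unfolding e using yx by simp
    also have "... \<le> lam\<^sup>2 / 2 * (51 / 49 * (4 * ?m\<^sup>2 / L\<^sup>2))"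
      using yxd x2 by (intro mult_left_mono) auto
    also have "... = 102 / 49 * (?m\<^sup>2 * a\<^sup>2)" using L0 by (simp add: lam_def power_mult_distrib)
    also have "... \<le> 3 * (?m\<^sup>2 * a\<^sup>2)" by (intro mult_right_mono) auto
    finally show ?thesis by (simp only: mult.assoc)
  qed
  show "\<bar>L * a ^ 3 * (1/3 + 3/2 * (?m - 1) * ?m) - lam * q\<^sup>2 / 3 - L * a ^ 3 * (?m * (?m - 1) / 6)\<bar>
      \<le> 10 * ?m ^ 3 * a ^ 3"
  proof -
    \<comment> \<open>From (2 m - 1)^2 = 4 m (m - 1) + 1 follows 1/3 + 3/2 m (m - 1) - m (m - 1) / 6
      = (2 m - 1)^2 / 3; this is where the 1/6 of the leading term originates.\<close>
    have "L * a ^ 3 * (1/3 + 3/2 * (?m - 1) * ?m) - L * a ^ 3 * (?m * (?m - 1) / 6) = L * a ^ 3 * k\<^sup>2 / 3"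
      by (simp add: k_def power2_eq_square field_simps)
    also have "L * a ^ 3 * k\<^sup>2 / 3 = lam ^ 3 / 3 * (k / L)\<^sup>2"
      using L0 by (simp add: lam_def power_mult_distrib power_divide power2_eq_square power3_eq_cube)
    finally have "L * a ^ 3 * (1/3 + 3/2 * (?m - 1) * ?m) - lam * q\<^sup>2 / 3 - L * a ^ 3 * (?m * (?m - 1) / 6)
        = lam ^ 3 / 3 * (k / L)\<^sup>2 - lam * (lam * y)\<^sup>2 / 3" by (simp add: qy)
    also have "... = lam ^ 3 / 3 * ((k / L + y) * (k / L - y))"
      by (simp add: power2_eq_square power3_eq_cube algebra_simps)
    finally have e: "L * a ^ 3 * (1/3 + 3/2 * (?m - 1) * ?m) - lam * q\<^sup>2 / 3 - L * a ^ 3 * (?m * (?m - 1) / 6)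
        = lam ^ 3 / 3 * ((k / L + y) * (k / L - y))" .
    have "\<bar>L * a ^ 3 * (1/3 + 3/2 * (?m - 1) * ?m) - lam * q\<^sup>2 / 3 - L * a ^ 3 * (?m * (?m - 1) / 6)\<bar>
        = lam ^ 3 / 3 * ((k / L + y) * \<bar>k / L - y\<bar>)"
      unfolding e using lam1 y0 k L0 by (simp add: abs_mult)
    also have "... \<le> lam ^ 3 / 3 * ((5 * ?m / L) * (6 * ?m\<^sup>2 / L\<^sup>2))"
    proof (intro mult_left_mono mult_mono)
      have kLm: "k / L \<le> 2 * ?m / L" using k L0 by (intro divide_right_mono) auto
      have "k / L + y \<le> 5 / 2 * (2 * ?m / L)" using y98 xk kLm y0 by linarith
      then show "k / L + y \<le> 5 * ?m / L" by simp
      have "\<bar>k / L - y\<bar> \<le> \<bar>k / L - x\<bar> + (y - x)" using yx by linarith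
      also have "... \<le> ?m\<^sup>2 / L\<^sup>2 + 51 / 49 * (4 * ?m\<^sup>2 / L\<^sup>2)"
      proof (intro add_mono)
        have "\<bar>k / L - x\<bar> = ?m * (?m - 1) / L\<^sup>2" using mm by (simp add: x_def)
        also have "... \<le> ?m\<^sup>2 / L\<^sup>2" using mm by (intro divide_right_mono) auto
        finally show "\<bar>k / L - x\<bar> \<le> ?m\<^sup>2 / L\<^sup>2" .
        show "y - x \<le> 51 / 49 * (4 * ?m\<^sup>2 / L\<^sup>2)" using yxd x2 by simp
      qed
      also have "... = (253 / 49) * (?m\<^sup>2 / L\<^sup>2)" by simp
      also have "... \<le> 6 * (?m\<^sup>2 / L\<^sup>2)" by (intro mult_right_mono) auto
      finally show "\<bar>k / L - y\<bar> \<le> 6 * ?m\<^sup>2 / L\<^sup>2" by simp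
    qed (use lam1 m2 L0 in auto)
    also have "... = 10 * ?m ^ 3 * a ^ 3"
      using L0 by (simp add: lam_def power_mult_distrib power2_eq_square power3_eq_cube)
    finally show ?thesis .
  qed
qed

end

section \<open>Absolutely summable power series and the Poisson distribution\<close>

text \<open>Elements encode finite signed measures on the nonnegative integers, where both laws
  live. As a subtype of \<open>real fps\<close> it inherits convolution and the ring laws by
  lifting; only summability has to be checked.\<close>

typedef ell1 = "{f :: real fps. summable (\<lambda>n. \<bar>fps_nth f n\<bar>)}"
  morphisms fps_of_ell1 Abs_ell1
  by (rule exI[of _ 0]) simp

setup_lifting type_definition_ell1

lemma abs_summable_fps_mult:
  fixes f g :: "real fps"
  assumes "summable (\<lambda>n. \<bar>fps_nth f n\<bar>)" "summable (\<lambda>n. \<bar>fps_nth g n\<bar>)"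
  shows "summable (\<lambda>n. \<bar>fps_nth (f * g) n\<bar>)"
    and "(\<Sum>n. \<bar>fps_nth (f * g) n\<bar>) \<le> (\<Sum>n. \<bar>fps_nth f n\<bar>) * (\<Sum>n. \<bar>fps_nth g n\<bar>)"
proof -
  let ?F = "\<lambda>n. \<bar>fps_nth f n\<bar>" and ?G = "\<lambda>n. \<bar>fps_nth g n\<bar>"
  have s: "(\<lambda>n. \<Sum>i\<le>n. ?F i * ?G (n - i)) sums ((\<Sum>n. ?F n) * (\<Sum>n. ?G n))"
    using Cauchy_product_sums[of ?F ?G] assms by simp
  have le: "\<bar>fps_nth (f * g) n\<bar> \<le> (\<Sum>i\<le>n. ?F i * ?G (n - i))" for n
    unfolding fps_mult_nth atMost_atLeast0
    by (rule order_trans[OF sum_abs]) (simp add: abs_mult)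
  show sm: "summable (\<lambda>n. \<bar>fps_nth (f * g) n\<bar>)"
    by (rule summable_comparison_test'[OF sums_summable[OF s]]) (use le in simp)
  show "(\<Sum>n. \<bar>fps_nth (f * g) n\<bar>) \<le> (\<Sum>n. ?F n) * (\<Sum>n. ?G n)"
    using suminf_le[OF le sm sums_summable[OF s]] sums_unique[OF s] by simp
qed

instantiation ell1 :: comm_ring_1
begin

lift_definition zero_ell1 :: ell1 is 0 by simp
lift_definition one_ell1 :: ell1 is 1
  by (rule summable_finite[of "{0}"]) auto
lift_definition plus_ell1 :: "ell1 \<Rightarrow> ell1 \<Rightarrow> ell1" is "(+)"
proof -
  fix f g :: "real fps"
  assume "summable (\<lambda>n. \<bar>fps_nth f n\<bar>)" "summable (\<lambda>n. \<bar>fps_nth g n\<bar>)"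
  then have "summable (\<lambda>n. \<bar>fps_nth f n\<bar> + \<bar>fps_nth g n\<bar>)" by (rule summable_add)
  then show "summable (\<lambda>n. \<bar>fps_nth (f + g) n\<bar>)"
    by (rule summable_comparison_test') auto
qed
lift_definition uminus_ell1 :: "ell1 \<Rightarrow> ell1" is uminus by simp
lift_definition minus_ell1 :: "ell1 \<Rightarrow> ell1 \<Rightarrow> ell1" is "(-)"
proof -
  fix f g :: "real fps"
  assume "summable (\<lambda>n. \<bar>fps_nth f n\<bar>)" "summable (\<lambda>n. \<bar>fps_nth g n\<bar>)"
  then have "summable (\<lambda>n. \<bar>fps_nth f n\<bar> + \<bar>fps_nth g n\<bar>)" by (rule summable_add)
  then show "summable (\<lambda>n. \<bar>fps_nth (f - g) n\<bar>)"
    by (rule summable_comparison_test') auto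
qed
lift_definition times_ell1 :: "ell1 \<Rightarrow> ell1 \<Rightarrow> ell1" is "(*)"
  by (rule abs_summable_fps_mult)

instance
  by (standard; transfer) (auto simp: algebra_simps)

end

lift_definition coeff1 :: "ell1 \<Rightarrow> nat \<Rightarrow> real" is fps_nth .

lemma ell1_eqI: "(\<And>n. coeff1 f n = coeff1 g n) \<Longrightarrow> f = g"
  by transfer (auto simp: fps_eq_iff)

lemma coeff1_summable: "summable (\<lambda>n. \<bar>coeff1 f n\<bar>)"
  by transfer simp

lemma coeff1_simps [simp]:
  "coeff1 0 n = 0" "coeff1 1 n = (if n = 0 then 1 else 0)"
  "coeff1 (f + g) n = coeff1 f n + coeff1 g n" "coeff1 (f - g) n = coeff1 f n - coeff1 g n"
  "coeff1 (- f) n = - coeff1 f n"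
  by (transfer; simp)+

instantiation ell1 :: real_normed_algebra_1
begin

lift_definition scaleR_ell1 :: "real \<Rightarrow> ell1 \<Rightarrow> ell1" is "\<lambda>c f. fps_const c * f"
  by (simp add: abs_mult summable_mult)
definition norm_ell1 :: "ell1 \<Rightarrow> real" where "norm_ell1 f = (\<Sum>n. \<bar>coeff1 f n\<bar>)"
definition dist_ell1 :: "ell1 \<Rightarrow> ell1 \<Rightarrow> real" where "dist_ell1 f g = norm (f - g)"
definition sgn_ell1 :: "ell1 \<Rightarrow> ell1" where "sgn_ell1 f = inverse (norm f) *\<^sub>R f"
definition uniformity_ell1 :: "(ell1 \<times> ell1) filter" where
  "uniformity_ell1 = (INF e\<in>{0<..}. principal {(x, y). dist x y < e})"
definition open_ell1 :: "ell1 set \<Rightarrow> bool" where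
  "open_ell1 U \<longleftrightarrow> (\<forall>x\<in>U. eventually (\<lambda>(x', y). x' = x \<longrightarrow> y \<in> U) uniformity)"

instance
proof
  fix f g :: ell1 and c d :: real and U :: "ell1 set"
  show "c *\<^sub>R (f + g) = c *\<^sub>R f + c *\<^sub>R g" by transfer (simp add: algebra_simps)
  show "(c + d) *\<^sub>R f = c *\<^sub>R f + d *\<^sub>R f"
    by transfer (simp add: algebra_simps flip: fps_const_add)
  show "c *\<^sub>R d *\<^sub>R f = (c * d) *\<^sub>R f" by transfer (simp add: mult.assoc flip: fps_const_mult)
  show "1 *\<^sub>R f = f" by transfer simp
  show "(c *\<^sub>R f) * g = c *\<^sub>R (f * g)" by transfer (simp add: mult.assoc)
  show "f * (c *\<^sub>R g) = c *\<^sub>R (f * g)" by transfer (simp add: algebra_simps)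
  show "dist f g = norm (f - g)" by (rule dist_ell1_def)
  show "sgn f = inverse (norm f) *\<^sub>R f" by (rule sgn_ell1_def)
  show "uniformity = (INF e\<in>{0<..}. principal {(x :: ell1, y). dist x y < e})"
    by (rule uniformity_ell1_def)
  show "open U \<longleftrightarrow> (\<forall>x\<in>U. eventually (\<lambda>(x', y). x' = x \<longrightarrow> y \<in> U) uniformity)"
    by (rule open_ell1_def)
  show "norm f = 0 \<longleftrightarrow> f = 0"
    unfolding norm_ell1_def
    by (subst suminf_eq_zero_iff[OF coeff1_summable]) (auto intro: ell1_eqI)
  show "norm (f + g) \<le> norm f + norm g"
    unfolding norm_ell1_def suminf_add[OF coeff1_summable coeff1_summable]
    by (intro suminf_le coeff1_summable summable_add) simp
  have "coeff1 (c *\<^sub>R f) n = c * coeff1 f n" for n by transfer simp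
  then show "norm (c *\<^sub>R f) = \<bar>c\<bar> * norm f"
    by (simp add: norm_ell1_def abs_mult suminf_mult coeff1_summable)
  show "norm (f * g) \<le> norm f * norm g"
    unfolding norm_ell1_def by transfer (rule abs_summable_fps_mult(2))
  show "norm (1 :: ell1) = 1"
    unfolding norm_ell1_def by (subst suminf_finite[of "{0}"]) auto
qed

end

lemma coeff1_scaleR [simp]: "coeff1 (c *\<^sub>R f) n = c * coeff1 f n"
  by transfer simp

lemma coeff1_le_norm: "\<bar>coeff1 f n\<bar> \<le> norm f"
  unfolding norm_ell1_def
  using sum_le_suminf[OF coeff1_summable, of "{n}" f] by simp

lemma bounded_linear_coeff1: "bounded_linear (\<lambda>f. coeff1 f n)"
  by (rule bounded_linear_intro[of _ 1]) (auto intro: coeff1_le_norm)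

text \<open>The value 0 for non-summable arguments is a default to make the function total.\<close>

lift_definition ell1_of_fun :: "(nat \<Rightarrow> real) \<Rightarrow> ell1" is
  "\<lambda>f. if summable (\<lambda>n. \<bar>f n\<bar>) then Abs_fps f else 0"
  by auto

lemma coeff1_ell1_of_fun: "summable (\<lambda>n. \<bar>f n\<bar>) \<Longrightarrow> coeff1 (ell1_of_fun f) n = f n"
  by transfer simp

instance ell1 :: banach
proof
  fix F :: "nat \<Rightarrow> ell1"
  assume F: "Cauchy F"
  have "Cauchy (\<lambda>i. coeff1 (F i) n)" for n
    using bounded_linear.Cauchy[OF bounded_linear_coeff1 F] .
  then have "\<forall>n. \<exists>l. (\<lambda>i. coeff1 (F i) n) \<longlonglongrightarrow> l"
    by (simp add: Cauchy_convergent_iff convergent_def)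
  then obtain l where l: "\<And>n. (\<lambda>i. coeff1 (F i) n) \<longlonglongrightarrow> l n" by metis
  \<comment> \<open>Coordinatewise convergence suffices for finite partial sums; since the bound
    \<open>e\<close> does not depend on k, it then passes to the full series, which turns
    coordinatewise limits into a limit in norm.\<close>
  have part: "(\<Sum>n<k. \<bar>coeff1 (F i) n - l n\<bar>) \<le> e"
    if N: "\<And>j. j \<ge> N \<Longrightarrow> norm (F i - F j) \<le> e" for N i k e
  proof (rule tendsto_upperbound)
    show "(\<lambda>j. \<Sum>n<k. \<bar>coeff1 (F i) n - coeff1 (F j) n\<bar>) \<longlonglongrightarrow> (\<Sum>n<k. \<bar>coeff1 (F i) n - l n\<bar>)"
      by (intro tendsto_intros l)
    have "(\<Sum>n<k. \<bar>coeff1 (F i) n - coeff1 (F j) n\<bar>) \<le> norm (F i - F j)" for j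
      unfolding norm_ell1_def using sum_le_suminf[OF coeff1_summable, of "{..<k}" "F i - F j"] by simp
    then show "\<forall>\<^sub>F j in sequentially. (\<Sum>n<k. \<bar>coeff1 (F i) n - coeff1 (F j) n\<bar>) \<le> e"
      unfolding eventually_sequentially using N order_trans by blast
  qed simp
  have summ: "summable (\<lambda>n. \<bar>coeff1 (F i) n - l n\<bar>)" "(\<Sum>n. \<bar>coeff1 (F i) n - l n\<bar>) \<le> e"
    if N: "\<And>j. j \<ge> N \<Longrightarrow> norm (F i - F j) \<le> e" for N i e
  proof -
    show "summable (\<lambda>n. \<bar>coeff1 (F i) n - l n\<bar>)"
      by (rule bounded_imp_summable[of _ e])
         (use part[OF N, of N "Suc _"] in \<open>auto simp: lessThan_Suc_atMost\<close>)
    then show "(\<Sum>n. \<bar>coeff1 (F i) n - l n\<bar>) \<le> e"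
      by (rule suminf_le_const) (rule part[OF N])
  qed
  have ex: "\<exists>N. \<forall>i\<ge>N. \<forall>j\<ge>N. norm (F i - F j) \<le> e" if "e > 0" for e
    using CauchyD[OF F that] less_imp_le by metis
  obtain N1 where N1: "\<And>i j. i \<ge> N1 \<Longrightarrow> j \<ge> N1 \<Longrightarrow> norm (F i - F j) \<le> 1"
    using ex[of 1] by auto
  have "summable (\<lambda>n. \<bar>coeff1 (F N1) n - l n\<bar> + \<bar>coeff1 (F N1) n\<bar>)"
    by (intro summable_add coeff1_summable summ(1)[of N1 _ 1]) (use N1 in auto)
  then have sl: "summable (\<lambda>n. \<bar>l n\<bar>)"
    by (rule summable_comparison_test') auto
  have "F \<longlonglongrightarrow> ell1_of_fun l"
  proof (rule LIMSEQ_I)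
    fix r :: real assume "r > 0"
    then obtain N where N: "\<And>i j. i \<ge> N \<Longrightarrow> j \<ge> N \<Longrightarrow> norm (F i - F j) \<le> r / 2"
      using ex[of "r / 2"] by auto
    have "norm (F i - ell1_of_fun l) \<le> r / 2" if "i \<ge> N" for i
      unfolding norm_ell1_def using summ(2)[of N i "r/2"] N that
      by (simp add: coeff1_ell1_of_fun[OF sl])
    then show "\<exists>no. \<forall>n\<ge>no. norm (F n - ell1_of_fun l) < r"
      using \<open>r > 0\<close> by (intro exI[of _ N] allI impI) (rule le_less_trans[of _ "r / 2"], auto)
  qed
  then show "convergent F" by (auto simp: convergent_def)
qed

instance ell1 :: comm_banach_algebra ..

section \<open>The difference operator and differences of the Poisson distribution\<close>

lift_definition ell1_X :: ell1 is "fps_X"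
  by (rule summable_finite[of "{1}"]) (auto simp: fps_X_def)

lemma coeff1_X_mult [simp]: "coeff1 (ell1_X * f) n = (if n = 0 then 0 else coeff1 f (n - 1))"
  by transfer simp

lemma coeff1_X_power [simp]: "coeff1 (ell1_X ^ k) n = (if n = k then 1 else 0)"
  by (induction k arbitrary: n) auto

lemma coeff1_exp_X: "coeff1 (exp (t *\<^sub>R ell1_X)) n = t ^ n / fact n"
proof -
  have "(\<lambda>k. coeff1 ((t *\<^sub>R ell1_X) ^ k /\<^sub>R fact k) n) sums coeff1 (exp (t *\<^sub>R ell1_X)) n"
    by (rule bounded_linear.sums[OF bounded_linear_coeff1 exp_converges])
  moreover have "(\<lambda>k. coeff1 ((t *\<^sub>R ell1_X) ^ k /\<^sub>R fact k) n) =
      (\<lambda>k. if k = n then t ^ n / fact n else 0)"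
    by (auto simp: scaleR_power field_simps)
  ultimately show ?thesis
    using sums_single[of n "\<lambda>_. t ^ n / fact n"] sums_unique2 by (metis (no_types, lifting))
qed

text \<open>The signed measure I_1 - I; multiplication by it is a backward difference up to
  sign.\<close>

definition ell1_u :: ell1 where "ell1_u = ell1_X - 1"

definition pois :: "real \<Rightarrow> nat \<Rightarrow> real" where
  "pois t n = exp (- t) * t ^ n / fact n"

lemma coeff1_exp_u: "coeff1 (exp (t *\<^sub>R ell1_u)) n = pois t n"
proof -
  have "exp (t *\<^sub>R ell1_u) = exp (t *\<^sub>R ell1_X + (- t) *\<^sub>R 1)"
    by (simp add: ell1_u_def algebra_simps)
  also have "... = exp (t *\<^sub>R ell1_X) * exp (of_real (- t))"
    by (subst exp_add_commuting) (auto simp: of_real_def)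
  also have "... = exp (- t) *\<^sub>R exp (t *\<^sub>R ell1_X)"
    unfolding exp_of_real by (simp add: of_real_def)
  finally show ?thesis by (simp add: coeff1_exp_X pois_def)
qed

lemma pois_nonneg: "0 \<le> t \<Longrightarrow> 0 \<le> pois t n"
  by (simp add: pois_def)

lemma pois_sums: "pois t sums 1"
proof -
  have "(\<lambda>n. exp (- t) * (t ^ n /\<^sub>R fact n)) sums (exp (- t) * exp t)"
    by (intro sums_mult exp_converges)
  then show ?thesis by (simp add: pois_def[abs_def] divide_inverse mult_ac flip: exp_add)
qed

lemma pois_Suc: "real (Suc n) * pois t (Suc n) = t * pois t n"
  by (simp add: pois_def field_simps del: of_nat_Suc)

lemma pois_mean_sums: "(\<lambda>n. real n * pois t n) sums t"
proof -
  have "(\<lambda>n. real (Suc n) * pois t (Suc n)) sums (t * 1)"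
    unfolding pois_Suc by (intro sums_mult pois_sums)
  then show ?thesis by (subst (asm) sums_Suc_iff) simp
qed

lemma pois_variance_sums: "(\<lambda>n. (real n - t)\<^sup>2 * pois t n) sums t"
proof -
  have "real (Suc n) * (real (Suc n) - 1) * pois t (Suc n) = t * (real n * pois t n)" for n
  proof -
    have "real (Suc n) * (real (Suc n) - 1) * pois t (Suc n) = real n * (real (Suc n) * pois t (Suc n))"
      by simp
    then show ?thesis unfolding pois_Suc by simp
  qed
  then have "(\<lambda>n. real (Suc n) * (real (Suc n) - 1) * pois t (Suc n)) sums (t * t)"
    by (simp only:) (intro sums_mult pois_mean_sums)
  then have "(\<lambda>n. real n * (real n - 1) * pois t n) sums (t * t)"
    by (subst (asm) sums_Suc_iff) simp
  then have "(\<lambda>n. real n * (real n - 1) * pois t n + (1 - 2 * t) * (real n * pois t n) + t\<^sup>2 * pois t n)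
      sums (t * t + (1 - 2 * t) * t + t\<^sup>2 * 1)"
    by (intro sums_add sums_mult pois_mean_sums pois_sums)
  moreover have "(\<lambda>n. real n * (real n - 1) * pois t n + (1 - 2 * t) * (real n * pois t n) + t\<^sup>2 * pois t n)
      = (\<lambda>n. (real n - t)\<^sup>2 * pois t n)"
    by (auto simp: power2_eq_square algebra_simps)
  ultimately show ?thesis by (simp add: power2_eq_square algebra_simps)
qed

lemma coeff1_u_mult: "coeff1 (ell1_u * f) n = (if n = 0 then 0 else coeff1 f (n - 1)) - coeff1 f n"
  by (simp add: ell1_u_def left_diff_distrib)

text \<open>Turns differences of Poisson weights into polynomial multiples of the weights; the
  polynomials that arise for powers of u are Charlier polynomials. The identity includes n = 0,
  where both sides vanish.\<close>

lemma pois_pred: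
  assumes "t > 0"
  shows "(if n = 0 then 0 else pois t (n - 1)) = pois t n * (real n / t)"
proof (cases n)
  case (Suc k)
  show ?thesis unfolding Suc using pois_Suc[of k t] assms by (simp add: field_simps del: of_nat_Suc)
qed simp

lemma coeff1_u_exp:
  assumes "t > 0"
  shows "coeff1 (ell1_u * exp (t *\<^sub>R ell1_u)) n = pois t n * ((real n - t) / t)"
  unfolding coeff1_u_mult coeff1_exp_u pois_pred[OF assms] using assms by (simp add: field_simps)

lemma coeff1_u2_exp:
  assumes "t > 0"
  shows "coeff1 (ell1_u\<^sup>2 * exp (t *\<^sub>R ell1_u)) n = pois t n * (((real n - t)\<^sup>2 - real n) / t\<^sup>2)"
proof -
  have "coeff1 (ell1_u * (ell1_u * exp (t *\<^sub>R ell1_u))) n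
      = (if n = 0 then 0 else pois t (n - 1)) * ((real n - 1 - t) / t) - pois t n * ((real n - t) / t)"
    unfolding coeff1_u_mult[of "ell1_u * _"] coeff1_u_exp[OF assms] by (cases n) auto
  also have "... = pois t n * (((real n - t)\<^sup>2 - real n) / t\<^sup>2)"
    unfolding pois_pred[OF assms] using assms by (simp add: field_simps power2_eq_square)
  finally show ?thesis by (simp add: power2_eq_square mult.assoc)
qed

text \<open>The polynomial is arranged by size for y of order sqrt t: the first bracket has order
  t^(3/2) and determines the sign, the second has order t and is treated as a perturbation.\<close>

lemma coeff1_u3_exp:
  assumes "t > 0"
  defines "y \<equiv> \<lambda>n. real n - t"
  shows "coeff1 (ell1_u ^ 3 * exp (t *\<^sub>R ell1_u)) n =
    pois t n * ((y n ^ 3 - 3 * t * y n) + (- 3 * (y n)\<^sup>2 + 2 * y n + 2 * t)) / t ^ 3"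
proof -
  have "coeff1 (ell1_u * (ell1_u\<^sup>2 * exp (t *\<^sub>R ell1_u))) n
      = (if n = 0 then 0 else pois t (n - 1)) * (((real n - 1 - t)\<^sup>2 - (real n - 1)) / t\<^sup>2)
        - pois t n * (((real n - t)\<^sup>2 - real n) / t\<^sup>2)"
    unfolding coeff1_u_mult[of "ell1_u\<^sup>2 * _"] coeff1_u2_exp[OF assms(1)] by (cases n) auto
  also have "... = pois t n * ((real n * ((real n - 1 - t)\<^sup>2 - (real n - 1)) - t * ((real n - t)\<^sup>2 - real n)) / t ^ 3)"
    unfolding pois_pred[OF assms(1)] using assms(1) by (simp add: field_simps power2_eq_square power3_eq_cube)
  also have "real n * ((real n - 1 - t)\<^sup>2 - (real n - 1)) - t * ((real n - t)\<^sup>2 - real n) =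
      (y n ^ 3 - 3 * t * y n) + (- 3 * (y n)\<^sup>2 + 2 * y n + 2 * t)"
    unfolding y_def by algebra
  finally show ?thesis by (simp add: power3_eq_cube power2_eq_square mult.assoc)
qed

lemma norm_exp_u_le: "0 \<le> t \<Longrightarrow> norm (exp (t *\<^sub>R ell1_u)) \<le> 1"
  using sums_unique[OF pois_sums, of t]
  by (simp add: norm_ell1_def coeff1_exp_u pois_nonneg)

text \<open>The norm is the mean absolute deviation of the Poisson law divided by t, and the
  variance is t. Cauchy-Schwarz is replaced by the termwise inequality 2 z / sqrt t <= z^2 / t +
  1.\<close>

lemma norm_u_exp_u_le:
  assumes "t > 0"
  shows "norm (ell1_u * exp (t *\<^sub>R ell1_u)) \<le> 1 / sqrt t"
proof -
  have t: "sqrt t > 0" "sqrt t * sqrt t = t" using assms by auto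
  have s: "(\<lambda>n. (1 / (2 * t * sqrt t)) * ((real n - t)\<^sup>2 * pois t n) + (1 / (2 * sqrt t)) * pois t n)
      sums ((1 / (2 * t * sqrt t)) * t + (1 / (2 * sqrt t)) * 1)"
    by (intro sums_add sums_mult pois_variance_sums pois_sums)
  have le: "\<bar>coeff1 (ell1_u * exp (t *\<^sub>R ell1_u)) n\<bar> \<le>
      (1 / (2 * t * sqrt t)) * ((real n - t)\<^sup>2 * pois t n) + (1 / (2 * sqrt t)) * pois t n" for n
  proof -
    define z where "z = \<bar>real n - t\<bar>"
    have "0 \<le> (z / sqrt t - 1)\<^sup>2" by simp
    also have "... = z\<^sup>2 / t - 2 * z / sqrt t + 1"
      using assms by (simp add: power2_diff power_divide)
    finally have "2 * z / sqrt t \<le> z\<^sup>2 / t + 1" by simp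
    then have "2 * z / sqrt t / (2 * sqrt t) \<le> (z\<^sup>2 / t + 1) / (2 * sqrt t)"
      using t by (intro divide_right_mono) auto
    also have "2 * z / sqrt t / (2 * sqrt t) = z / t" using t by (simp add: field_simps)
    finally have "z / t \<le> (1 / (2 * t * sqrt t)) * z\<^sup>2 + 1 / (2 * sqrt t)"
      using t assms by (simp add: field_simps)
    then have "pois t n * (z / t) \<le> pois t n * ((1 / (2 * t * sqrt t)) * z\<^sup>2 + 1 / (2 * sqrt t))"
      using assms by (intro mult_left_mono pois_nonneg) auto
    moreover have "\<bar>coeff1 (ell1_u * exp (t *\<^sub>R ell1_u)) n\<bar> = pois t n * (z / t)"
      using assms by (simp add: coeff1_u_exp abs_mult z_def pois_nonneg)
    ultimately show ?thesis by (simp add: z_def distrib_left mult_ac)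
  qed
  have "norm (ell1_u * exp (t *\<^sub>R ell1_u)) \<le> (1 / (2 * t * sqrt t)) * t + (1 / (2 * sqrt t)) * 1"
    unfolding norm_ell1_def sums_unique[OF s]
    by (rule suminf_le[OF le coeff1_summable sums_summable[OF s]])
  also have "... = 1 / sqrt t" using assms by (simp add: field_simps)
  finally show ?thesis .
qed

section \<open>Stirling's formula with a rate\<close>

text \<open>The error \<open>f\<close> has derivative x^2 / (1 + x), which lies between 0 and 3 x^2
  here. So \<open>f\<close> and t^3 - f t are both nondecreasing and vanish at 0.\<close>

lemma ln_one_plus_quadratic:
  fixes t :: real
  assumes "\<bar>t\<bar> \<le> 1 / 2"
  shows "\<bar>ln (1 + t) - t + t\<^sup>2 / 2\<bar> \<le> \<bar>t\<bar> ^ 3"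
proof -
  define f where "f = (\<lambda>t::real. ln (1 + t) - t + t\<^sup>2 / 2)"
  define g where "g = (\<lambda>t::real. t ^ 3 - f t)"
  have f': "(f has_real_derivative (x\<^sup>2 / (1 + x))) (at x)" if "\<bar>x\<bar> \<le> 1 / 2" for x
    unfolding f_def using that
    by (auto intro!: derivative_eq_intros simp: power2_eq_square field_simps abs_if split: if_splits)
  have g': "(g has_real_derivative (3 * x\<^sup>2 - x\<^sup>2 / (1 + x))) (at x)" if "\<bar>x\<bar> \<le> 1 / 2" for x
    unfolding g_def using f'[OF that] by (auto intro!: derivative_eq_intros)
  have pos: "0 \<le> x\<^sup>2 / (1 + x)" "0 \<le> 3 * x\<^sup>2 - x\<^sup>2 / (1 + x)" if "\<bar>x\<bar> \<le> 1 / 2" for x :: real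
  proof -
    have x: "1 / 2 \<le> 1 + x" using that by auto
    then show "0 \<le> x\<^sup>2 / (1 + x)" by simp
    have "x\<^sup>2 / (1 + x) \<le> x\<^sup>2 / (1 / 2)" using x by (intro divide_left_mono) auto
    also have "... \<le> 3 * x\<^sup>2" by simp
    finally show "0 \<le> 3 * x\<^sup>2 - x\<^sup>2 / (1 + x)" by simp
  qed
  have mono: "f x \<le> f y" "g x \<le> g y" if "- (1/2) \<le> x" "x \<le> y" "y \<le> 1/2" for x y
  proof -
    show "f x \<le> f y"
      by (rule DERIV_nonneg_imp_nondecreasing[OF that(2)]) (use f' pos that in force)
    show "g x \<le> g y"
      by (rule DERIV_nonneg_imp_nondecreasing[OF that(2)]) (use g' pos that in force)
  qed
  have 0: "f 0 = 0" "g 0 = 0" by (simp_all add: f_def g_def)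
  have "\<bar>f t\<bar> \<le> \<bar>t\<bar> ^ 3"
  proof (cases "0 \<le> t")
    case True
    then show ?thesis using mono[of 0 t] assms 0 by (auto simp: g_def)
  next
    case False
    then have "\<bar>t\<bar> ^ 3 = - (t ^ 3)" by (simp add: power3_eq_cube)
    then show ?thesis using mono[of t 0] assms 0 False by (auto simp: g_def)
  qed
  then show ?thesis by (simp add: f_def)
qed

text \<open>Logarithm of the ratio of n! to sqrt n (n / e)^n.\<close>

definition stirling_rem :: "nat \<Rightarrow> real" where
  "stirling_rem n = ln (fact n) - (real n + 1/2) * ln (real n) + real n"

lemma stirling_rem_step:
  assumes "2 \<le> n"
  shows "\<bar>stirling_rem (Suc n) - stirling_rem n\<bar> \<le> 2 / (real n)\<^sup>2"
proof -
  define t where "t = 1 / real n"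
  have t: "0 < t" "t \<le> 1 / 2" using assms by (auto simp: t_def field_simps)
  have nt: "real n = 1 / t" by (simp add: t_def)
  have n: "real n > 0" using assms by simp
  define r where "r = ln (1 + t) - t + t\<^sup>2 / 2"
  have r: "\<bar>r\<bar> \<le> t ^ 3" using ln_one_plus_quadratic[of t] t by (simp add: r_def)
  have "real (Suc n) = real n * (1 + t)" using n by (simp add: t_def field_simps)
  then have lnS: "ln (real (Suc n)) = ln (real n) + ln (1 + t)"
    using n t by (simp add: ln_mult)
  have "ln (fact (Suc n) :: real) = ln (real (Suc n)) + ln (fact n)"
    unfolding fact_Suc by (subst ln_mult) (auto simp del: of_nat_Suc)
  then have "stirling_rem (Suc n) - stirling_rem n = 1 - (real n + 1/2) * ln (1 + t)"
    unfolding stirling_rem_def lnS by (simp add: algebra_simps)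
  also have "... = 1 - (1 / t + 1/2) * (r + t - t\<^sup>2 / 2)"
    unfolding nt by (simp add: r_def)
  also have "... = t\<^sup>2 / 4 - (1 / t + 1/2) * r"
    using t by (simp add: field_simps power2_eq_square)
  also have "\<bar>...\<bar> \<le> t\<^sup>2 / 4 + (1 / t + 1/2) * t ^ 3"
  proof -
    have "\<bar>(1 / t + 1/2) * r\<bar> \<le> (1 / t + 1/2) * t ^ 3"
      unfolding abs_mult using t r by (intro mult_mono) auto
    then show ?thesis using abs_triangle_ineq4[of "t\<^sup>2 / 4" "(1 / t + 1/2) * r"] by simp
  qed
  also have "... = t\<^sup>2 * (5 / 4 + t / 2)" using t by (simp add: field_simps power2_eq_square power3_eq_cube)
  also have "... \<le> t\<^sup>2 * 2" using t by (intro mult_left_mono) auto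
  finally show ?thesis by (simp add: t_def power_divide)
qed

text \<open>Steps of size 2 / n^2 are dominated by differences of 2 / (n - 1). Subtracting or adding
  this quantity thus gives an increasing and a decreasing sequence that enclose the limit, and the
  enclosure is the rate. The shift by 2 skips the indices without a step bound.\<close>

lemma stirling_rem_limit:
  obtains l where "stirling_rem \<longlonglongrightarrow> l" "\<And>n. 2 \<le> n \<Longrightarrow> \<bar>stirling_rem n - l\<bar> \<le> 2 / (real n - 1)"
proof -
  define s where "s n = stirling_rem (n + 2)" for n
  define f where "f n = s n - 2 / (real n + 1)" for n
  define g where "g n = s n + 2 / (real n + 1)" for n
  have step: "\<bar>s (Suc n) - s n\<bar> \<le> 2 / (real n + 1) - 2 / (real (Suc n) + 1)" for n
  proof -
    have "\<bar>s (Suc n) - s n\<bar> \<le> 2 / (real (n + 2))\<^sup>2"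
      using stirling_rem_step[of "n + 2"] by (simp add: s_def)
    also have "... \<le> 2 / ((real n + 1) * (real n + 2))"
      unfolding power2_eq_square by (intro divide_left_mono mult_mono) auto
    also have "... = 2 / (real n + 1) - 2 / (real (Suc n) + 1)"
      by (simp add: field_simps)
    finally show ?thesis .
  qed
  have lim0: "(\<lambda>n. 2 / (real n + 1)) \<longlonglongrightarrow> 0" by real_asymp
  have "\<exists>l. ((\<forall>n. f n \<le> l) \<and> f \<longlonglongrightarrow> l) \<and> ((\<forall>n. l \<le> g n) \<and> g \<longlonglongrightarrow> l)"
  proof (rule nested_sequence_unique; (intro allI)?)
    show "f n \<le> f (Suc n)" "g (Suc n) \<le> g n" for n
      using step[of n] by (simp_all add: f_def g_def abs_le_iff)
    show "f n \<le> g n" for n by (simp add: f_def g_def)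
    have "(\<lambda>n. f n - g n) = (\<lambda>n. - 4 / (real n + 1))" by (auto simp: f_def g_def)
    moreover have "(\<lambda>n. - 4 / (real n + 1)) \<longlonglongrightarrow> 0" by real_asymp
    ultimately show "(\<lambda>n. f n - g n) \<longlonglongrightarrow> 0" by simp
  qed
  then obtain l where l: "\<And>n. f n \<le> l" "\<And>n. l \<le> g n" "f \<longlonglongrightarrow> l" by blast
  have "(\<lambda>n. f n + 2 / (real n + 1)) \<longlonglongrightarrow> l + 0" by (intro tendsto_add l lim0)
  then have "(\<lambda>n. stirling_rem (n + 2)) \<longlonglongrightarrow> l" by (simp add: f_def s_def)
  then have "stirling_rem \<longlonglongrightarrow> l" by (rule LIMSEQ_offset)
  moreover have "\<bar>stirling_rem n - l\<bar> \<le> 2 / (real n - 1)" if "2 \<le> n" for n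
  proof -
    have "n - 2 + 2 = n" "real (n - 2) + 1 = real n - 1" using that by auto
    then have "s (n - 2) = stirling_rem n" unfolding s_def by (simp only:)
    then show ?thesis using l(1,2)[of "n - 2"] \<open>real (n - 2) + 1 = real n - 1\<close>
      by (simp add: f_def g_def abs_le_iff)
  qed
  ultimately show thesis using that by blast
qed

lemma wallis_product_fact:
  "(\<Prod>k=1..n. (4 * real k^2) / (4 * real k^2 - 1)) = 16 ^ n * fact n ^ 4 / ((fact (2 * n))\<^sup>2 * (2 * real n + 1))"
proof (induction n)
  case (Suc n)
  have nz: "4 * (real (Suc n))\<^sup>2 - 1 = (2 * real n + 1) * (2 * real n + 3)" by (simp add: power2_eq_square algebra_simps)
  have fS: "fact (2 * Suc n) = (2 * real n + 2) * (2 * real n + 1) * (fact (2 * n) :: real)"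
    by (simp add: algebra_simps)
  have "(\<Prod>k=1..Suc n. (4 * real k^2) / (4 * real k^2 - 1)) =
      16 ^ n * fact n ^ 4 / ((fact (2 * n))\<^sup>2 * (2 * real n + 1)) * (4 * (real n + 1)\<^sup>2 / ((2 * real n + 1) * (2 * real n + 3)))"
    using Suc nz by (simp add: add.commute)
  also have "... = 16 ^ Suc n * ((real n + 1) * fact n) ^ 4 /
      (((2 * real n + 2) * (2 * real n + 1) * (fact (2 * n) :: real))\<^sup>2 * (2 * real n + 3))"
  proof -
    define F H N where "F = (fact n :: real)" and "H = (fact (2 * n) :: real)" and "N = real n"
    have "H > 0" "N \<ge> 0" by (simp_all add: H_def N_def)
    then have "H \<noteq> 0" "2 * N + 1 \<noteq> 0" "2 * N + 3 \<noteq> 0" "N + 1 \<noteq> 0" by auto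
    then have "P * F ^ 4 / (H\<^sup>2 * (2 * N + 1)) * (4 * (N + 1)\<^sup>2 / ((2 * N + 1) * (2 * N + 3))) =
      (16 * P) * ((N + 1) * F) ^ 4 / ((2 * (N + 1) * (2 * N + 1) * H)\<^sup>2 * (2 * N + 3))" for P
      by (simp add: divide_simps) algebra
    from this[of "16 ^ n"] show ?thesis by (simp add: F_def H_def N_def algebra_simps)
  qed
  finally show ?case unfolding fS by (simp add: add.commute algebra_simps)
qed simp

text \<open>In the logarithm of the Wallis product the remainders occur as 4 stirling_rem n - 2
  stirling_rem (2 n), so the limit l satisfies 2 l - 2 ln 2 = ln (pi / 2).\<close>

lemma stirling_rem_tendsto: "stirling_rem \<longlonglongrightarrow> ln (2 * pi) / 2"
proof -
  obtain l where l: "stirling_rem \<longlonglongrightarrow> l" by (rule stirling_rem_limit) blast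
  have l2: "(\<lambda>n. stirling_rem (2 * n)) \<longlonglongrightarrow> l"
    by (rule filterlim_compose[OF l]) real_asymp
  have "(\<lambda>n. ln (\<Prod>k=1..n. (4 * real k^2) / (4 * real k^2 - 1))) \<longlonglongrightarrow> ln (pi / 2)"
    by (intro tendsto_ln wallis) auto
  moreover have "\<forall>\<^sub>F n in sequentially. ln (\<Prod>k=1..n. (4 * real k^2) / (4 * real k^2 - 1)) =
      4 * stirling_rem n - 2 * stirling_rem (2 * n) + (ln (real n) - ln 2 - ln (2 * real n + 1))"
    using eventually_gt_at_top[of 0]
  proof eventually_elim
    case (elim n)
    have "ln (16 :: real) = 4 * ln 2" using ln_realpow[of "2::real" 4] by simp
    then have "ln (16 ^ n * fact n ^ 4 / ((fact (2 * n))\<^sup>2 * (2 * real n + 1)) :: real) =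
        real n * (4 * ln 2) + 4 * ln (fact n) - (2 * ln (fact (2 * n)) + ln (2 * real n + 1))"
      by (subst ln_div) (auto simp: ln_mult ln_realpow add_pos_nonneg)
    moreover have "ln (2 * real n) = ln 2 + ln (real n)" using elim by (simp add: ln_mult)
    ultimately show ?case
      unfolding wallis_product_fact stirling_rem_def by (simp add: algebra_simps)
  qed
  ultimately have "(\<lambda>n. 4 * stirling_rem n - 2 * stirling_rem (2 * n) + (ln (real n) - ln 2 - ln (2 * real n + 1)))
      \<longlonglongrightarrow> ln (pi / 2)"
    by (rule Lim_transform_eventually)
  moreover have "(\<lambda>n. 4 * stirling_rem n - 2 * stirling_rem (2 * n) + (ln (real n) - ln 2 - ln (2 * real n + 1)))
      \<longlonglongrightarrow> 4 * l - 2 * l + (- ln 2 - ln 2)"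
  proof -
    have "(\<lambda>n. ln (real n) - ln 2 - ln (2 * real n + 1)) \<longlonglongrightarrow> - ln 2 - ln 2" by real_asymp
    then show ?thesis
      by (intro tendsto_add[OF tendsto_diff[OF tendsto_mult[OF tendsto_const l] tendsto_mult[OF tendsto_const l2]]])
  qed
  ultimately have "ln (pi / 2) = 4 * l - 2 * l + (- ln 2 - ln 2)" by (rule LIMSEQ_unique)
  then have "2 * l = ln (2 * pi)" by (simp add: ln_div ln_mult)
  then have "l = ln (2 * pi) / 2" by simp
  then show ?thesis using l by (simp only:)
qed

lemma stirling_rem_bound:
  assumes "2 \<le> n"
  shows "\<bar>stirling_rem n - ln (2 * pi) / 2\<bar> \<le> 2 / (real n - 1)"
proof -
  obtain l where l: "stirling_rem \<longlonglongrightarrow> l" "\<And>n. 2 \<le> n \<Longrightarrow> \<bar>stirling_rem n - l\<bar> \<le> 2 / (real n - 1)"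
    by (rule stirling_rem_limit) blast
  have "l = ln (2 * pi) / 2" by (rule LIMSEQ_unique[OF l(1) stirling_rem_tendsto])
  then show ?thesis using l(2)[OF assms] by simp
qed

section \<open>The third difference of the Poisson distribution\<close>

lemma abs_exp_diff_le:
  fixes d z :: real
  assumes "z \<le> 0"
  shows "\<bar>exp (z + d) - exp z\<bar> \<le> \<bar>d\<bar> * exp \<bar>d\<bar>"
proof -
  have *: "\<bar>exp d - 1\<bar> \<le> \<bar>d\<bar> * exp \<bar>d\<bar>"
  proof (cases "0 \<le> d")
    case True
    have "1 - d \<le> exp (- d)" using exp_ge_add_one_self[of "- d"] by simp
    then have "(1 - d) * exp d \<le> exp (- d) * exp d" by (intro mult_right_mono) auto
    then have "exp d - 1 \<le> d * exp d" by (simp add: algebra_simps flip: exp_add)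
    then show ?thesis using True by simp
  next
    case False
    have "1 + d \<le> exp d" by (rule exp_ge_add_one_self)
    moreover have "exp d \<le> 1" using False by simp
    ultimately have "\<bar>exp d - 1\<bar> \<le> \<bar>d\<bar> * 1" using False by linarith
    also have "... \<le> \<bar>d\<bar> * exp \<bar>d\<bar>" by (intro mult_left_mono) auto
    finally show ?thesis .
  qed
  have "\<bar>exp (z + d) - exp z\<bar> = exp z * \<bar>exp d - 1\<bar>"
  proof -
    have "exp (z + d) - exp z = exp z * (exp d - 1)" by (simp add: exp_add algebra_simps)
    then show ?thesis by (simp add: abs_mult)
  qed
  also have "... \<le> 1 * \<bar>exp d - 1\<bar>" using assms by (intro mult_right_mono) auto
  finally show ?thesis using * by simp
qed

lemma pois_log:
  assumes "0 < t" "0 < k"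
  shows "pois t k = exp (real k - t - real k * ln (real k / t) - ln (real k) / 2 - stirling_rem k)"
proof -
  have "pois t k = exp (- t + real k * ln t - ln (fact k))"
    using assms exp_of_nat_mult[of k "ln t"] by (simp add: pois_def exp_diff exp_add exp_minus field_simps)
  also have "- t + real k * ln t - ln (fact k) =
      real k - t - real k * ln (real k / t) - ln (real k) / 2 - stirling_rem k"
    using assms by (simp add: stirling_rem_def ln_div algebra_simps)
  finally show ?thesis .
qed

text \<open>A local limit theorem with the error kept in the exponent. The window is slightly wider
  than 2 sqrt t because k will be a rounded point t + x sqrt t with |x| <= 2, and rounding costs at
  most 1 <= sqrt t / 10.\<close>

lemma pois_local:
  assumes t: "100 \<le> t" and k: "\<bar>real k - t\<bar> \<le> 21/10 * sqrt t"
  defines "y \<equiv> real k - t"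
  shows "\<exists>d. sqrt t * pois t k = exp (- (y\<^sup>2 / (2 * t)) + d) / sqrt (2 * pi) \<and> \<bar>d\<bar> \<le> 40 / sqrt t"
proof -
  have st: "sqrt t \<ge> 10" "sqrt t * sqrt t = t"
    using t real_sqrt_le_mono[of 100 t] by auto
  have t21: "21/10 * sqrt t \<le> 21/100 * t"
  proof -
    have "10 * sqrt t \<le> sqrt t * sqrt t" using st by (intro mult_right_mono) auto
    then show ?thesis using st by simp
  qed
  have c_sqrt: "c * v / (v * v) = c / v" if "v > 0" for c v :: real using that by simp
  define x where "x = y / t"
  have x: "\<bar>x\<bar> \<le> 21/10 / sqrt t"
  proof -
    have "\<bar>x\<bar> = \<bar>y\<bar> / t" using t by (simp add: x_def)
    also have "... \<le> (21/10 * sqrt t) / t"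
      using k t unfolding y_def by (intro divide_right_mono) auto
    also have "... = (21/10 * sqrt t) / (sqrt t * sqrt t)" using st by simp
    also have "... = 21/10 / sqrt t" by (rule c_sqrt) (use t in simp)
    finally show ?thesis .
  qed
  have "21/10 / sqrt t \<le> 21/10 / 10" using st t by (intro divide_left_mono) auto
  then have x2: "\<bar>x\<bar> \<le> 21/100" using x by simp
  have kx: "real k = t * (1 + x)" using t by (simp add: x_def y_def field_simps)
  have k79: "real k \<ge> 79/100 * t" using x2 t unfolding kx by (simp add: abs_le_iff)
  then have k2: "2 \<le> k" using t by linarith
  define f where "f = ln (1 + x) - x + x\<^sup>2 / 2"
  have f: "\<bar>f\<bar> \<le> \<bar>x\<bar> ^ 3" unfolding f_def by (rule ln_one_plus_quadratic) (use x2 in simp)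
  have lnx: "ln (1 + x) = x - x\<^sup>2 / 2 + f" by (simp add: f_def)
  have lnk: "ln (real k) = ln t + ln (1 + x)" unfolding kx using t x2 by (subst ln_mult) (auto simp: abs_le_iff)
  \<comment> \<open>The three errors: \<open>d1\<close> is the Taylor remainder of the entropy k ln
    (k / t), \<open>d2\<close> comes from sqrt k in place of sqrt t, and \<open>d3\<close> from
    Stirling's formula.\<close>
  define d1 where "d1 = t * (x ^ 3 / 2 - (1 + x) * f)"
  define d2 where "d2 = - ln (1 + x) / 2"
  define d3 where "d3 = - (stirling_rem k - ln (2 * pi) / 2)"
  have main: "real k - t - real k * ln (real k / t) = - (y\<^sup>2 / (2 * t)) + d1"
  proof -
    have A: "real k / t = 1 + x" using kx t by simp
    have "real k - t - real k * ln (real k / t) = t * x - t * (1 + x) * (x - x\<^sup>2 / 2 + f)"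
      unfolding A unfolding kx lnx by (simp add: algebra_simps)
    also have "... = - (t * x\<^sup>2 / 2) + d1"
      unfolding d1_def by (simp add: algebra_simps power2_eq_square power3_eq_cube)
    also have "t * x\<^sup>2 / 2 = y\<^sup>2 / (2 * t)" using t by (simp add: x_def power2_eq_square)
    finally show ?thesis .
  qed
  have "pois t k = exp (- (y\<^sup>2 / (2 * t)) + (d1 + d2 + d3) - ln t / 2 - ln (2 * pi) / 2)"
  proof -
    have "real k - t - real k * ln (real k / t) - ln (real k) / 2 - stirling_rem k =
        - (y\<^sup>2 / (2 * t)) + (d1 + d2 + d3) - ln t / 2 - ln (2 * pi) / 2"
      unfolding main lnk d2_def d3_def by (simp add: add_divide_distrib)
    then show ?thesis using pois_log[of t k] t k2 by simp
  qed
  also have "... = exp (- (y\<^sup>2 / (2 * t)) + (d1 + d2 + d3)) / (exp (ln t / 2) * exp (ln (2 * pi) / 2))"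
    by (simp only: exp_diff divide_divide_eq_left)
  also have "exp (ln t / 2) = sqrt t" using t by (subst ln_sqrt[symmetric]) auto
  also have "exp (ln (2 * pi) / 2) = sqrt (2 * pi)" by (subst ln_sqrt[symmetric]) auto
  finally have eq: "sqrt t * pois t k = exp (- (y\<^sup>2 / (2 * t)) + (d1 + d2 + d3)) / sqrt (2 * pi)"
    using st t by simp
  have x3: "t * \<bar>x\<bar> ^ 3 \<le> 10 / sqrt t"
  proof -
    have "t * \<bar>x\<bar> ^ 3 \<le> (sqrt t * sqrt t) * (21/10 / sqrt t) ^ 3"
      using x t st by (intro mult_mono power_mono) auto
    also have "... = (21/10) ^ 3 / sqrt t"
    proof -
      have "v * v * (c / v) ^ 3 = c ^ 3 / v" if "v > 0" for c v :: real
        using that by (simp add: power3_eq_cube field_simps)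
      from this[of "sqrt t" "21/10"] show ?thesis using t by simp
    qed
    also have "... \<le> 10 / sqrt t" using st by (intro divide_right_mono) (auto simp: power3_eq_cube)
    finally show ?thesis .
  qed
  have "\<bar>x ^ 3 / 2 - (1 + x) * f\<bar> \<le> \<bar>x\<bar> ^ 3 / 2 + 2 * \<bar>x\<bar> ^ 3"
  proof -
    have "\<bar>(1 + x) * f\<bar> \<le> 2 * \<bar>x\<bar> ^ 3" unfolding abs_mult using f x2 by (intro mult_mono) auto
    then show ?thesis using abs_triangle_ineq4[of "x ^ 3 / 2" "(1 + x) * f"] by (simp add: power_abs)
  qed
  then have "\<bar>d1\<bar> \<le> t * (\<bar>x\<bar> ^ 3 / 2 + 2 * \<bar>x\<bar> ^ 3)"
    unfolding d1_def abs_mult using t by (simp add: mult_left_mono)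
  then have d1: "\<bar>d1\<bar> \<le> 25 / sqrt t" using x3 by (simp add: algebra_simps)
  have d2: "\<bar>d2\<bar> \<le> 3 / sqrt t"
  proof -
    have 1: "\<bar>x\<bar> ^ 3 \<le> \<bar>x\<bar>" "x\<^sup>2 \<le> \<bar>x\<bar>"
      using x2 power_decreasing[of 1 3 "\<bar>x\<bar>"] power_decreasing[of 1 2 "\<bar>x\<bar>"] by auto
    then have "\<bar>ln (1 + x)\<bar> \<le> 5 / 2 * \<bar>x\<bar>" unfolding lnx using f zero_le_power2[of x] by linarith
    also have "... \<le> 5 / 2 * (21/10 / sqrt t)" using x by simp
    also have "... = (21/4) / sqrt t" by simp
    also have "... \<le> 6 / sqrt t" using t by (intro divide_right_mono) auto
    finally show ?thesis by (simp add: d2_def)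
  qed
  have d3: "\<bar>d3\<bar> \<le> 12 / sqrt t"
  proof -
    have "\<bar>d3\<bar> \<le> 2 / (real k - 1)" using stirling_rem_bound[OF k2] by (simp only: d3_def abs_minus_cancel)
    also have "... \<le> 2 / (t / 2)" using k79 t by (intro divide_left_mono) auto
    also have "... = 4 / (sqrt t * sqrt t)" using st by simp
    also have "... \<le> 4 / (1 * sqrt t)" using st t by (intro divide_left_mono mult_right_mono) auto
    also have "... \<le> 12 / sqrt t" using t by (simp add: divide_right_mono)
    finally show ?thesis .
  qed
  have "\<bar>d1 + d2 + d3\<bar> \<le> 25 / sqrt t + 3 / sqrt t + 12 / sqrt t"
    using d1 d2 d3 by linarith
  also have "... = 40 / sqrt t" by (simp add: add_divide_distrib[symmetric])
  finally show ?thesis using eq by blast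
qed

text \<open>The second difference at t + x sqrt t is, after scaling by t^(3/2), the second
  derivative (x^2 - 1) exp (- x^2 / 2) / sqrt (2 pi) of the normal density. It will be evaluated at
  the zeros - sqrt 3, 0, sqrt 3 of the third derivative.\<close>

lemma second_difference_local:
  "\<exists>C. \<forall>t x k. 100 \<le> t \<longrightarrow> \<bar>x\<bar> \<le> 2 \<longrightarrow> k = nat \<lfloor>t + x * sqrt t\<rfloor> \<longrightarrow>
     \<bar>pois t k * (((real k - t)\<^sup>2 - real k) / t\<^sup>2)
       - (x\<^sup>2 - 1) * exp (- (x\<^sup>2 / 2)) / sqrt (2 * pi) / (t * sqrt t)\<bar> \<le> C / t\<^sup>2"
proof -
  \<comment> \<open>The exponent is off by at most 40 / sqrt t from \<open>pois_local\<close> plus 5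
    / (2 sqrt t) from rounding, hence 43; the factor 5 bounds the polynomial factor
    \<open>Q\<close>, and 9 exceeds the 8 from the error of \<open>Q\<close>.\<close>
  define C where "C = 9 + 5 * (43 * exp (43 :: real))"
  show ?thesis
  proof (intro exI[of _ C] allI impI)
    fix t x :: real and k :: nat
    assume t: "100 \<le> t" and x: "\<bar>x\<bar> \<le> 2" and k: "k = nat \<lfloor>t + x * sqrt t\<rfloor>"
    have st: "sqrt t \<ge> 10" "sqrt t * sqrt t = t"
      using t real_sqrt_le_mono[of 100 t] by auto
    have xt: "\<bar>x * sqrt t\<bar> \<le> 2 * sqrt t" unfolding abs_mult using x st by (intro mult_mono) auto
    have "10 * sqrt t \<le> sqrt t * sqrt t" using st by (intro mult_right_mono) auto
    then have "t + x * sqrt t \<ge> 0" using xt st by (simp add: abs_le_iff)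
    then have kf: "real k \<le> t + x * sqrt t" "t + x * sqrt t < real k + 1"
      unfolding k by (auto simp: of_nat_nat)
    define y where "y = real k - t"
    define h where "h = x * sqrt t - y"
    have h: "0 \<le> h" "h < 1" using kf by (auto simp: h_def y_def)
    have yh: "y = x * sqrt t - h" by (simp add: h_def)
    have ky: "\<bar>real k - t\<bar> \<le> 21/10 * sqrt t"
      using xt h st unfolding y_def[symmetric] yh by linarith
    obtain d where d: "sqrt t * pois t k = exp (- (y\<^sup>2 / (2 * t)) + d) / sqrt (2 * pi)" "\<bar>d\<bar> \<le> 40 / sqrt t"
      using pois_local[OF t ky] unfolding y_def by blast
    \<comment> \<open>The effect on y^2 / t of rounding t + x sqrt t down to k, where h in [0, 1) is
      the part cut off.\<close>
    define r where "r = (h\<^sup>2 - 2 * x * sqrt t * h) / t"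
    have y2: "y\<^sup>2 / t = x\<^sup>2 + r"
      using t st unfolding yh r_def by (simp add: field_simps power2_eq_square)
    have r: "\<bar>r\<bar> \<le> 5 / sqrt t"
    proof -
      have "\<bar>h\<^sup>2 - 2 * x * sqrt t * h\<bar> \<le> \<bar>h\<^sup>2\<bar> + \<bar>2 * x * sqrt t * h\<bar>" by (rule abs_triangle_ineq4)
      also have "\<bar>h\<^sup>2\<bar> \<le> 1" using h by (simp add: abs_square_le_1)
      also have "\<bar>2 * x * sqrt t * h\<bar> \<le> (2 * 2 * sqrt t) * 1"
        unfolding abs_mult using x h st by (intro mult_mono) auto
      finally have "\<bar>h\<^sup>2 - 2 * x * sqrt t * h\<bar> \<le> 5 * sqrt t" using st by simp
      then have "\<bar>r\<bar> \<le> 5 * sqrt t / t" unfolding r_def using t by (simp add: divide_right_mono)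
      also have "5 * sqrt t / t = 5 / sqrt t" using st t by (simp add: field_simps)
      finally show ?thesis .
    qed
    define P where "P = sqrt t * pois t k"
    define Q where "Q = (y\<^sup>2 - real k) / t"
    define E where "E = exp (- (x\<^sup>2 / 2)) / sqrt (2 * pi)"
    have pi1: "1 \<le> sqrt (2 * pi)" using pi_ge_two by simp
    have "P = exp (- (x\<^sup>2 / 2) + (d - r / 2)) / sqrt (2 * pi)"
    proof -
      have "- (y\<^sup>2 / (2 * t)) + d = - (x\<^sup>2 / 2) + (d - r / 2)" using y2 by simp
      then show ?thesis unfolding P_def d(1) by simp
    qed
    then have "\<bar>P - E\<bar> = \<bar>exp (- (x\<^sup>2 / 2) + (d - r / 2)) - exp (- (x\<^sup>2 / 2))\<bar> / sqrt (2 * pi)"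
      by (simp add: E_def flip: diff_divide_distrib)
    also have "... \<le> (\<bar>d - r / 2\<bar> * exp \<bar>d - r / 2\<bar>) / 1"
      using pi1 by (intro frac_le abs_exp_diff_le) auto
    also have dr: "\<bar>d - r / 2\<bar> \<le> 43 / sqrt t"
    proof -
      have "\<bar>d - r / 2\<bar> \<le> \<bar>d\<bar> + \<bar>r\<bar> / 2" using abs_triangle_ineq4[of d "r / 2"] by simp
      also have "... \<le> 40 / sqrt t + 5 / sqrt t / 2" by (intro add_mono divide_right_mono d(2) r) simp
      also have "... = (85 / 2) / sqrt t" by simp
      also have "... \<le> 43 / sqrt t" using t by (intro divide_right_mono) auto
      finally show ?thesis .
    qed
    then have "(\<bar>d - r / 2\<bar> * exp \<bar>d - r / 2\<bar>) / 1 \<le> (43 / sqrt t * exp 43) / 1"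
    proof -
      have "43 / sqrt t \<le> 43 / 1" using st t by (intro divide_left_mono) auto
      then have "\<bar>d - r / 2\<bar> \<le> 43" using dr by simp
      then show ?thesis using dr t by (intro divide_right_mono mult_mono) auto
    qed
    finally have PE: "\<bar>P - E\<bar> \<le> 43 * exp 43 / sqrt t" by simp
    have Q: "Q = (x\<^sup>2 - 1) + (r - y / t)"
      using y2 t unfolding Q_def by (simp add: y_def field_simps)
    have yt: "\<bar>y / t\<bar> \<le> 3 / sqrt t"
    proof -
      have "\<bar>y\<bar> \<le> 3 * sqrt t" using ky st by (simp add: y_def)
      then have "\<bar>y / t\<bar> \<le> 3 * sqrt t / t" using t by (simp add: divide_right_mono)
      also have "3 * sqrt t / t = 3 / sqrt t" using st t by (simp add: field_simps)
      finally show ?thesis .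
    qed
    have Qd: "\<bar>Q - (x\<^sup>2 - 1)\<bar> \<le> 8 / sqrt t"
    proof -
      have "\<bar>Q - (x\<^sup>2 - 1)\<bar> \<le> 5 / sqrt t + 3 / sqrt t" unfolding Q using r yt by linarith
      then show ?thesis by (simp flip: add_divide_distrib)
    qed
    have x24: "\<bar>x\<^sup>2 - 1\<bar> \<le> 4"
    proof -
      have "x\<^sup>2 \<le> 4" using x power_mono[of "\<bar>x\<bar>" 2 2] by simp
      then show ?thesis using zero_le_power2[of x] by linarith
    qed
    have "8 / sqrt t \<le> 8 / 8" using st t by (intro divide_left_mono) auto
    then have Q5: "\<bar>Q\<bar> \<le> 5" using Qd x24 by linarith
    have E1: "\<bar>E\<bar> \<le> 1"
    proof -
      have "exp (- (x\<^sup>2 / 2)) / sqrt (2 * pi) \<le> 1 / 1" using pi1 by (intro frac_le) auto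
      then show ?thesis by (simp add: E_def)
    qed
    have "\<bar>P * Q - (x\<^sup>2 - 1) * E\<bar> = \<bar>(P - E) * Q + E * (Q - (x\<^sup>2 - 1))\<bar>" by (simp add: algebra_simps)
    also have "... \<le> \<bar>P - E\<bar> * \<bar>Q\<bar> + \<bar>E\<bar> * \<bar>Q - (x\<^sup>2 - 1)\<bar>"
      unfolding abs_mult[symmetric] by (rule abs_triangle_ineq)
    also have "... \<le> 43 * exp 43 / sqrt t * 5 + 1 * (8 / sqrt t)"
      using PE Q5 E1 Qd by (intro add_mono mult_mono) auto
    also have "... \<le> C / sqrt t"
    proof -
      have "A / v * 5 + 1 * (8 / v) \<le> (9 + 5 * A) / v" if "v > 0" for A v :: real
        using that by (simp add: field_simps)
      from this[of "sqrt t" "43 * exp 43"] show ?thesis using t unfolding C_def by simp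
    qed
    finally have fin: "\<bar>P * Q - (x\<^sup>2 - 1) * E\<bar> \<le> C / sqrt t" .
    have "pois t k * (((real k - t)\<^sup>2 - real k) / t\<^sup>2) = P * Q / (t * sqrt t)"
      using t st unfolding P_def Q_def y_def by (simp add: field_simps power2_eq_square)
    moreover have "(x\<^sup>2 - 1) * exp (- (x\<^sup>2 / 2)) / sqrt (2 * pi) / (t * sqrt t) = (x\<^sup>2 - 1) * E / (t * sqrt t)"
      by (simp add: E_def)
    ultimately have "\<bar>pois t k * (((real k - t)\<^sup>2 - real k) / t\<^sup>2)
       - (x\<^sup>2 - 1) * exp (- (x\<^sup>2 / 2)) / sqrt (2 * pi) / (t * sqrt t)\<bar> = \<bar>P * Q - (x\<^sup>2 - 1) * E\<bar> / (t * sqrt t)"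
      using t by (simp flip: diff_divide_distrib)
    also have "... \<le> (C / sqrt t) / (t * sqrt t)" using fin t by (intro divide_right_mono) auto
    also have "... = C / t\<^sup>2" using st by (simp add: power2_eq_square mult_ac)
    finally show "\<bar>pois t k * (((real k - t)\<^sup>2 - real k) / t\<^sup>2)
       - (x\<^sup>2 - 1) * exp (- (x\<^sup>2 / 2)) / sqrt (2 * pi) / (t * sqrt t)\<bar> \<le> C / t\<^sup>2" .
  qed
qed

text \<open>
  Up to a perturbation \<open>R\<close> of mean \<open>O(t)\<close>, the sign of the \<open>k\<close>-th coefficient is that of
  \<open>y (y\<^sup>2 - 3 t)\<close> with \<open>y = k - t\<close>. The sum with these signs telescopes.
\<close>

lemma norm_u3_exp_decomp:
  fixes t :: real
  assumes t: "100 \<le> t"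
  defines "g \<equiv> \<lambda>k. pois t k * (((real k - t)\<^sup>2 - real k) / t\<^sup>2)"
    and "kk \<equiv> \<lambda>x. nat \<lfloor>t + x * sqrt t\<rfloor>"
  shows "\<bar>norm (ell1_u ^ 3 * exp (t *\<^sub>R ell1_u)) - (2 * g (kk (- sqrt 3)) - 2 * g (kk 0) + 2 * g (kk (sqrt 3)))\<bar> \<le> 14 / t\<^sup>2"
proof -
  have t0: "t > 0" using t by simp
  have st: "sqrt t \<ge> 10" "sqrt t * sqrt t = t"
    using t real_sqrt_le_mono[of 100 t] by auto
  define f where "f = coeff1 (ell1_u ^ 3 * exp (t *\<^sub>R ell1_u))"
  have g: "g = coeff1 (ell1_u\<^sup>2 * exp (t *\<^sub>R ell1_u))"
    unfolding g_def coeff1_u2_exp[OF t0, abs_def] by simp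
  have fg: "f k = (if k = 0 then 0 else g (k - 1)) - g k" for k
    unfolding f_def g power3_eq_cube power2_eq_square mult.assoc by (rule coeff1_u_mult)
  have part: "(\<Sum>k\<le>K. f k) = - g K" for K
    by (induction K) (auto simp: fg)
  have fs: "summable (\<lambda>k. \<bar>f k\<bar>)" unfolding f_def by (rule coeff1_summable)
  have gs: "summable (\<lambda>k. \<bar>g k\<bar>)" unfolding g by (rule coeff1_summable)
  have "(\<lambda>K. - g K) \<longlonglongrightarrow> - 0"
    using summable_LIMSEQ_zero[OF summable_rabs_cancel[OF gs]] by (intro tendsto_minus)
  then have f0: "f sums 0" unfolding sums_def_le part by simp
  define k1 k2 k3 where "k1 = kk (- sqrt 3)" and "k2 = kk 0" and "k3 = kk (sqrt 3)"
  have s3: "1 < sqrt 3" "sqrt 3 < 2" "sqrt 3 * sqrt 3 = (3 :: real)"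
    using real_sqrt_less_mono[of 1 3] real_sqrt_less_mono[of 3 4] by auto
  define q where "q = sqrt 3 * sqrt t"
  have q: "q > 0" "q * q = 3 * t" "q \<le> t"
  proof -
    show "q > 0" unfolding q_def by (rule mult_pos_pos) (use t0 in auto)
    show "q * q = 3 * t" unfolding q_def using s3(3) st(2) by (metis mult.assoc mult.left_commute)
    have "sqrt 3 * sqrt t \<le> sqrt t * sqrt t" by (rule mult_right_mono) (use s3 st in linarith)+
    then show "q \<le> t" using st by (simp add: q_def)
  qed
  \<comment> \<open>Because q <= t, the point t - q is nonnegative and \<open>nat\<close> truncates
    nothing, so the thresholds are plain conditions on y.\<close>
  have kle: "k \<le> k1 \<longleftrightarrow> real k - t \<le> - q" "k \<le> k2 \<longleftrightarrow> real k - t \<le> 0" "k \<le> k3 \<longleftrightarrow> real k - t \<le> q" for k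
  proof -
    have *: "k \<le> nat \<lfloor>t + z\<rfloor> \<longleftrightarrow> real k - t \<le> z" if "0 \<le> t + z" for z
      using that by (auto simp: le_nat_iff le_floor_iff)
    show "k \<le> k1 \<longleftrightarrow> real k - t \<le> - q" "k \<le> k2 \<longleftrightarrow> real k - t \<le> 0" "k \<le> k3 \<longleftrightarrow> real k - t \<le> q"
      unfolding k1_def k2_def k3_def kk_def using *[of "- q"] *[of 0] *[of q] q t0 by (auto simp: q_def)
  qed
  \<comment> \<open>The signs -1, 1, -1, 1 on the four intervals cut out by - q, 0 and q. Written
    through indicators of initial segments, the signed sum becomes a combination of the partial sums
    \<open>part\<close>.\<close>
  define s where "s k = 1 - 2 * (if k \<in> {..k3} then 1 else 0) + 2 * (if k \<in> {..k2} then 1 else 0)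
      - 2 * (if k \<in> {..k1} then 1 else (0::real))" for k
  have sf: "(\<lambda>k. s k * f k) sums (2 * g k1 - 2 * g k2 + 2 * g k3)"
  proof -
    have i: "(\<lambda>k. if k \<in> {..K} then f k else 0) sums (- g K)" for K
      using sums_If_finite_set[of "{..K}" f] part by simp
    have "(\<lambda>k. f k - 2 * (if k \<in> {..k3} then f k else 0) + 2 * (if k \<in> {..k2} then f k else 0)
      - 2 * (if k \<in> {..k1} then f k else 0)) sums (0 - 2 * (- g k3) + 2 * (- g k2) - 2 * (- g k1))"
      by (intro sums_add sums_diff sums_mult i f0)
    moreover have "(\<lambda>k. f k - 2 * (if k \<in> {..k3} then f k else 0) + 2 * (if k \<in> {..k2} then f k else 0)
      - 2 * (if k \<in> {..k1} then f k else 0)) = (\<lambda>k. s k * f k)"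
      by (auto simp: s_def fun_eq_iff)
    ultimately show ?thesis by (simp add: algebra_simps)
  qed
  define R where "R k = - 3 * (real k - t)\<^sup>2 + 2 * (real k - t) + 2 * t" for k
  have err: "\<bar>\<bar>f k\<bar> - s k * f k\<bar> \<le> 2 * (4 * ((real k - t)\<^sup>2 * pois t k) + (2 * t + 1) * pois t k) / t ^ 3" for k
  proof -
    define y where "y = real k - t"
    define A where "A = y ^ 3 - 3 * t * y"
    have Ay: "A = y * (y - q) * (y + q)"
      unfolding A_def using q(2) by (simp add: algebra_simps power3_eq_cube)
    have s1: "\<bar>s k\<bar> = 1" and sA: "s k * A \<ge> 0"
    proof -
      consider "y \<le> - q" | "- q < y" "y \<le> 0" | "0 < y" "y \<le> q" | "q < y" by linarith
      then have "\<bar>s k\<bar> = 1 \<and> s k * A \<ge> 0"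
      proof cases
        case 1
        then have "s k = - 1" using kle[of k] q unfolding s_def y_def by auto
        moreover have "y * (y - q) * (y + q) \<le> 0" using 1 q
          by (intro mult_nonneg_nonpos mult_nonpos_nonpos) auto
        ultimately show ?thesis unfolding Ay by simp
      next
        case 2
        then have "s k = 1" using kle[of k] q unfolding s_def y_def by auto
        moreover have "y * (y - q) * (y + q) \<ge> 0" using 2 q
          by (intro mult_nonneg_nonneg mult_nonpos_nonpos) auto
        ultimately show ?thesis unfolding Ay by simp
      next
        case 3
        then have "s k = - 1" using kle[of k] q unfolding s_def y_def by auto
        moreover have "y * (y - q) * (y + q) \<le> 0" using 3 q
          by (intro mult_nonpos_nonneg mult_nonneg_nonpos) auto
        ultimately show ?thesis unfolding Ay by simp
      next
        case 4
        then have "s k = 1" using kle[of k] q unfolding s_def y_def by auto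
        moreover have "y * (y - q) * (y + q) \<ge> 0" using 4 q
          by (intro mult_nonneg_nonneg) auto
        ultimately show ?thesis unfolding Ay by simp
      qed
      then show "\<bar>s k\<bar> = 1" "s k * A \<ge> 0" by auto
    qed
    define c where "c = pois t k / t ^ 3"
    have c: "0 \<le> c" using t0 by (simp add: c_def pois_nonneg)
    have fk: "f k = c * (A + R k)"
      unfolding f_def coeff1_u3_exp[OF t0] A_def R_def c_def y_def by simp
    \<comment> \<open>If the sign of A is used for A + R k, nothing is lost unless the two differ in
      sign, and then the loss is at most 2 |R k|.\<close>
    have "\<bar>\<bar>A + R k\<bar> - s k * (A + R k)\<bar> \<le> 2 * \<bar>R k\<bar>"
      using s1 sA by (auto simp: abs_if split: if_splits)
    then have "c * \<bar>\<bar>A + R k\<bar> - s k * (A + R k)\<bar> \<le> c * (2 * \<bar>R k\<bar>)"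
      using c by (rule mult_left_mono)
    moreover have "\<bar>\<bar>f k\<bar> - s k * f k\<bar> = c * \<bar>\<bar>A + R k\<bar> - s k * (A + R k)\<bar>"
    proof -
      have "\<bar>f k\<bar> - s k * f k = c * (\<bar>A + R k\<bar> - s k * (A + R k))"
        unfolding fk abs_mult using c by (simp add: algebra_simps)
      then show ?thesis using c by (simp add: abs_mult)
    qed
    ultimately have 1: "\<bar>\<bar>f k\<bar> - s k * f k\<bar> \<le> c * (2 * \<bar>R k\<bar>)" by simp
    have "\<bar>R k\<bar> \<le> 4 * y\<^sup>2 + (2 * t + 1)"
    proof -
      have "2 * \<bar>y\<bar> \<le> y\<^sup>2 + 1" using zero_le_power2[of "\<bar>y\<bar> - 1"] by (simp add: power2_diff)
      then show ?thesis unfolding R_def y_def[symmetric] using t0 zero_le_power2[of y] by linarith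
    qed
    then have "c * (2 * \<bar>R k\<bar>) \<le> c * (2 * (4 * y\<^sup>2 + (2 * t + 1)))" using c by (intro mult_left_mono) auto
    also have "... = 2 * (4 * ((real k - t)\<^sup>2 * pois t k) + (2 * t + 1) * pois t k) / t ^ 3"
      unfolding c_def y_def by (simp add: algebra_simps add_divide_distrib)
    finally show ?thesis using 1 by simp
  qed
  have es: "(\<lambda>k. 2 * (4 * ((real k - t)\<^sup>2 * pois t k) + (2 * t + 1) * pois t k) / t ^ 3) sums
      (2 * (4 * t + (2 * t + 1) * 1) / t ^ 3)"
    by (intro sums_divide sums_mult sums_add pois_variance_sums pois_sums)
  have ds: "(\<lambda>k. \<bar>f k\<bar> - s k * f k) sums (norm (ell1_u ^ 3 * exp (t *\<^sub>R ell1_u)) - (2 * g k1 - 2 * g k2 + 2 * g k3))"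
    unfolding norm_ell1_def f_def[symmetric] by (intro sums_diff sf summable_sums fs)
  have "\<bar>norm (ell1_u ^ 3 * exp (t *\<^sub>R ell1_u)) - (2 * g k1 - 2 * g k2 + 2 * g k3)\<bar> \<le> 2 * (4 * t + (2 * t + 1) * 1) / t ^ 3"
    unfolding sums_unique[OF ds] sums_unique[OF es] real_norm_def[symmetric]
    by (intro norm_suminf_le sums_summable[OF es]) (use err in simp)
  also have "... \<le> 2 * (7 * t) / t ^ 3" using t by (intro divide_right_mono) auto
  also have "... = 14 / t\<^sup>2" using t0 by (simp add: power2_eq_square power3_eq_cube)
  finally show ?thesis by (simp add: k1_def k2_def k3_def)
qed

text \<open>The alternating combination of the three extremal values of the normal second derivative
  is exactly the constant. For 1 <= t < 100 the claim is a crude bound on both terms, with 10000 =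
  100^2 compensating the division by t^2.\<close>

lemma norm_u3_exp_asymp:
  "\<exists>C. \<forall>t\<ge>1. \<bar>norm (ell1_u ^ 3 * exp (t *\<^sub>R ell1_u)) - sqrt (2 / pi) * (1 + 4 * exp (- 3 / 2)) / (t * sqrt t)\<bar> \<le> C / t\<^sup>2"
proof -
  define K where "K = sqrt (2 / pi) * (1 + 4 * exp (- 3 / 2))"
  have K0: "K \<ge> 0" by (simp add: K_def)
  have Keq: "K = 2 * ((3 - 1) * exp (- (3 / 2)) / sqrt (2 * pi)) - 2 * ((0 - 1) * exp (- (0 / 2)) / sqrt (2 * pi))
      + 2 * ((3 - 1) * exp (- (3 / 2)) / sqrt (2 * pi))"
  proof -
    have "sqrt (2 / pi) = 2 / sqrt (2 * pi)"
      using pi_gt_zero by (simp add: real_sqrt_divide real_sqrt_mult field_simps)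
    then show ?thesis unfolding K_def by (simp add: field_simps)
  qed
  obtain C where C: "\<And>t x k. 100 \<le> t \<Longrightarrow> \<bar>x\<bar> \<le> 2 \<Longrightarrow> k = nat \<lfloor>t + x * sqrt t\<rfloor> \<Longrightarrow>
     \<bar>pois t k * (((real k - t)\<^sup>2 - real k) / t\<^sup>2)
       - (x\<^sup>2 - 1) * exp (- (x\<^sup>2 / 2)) / sqrt (2 * pi) / (t * sqrt t)\<bar> \<le> C / t\<^sup>2"
    using second_difference_local by blast
  have big: "\<bar>norm (ell1_u ^ 3 * exp (t *\<^sub>R ell1_u)) - K / (t * sqrt t)\<bar> \<le> (14 + 6 * C) / t\<^sup>2" if t: "100 \<le> t" for t
  proof -
    define g kk where "g = (\<lambda>k. pois t k * (((real k - t)\<^sup>2 - real k) / t\<^sup>2))"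
      and "kk = (\<lambda>x. nat \<lfloor>t + x * sqrt t\<rfloor>)"
    define E where "E = (\<lambda>x. (x\<^sup>2 - 1) * exp (- (x\<^sup>2 / 2)) / sqrt (2 * pi) / (t * sqrt t))"
    have s3: "\<bar>sqrt 3\<bar> \<le> (2::real)" using real_sqrt_le_mono[of 3 4] by auto
    have gE: "\<bar>g (kk x) - E x\<bar> \<le> C / t\<^sup>2" if "\<bar>x\<bar> \<le> 2" for x
      unfolding g_def E_def kk_def by (rule C[OF t that refl])
    have 1: "\<bar>norm (ell1_u ^ 3 * exp (t *\<^sub>R ell1_u)) - (2 * g (kk (- sqrt 3)) - 2 * g (kk 0) + 2 * g (kk (sqrt 3)))\<bar> \<le> 14 / t\<^sup>2"
      unfolding g_def kk_def by (rule norm_u3_exp_decomp[OF t])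
    have 2: "K / (t * sqrt t) = 2 * E (- sqrt 3) - 2 * E 0 + 2 * E (sqrt 3)"
      unfolding Keq E_def by (simp add: diff_divide_distrib add_divide_distrib)
    have "\<bar>norm (ell1_u ^ 3 * exp (t *\<^sub>R ell1_u)) - K / (t * sqrt t)\<bar> \<le> 14 / t\<^sup>2 + 6 * (C / t\<^sup>2)"
    proof -
      have "\<bar>g (kk (- sqrt 3)) - E (- sqrt 3)\<bar> \<le> C / t\<^sup>2" "\<bar>g (kk 0) - E 0\<bar> \<le> C / t\<^sup>2"
        "\<bar>g (kk (sqrt 3)) - E (sqrt 3)\<bar> \<le> C / t\<^sup>2"
        by (rule gE; use s3 in simp)+
      with 1 show ?thesis unfolding 2 by linarith
    qed
    then show ?thesis by (simp add: add_divide_distrib)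
  qed
  define C' where "C' = max (14 + 6 * C) ((norm (ell1_u ^ 3) + K) * 10000)"
  show ?thesis
  proof (intro exI[of _ C'] allI impI)
    fix t :: real assume t1: "1 \<le> t"
    show "\<bar>norm (ell1_u ^ 3 * exp (t *\<^sub>R ell1_u)) - sqrt (2 / pi) * (1 + 4 * exp (- 3 / 2)) / (t * sqrt t)\<bar> \<le> C' / t\<^sup>2"
    proof (cases "100 \<le> t")
      case True
      have "(14 + 6 * C) / t\<^sup>2 \<le> C' / t\<^sup>2" by (intro divide_right_mono) (auto simp: C'_def)
      then show ?thesis using big[OF True] unfolding K_def by linarith
    next
      case False
      have "norm (ell1_u ^ 3 * exp (t *\<^sub>R ell1_u)) \<le> norm (ell1_u ^ 3) * norm (exp (t *\<^sub>R ell1_u))" by (rule norm_mult_ineq)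
      also have "... \<le> norm (ell1_u ^ 3) * 1" using norm_exp_u_le[of t] t1 by (intro mult_left_mono) auto
      finally have a: "norm (ell1_u ^ 3 * exp (t *\<^sub>R ell1_u)) \<le> norm (ell1_u ^ 3)" by simp
      have "1 * 1 \<le> t * sqrt t" using t1 by (intro mult_mono) auto
      then have b: "K / (t * sqrt t) \<le> K / 1" using K0 by (intro divide_left_mono) auto
      have b0: "0 \<le> K / (t * sqrt t)" using K0 t1 by simp
      have "t\<^sup>2 \<le> 100\<^sup>2" using False t1 by (intro power_mono) auto
      then have "(norm (ell1_u ^ 3) + K) * t\<^sup>2 \<le> (norm (ell1_u ^ 3) + K) * 10000" using K0 by (intro mult_left_mono) auto
      then have "norm (ell1_u ^ 3) + K \<le> C' / t\<^sup>2" using t1 by (simp add: C'_def pos_le_divide_eq)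
      moreover have "\<bar>A - B\<bar> \<le> M" if "0 \<le> A" "A \<le> n" "0 \<le> B" "B \<le> K" "n + K \<le> M" for A B n M
        using that K0 by linarith
      ultimately show ?thesis using a b b0 unfolding K_def[symmetric] by simp
    qed
  qed
qed

section \<open>The probability generating functions\<close>

context
  fixes M :: "'a measure" and \<eta> :: "nat \<Rightarrow> 'a \<Rightarrow> int" and p :: real and k1 k2 m :: nat
  assumes iid: "iid_bernoulli M \<eta> p" and m: "m = k1 + k2" "1 \<le> m"
begin

interpretation prob_space M
  using iid by (simp add: iid_bernoulli_def)

abbreviation Nn :: "nat \<Rightarrow> 'a \<Rightarrow> int" where
  "Nn n s \<equiv> N_stat k1 k2 n (\<lambda>i. \<eta> i s)"

lemma eta_measurable: "1 \<le> i \<Longrightarrow> \<eta> i \<in> measurable M (count_space UNIV)"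
  by (rule iid_bernoulli_marginal(1)[OF iid])

text \<open>The quantifier over i stands inside \<open>AE\<close>, so that one null set serves for
  all windows at once.\<close>

lemma eta_zero_one: "AE s in M. \<forall>i\<ge>1. \<eta> i s = 0 \<or> \<eta> i s = 1"
proof -
  have "AE s in M. 1 \<le> i \<longrightarrow> \<eta> i s = 0 \<or> \<eta> i s = 1" for i
  proof (cases "1 \<le> i")
    case True
    let ?A = "\<lambda>k. {s \<in> space M. \<eta> i s = k}"
    have sets: "?A k \<in> sets M" for k
      using measurable_sets[OF eta_measurable[OF True], of "{k}"] by (simp add: vimage_def Int_def conj_commute)
    have "prob (?A 1 \<union> ?A 0) = prob (?A 1) + prob (?A 0)"
      by (intro finite_measure_Union sets) auto
    also have "... = 1" using iid True by (simp add: iid_bernoulli_def)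
    finally have "AE s in M. s \<in> ?A 1 \<union> ?A 0" using prob_eq_1[of "?A 1 \<union> ?A 0"] sets by blast
    then show ?thesis by eventually_elim auto
  qed auto
  then have "AE s in M. \<forall>i. 1 \<le> i \<longrightarrow> \<eta> i s = 0 \<or> \<eta> i s = 1"
    by (simp add: AE_all_countable)
  then show ?thesis by simp
qed

text \<open>A finite product of discrete countable spaces is discrete, so a functional of finitely
  many coordinates is measurable whatever its form.\<close>

lemma measurable_of_finite_block:
  assumes "A \<subseteq> {1..}" "finite A" "\<And>x y. (\<And>i. i \<in> A \<Longrightarrow> x i = y i) \<Longrightarrow> F x = F y"
  shows "(\<lambda>s. F (\<lambda>i. \<eta> i s)) \<in> measurable M (count_space UNIV)"
proof -
  have P: "PiM A (\<lambda>_. count_space UNIV) = (count_space (PiE A (\<lambda>_. UNIV)) :: (nat \<Rightarrow> int) measure)"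
    by (intro count_space_PiM_finite) (use assms in auto)
  have "(\<lambda>s. F (restrict (\<lambda>i. \<eta> i s) A)) \<in> measurable M (count_space UNIV)"
  proof (rule measurable_compose[where g = F])
    show "(\<lambda>s. restrict (\<lambda>i. \<eta> i s) A) \<in> measurable M (PiM A (\<lambda>_. count_space UNIV))"
      by (rule measurable_restrict) (use assms eta_measurable in auto)
    show "F \<in> measurable (PiM A (\<lambda>_. count_space UNIV)) (count_space UNIV)" unfolding P by simp
  qed
  also have "(\<lambda>s. F (restrict (\<lambda>i. \<eta> i s) A)) = (\<lambda>s. F (\<lambda>i. \<eta> i s))"
    by (intro ext assms(3)) simp
  finally show ?thesis .
qed

lemma indep_blocks:
  fixes F G :: "(nat \<Rightarrow> int) \<Rightarrow> int"
  assumes A: "A \<subseteq> {1..}" "finite A" "\<And>x y. (\<And>i. i \<in> A \<Longrightarrow> x i = y i) \<Longrightarrow> F x = F y"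
    and B: "B \<subseteq> {1..}" "finite B" "\<And>x y. (\<And>i. i \<in> B \<Longrightarrow> x i = y i) \<Longrightarrow> G x = G y"
    and AB: "A \<inter> B = {}"
  shows "prob {s \<in> space M. F (\<lambda>i. \<eta> i s) = j \<and> G (\<lambda>i. \<eta> i s) = k} =
    prob {s \<in> space M. F (\<lambda>i. \<eta> i s) = j} * prob {s \<in> space M. G (\<lambda>i. \<eta> i s) = k}"
proof -
  let ?C = "\<lambda>_::nat. count_space (UNIV :: int set)"
  have P: "PiM S ?C = count_space (PiE S (\<lambda>_. UNIV))" if "finite S" for S :: "nat set"
    by (intro count_space_PiM_finite) (use that in auto)
  have "indep_vars ?C \<eta> {1..}" using iid by (simp add: iid_bernoulli_def)
  then have "indep_var (PiM A ?C) (\<lambda>s. restrict (\<lambda>i. \<eta> i s) A) (PiM B ?C) (\<lambda>s. restrict (\<lambda>i. \<eta> i s) B)"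
    using AB A(1) B(1) by (rule indep_var_restrict)
  then have "indep_var (count_space UNIV) (F \<circ> (\<lambda>s. restrict (\<lambda>i. \<eta> i s) A))
      (count_space UNIV) (G \<circ> (\<lambda>s. restrict (\<lambda>i. \<eta> i s) B))"
    by (rule indep_var_compose) (simp_all add: P A B)
  moreover have "F \<circ> (\<lambda>s. restrict (\<lambda>i. \<eta> i s) A) = (\<lambda>s. F (\<lambda>i. \<eta> i s))"
    "G \<circ> (\<lambda>s. restrict (\<lambda>i. \<eta> i s) B) = (\<lambda>s. G (\<lambda>i. \<eta> i s))"
    unfolding comp_def by (intro ext A(3) B(3); simp)+
  ultimately have "indep_var (count_space UNIV) (\<lambda>s. F (\<lambda>i. \<eta> i s)) (count_space UNIV) (\<lambda>s. G (\<lambda>i. \<eta> i s))"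
    by simp
  from indep_varD[OF this, of "{j}" "{k}"] show ?thesis
    by (simp add: vimage_def Int_def conj_commute)
qed

lemma Y_cong: "(\<And>i. i \<in> {j - m + 1..j} \<Longrightarrow> x i = y i) \<Longrightarrow> Y k1 k2 x j = Y k1 k2 y j"
  unfolding Y_def m(1)[symmetric]
  by (intro arg_cong2[where f = "(*)"] prod.cong refl) (use m in auto)

lemma N_stat_cong': "(\<And>i. i \<in> {1..n} \<Longrightarrow> x i = y i) \<Longrightarrow> N_stat k1 k2 n x = N_stat k1 k2 n y"
  using m by (intro N_stat_cong) auto

lemma Y_measurable:
  assumes "m \<le> j"
  shows "(\<lambda>s. Y k1 k2 (\<lambda>i. \<eta> i s) j) \<in> measurable M (count_space UNIV)"
proof (rule measurable_of_finite_block[where A = "{j - m + 1..j}"])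
  show "Y k1 k2 x j = Y k1 k2 y j" if "\<And>i. i \<in> {j - m + 1..j} \<Longrightarrow> x i = y i" for x y
    using that by (rule Y_cong)
qed auto

lemma Nn_measurable: "Nn n \<in> measurable M (count_space UNIV)"
proof (rule measurable_of_finite_block[where A = "{1..n}"])
  show "N_stat k1 k2 n x = N_stat k1 k2 n y" if "\<And>i. i \<in> {1..n} \<Longrightarrow> x i = y i" for x y
    using that by (rule N_stat_cong')
qed auto

lemma Nn_event: "{s \<in> space M. Nn n s = k} \<in> events"
  using measurable_sets[OF Nn_measurable, of "{k}" n] by (simp add: vimage_def Int_def conj_commute)

lemma Y_event: "m \<le> j \<Longrightarrow> {s \<in> space M. Y k1 k2 (\<lambda>i. \<eta> i s) j = k} \<in> events"
  using measurable_sets[OF Y_measurable, of j "{k}"] by (simp add: vimage_def Int_def conj_commute)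

lemma Y_eq_one_iff:
  assumes "m \<le> j" "\<And>i. 1 \<le> i \<Longrightarrow> x i = 0 \<or> x i = (1::int)"
  shows "Y k1 k2 x j = 1 \<longleftrightarrow> (\<forall>i\<in>{j - m + 1..j}. x i = (if i \<le> j - k2 then 0 else 1))"
    and "Y k1 k2 x j = 0 \<or> Y k1 k2 x j = 1"
proof -
  define Q where "Q \<longleftrightarrow> (\<forall>i\<in>{j - m + 1..j}. x i = (if i \<le> j - k2 then 0 else 1))"
  have "Y k1 k2 x j = (if Q then 1 else 0)"
  proof (cases Q)
    case True
    have q: "x i = (if i \<le> j - k2 then 0 else 1)" if "i \<in> {j - m + 1..j}" for i
      using True that unfolding Q_def by (rule bspec)
    have "1 - x i = 1" if i: "i \<in> {j - (k1 + k2) + 1..j - k2}" for i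
    proof -
      have "i \<in> {j - m + 1..j}" "i \<le> j - k2"
        using i unfolding m(1) atLeastAtMost_iff by linarith+
      then show ?thesis using q by simp
    qed
    then have "(\<Prod>i\<in>{j - (k1 + k2) + 1..j - k2}. 1 - x i) = 1"
      by (intro prod.neutral ballI)
    moreover have "x i = 1" if i: "i \<in> {j - k2 + 1..j}" for i
    proof -
      have "i \<in> {j - m + 1..j}" "\<not> i \<le> j - k2"
        using i unfolding m(1) atLeastAtMost_iff by linarith+
      then show ?thesis using q by simp
    qed
    then have "(\<Prod>i\<in>{j - k2 + 1..j}. x i) = 1"
      by (intro prod.neutral ballI)
    ultimately show ?thesis using True by (simp add: Y_def)
  next
    case False
    then obtain i where i: "i \<in> {j - m + 1..j}" "x i \<noteq> (if i \<le> j - k2 then 0 else 1)"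
      unfolding Q_def by blast
    then have i1: "1 \<le> i" by simp
    show ?thesis
    proof (cases "i \<le> j - k2")
      case True
      then have "x i = 1" using assms(2)[OF i1] i(2) by simp
      then have "(\<Prod>i\<in>{j - (k1 + k2) + 1..j - k2}. 1 - x i) = 0"
        using i(1) True m(1) \<open>x i = 1\<close> by (intro prod_zero bexI[of _ i]) auto
      then show ?thesis using False by (simp add: Y_def)
    next
      case nle: False
      then have "x i = 0" using assms(2)[OF i1] i(2) by simp
      then have "(\<Prod>i\<in>{j - k2 + 1..j}. x i) = 0"
        using i(1) nle \<open>x i = 0\<close> by (intro prod_zero bexI[of _ i]) auto
      then show ?thesis using False by (simp add: Y_def)
    qed
  qed
  then show "Y k1 k2 x j = 1 \<longleftrightarrow> (\<forall>i\<in>{j - m + 1..j}. x i = (if i \<le> j - k2 then 0 else 1))"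
    and "Y k1 k2 x j = 0 \<or> Y k1 k2 x j = 1" by (auto simp: Q_def)
qed

lemma prob_Y:
  assumes "m \<le> j"
  shows "prob {s \<in> space M. Y k1 k2 (\<lambda>i. \<eta> i s) j = 1} = a_prob k1 k2 p"
proof -
  let ?I = "{j - m + 1..j}" and ?b = "\<lambda>i. if i \<le> j - k2 then 0 else (1::int)"
  have I: "?I \<noteq> {}" "finite ?I" "?I \<subseteq> {1..}" using assms m by auto
  have "AE s in M. (Y k1 k2 (\<lambda>i. \<eta> i s) j = 1) = (\<forall>i\<in>?I. \<eta> i s = ?b i)"
    using eta_zero_one
  proof eventually_elim
    case (elim s)
    show ?case by (rule Y_eq_one_iff(1)[OF assms]) (use elim in auto)
  qed
  moreover have Ie: "{s \<in> space M. \<forall>i\<in>?I. \<eta> i s = ?b i} = (\<Inter>i\<in>?I. \<eta> i -` {?b i} \<inter> space M)"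
    using I by auto
  have ev: "\<eta> i -` {?b i} \<inter> space M \<in> events" if "i \<in> ?I" for i
    using measurable_sets[OF eta_measurable, of i] that by auto
  ultimately have "prob {s \<in> space M. Y k1 k2 (\<lambda>i. \<eta> i s) j = 1} = prob {s \<in> space M. \<forall>i\<in>?I. \<eta> i s = ?b i}"
    using Y_event[OF assms, of 1] I unfolding Ie
    by (intro finite_measure_eq_AE sets.finite_INT) auto
  also have "... = (\<Prod>i\<in>?I. prob (\<eta> i -` {?b i} \<inter> space M))"
    unfolding Ie
    by (rule indep_varsD[where X = \<eta> and I = "{1..}" and M' = "\<lambda>_. count_space UNIV"]) (use I iid in \<open>auto simp: iid_bernoulli_def\<close>)
  also have "... = (\<Prod>i\<in>?I. if i \<le> j - k2 then 1 - p else p)"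
  proof (intro prod.cong refl)
    fix i assume i: "i \<in> ?I"
    have "\<eta> i -` {?b i} \<inter> space M = {s \<in> space M. \<eta> i s = ?b i}" by auto
    then show "prob (\<eta> i -` {?b i} \<inter> space M) = (if i \<le> j - k2 then 1 - p else p)"
      using iid i by (simp add: iid_bernoulli_def)
  qed
  also have "?I = {j - m + 1..j - k2} \<union> {j - k2 + 1..j}" using m assms by auto
  also have "(\<Prod>i\<in>.... if i \<le> j - k2 then 1 - p else p) =
      (\<Prod>i\<in>{j - m + 1..j - k2}. 1 - p) * (\<Prod>i\<in>{j - k2 + 1..j}. p)"
    by (subst prod.union_disjoint) auto
  also have "... = a_prob k1 k2 p" using m assms by (simp add: a_prob_def)
  finally show ?thesis .
qed

text \<open>The pattern 0...01...1 cannot overlap itself. If windows ending at j < n with j > n - m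
  both showed it, then either j <= n - k2, and the last success of the earlier window falls among
  the failures of the later one, or j > n - k2, and the last failure of the later window falls among
  the successes of the earlier one.\<close>

lemma N_stat_rec:
  assumes n: "m \<le> n" and x: "\<And>i. 1 \<le> i \<Longrightarrow> x i = 0 \<or> x i = (1::int)" and k: "1 \<le> k1" "1 \<le> k2"
  shows "N_stat k1 k2 n x = N_stat k1 k2 (n - 1) x + Y k1 k2 x n"
    and "Y k1 k2 x n = 1 \<Longrightarrow> N_stat k1 k2 (n - 1) x = N_stat k1 k2 (n - m) x"
proof -
  have "{m..n} = insert n {m..n - 1}" using n m by auto
  then show "N_stat k1 k2 n x = N_stat k1 k2 (n - 1) x + Y k1 k2 x n"
    unfolding N_stat_def m(1)[symmetric] using m n by simp
  assume Yn: "Y k1 k2 x n = 1"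
  have "Y k1 k2 x j = 0" if j: "j \<in> {m..n - 1}" "j \<notin> {m..n - m}" for j
  proof (rule ccontr)
    assume "Y k1 k2 x j \<noteq> 0"
    then have "Y k1 k2 x j = 1" using Y_eq_one_iff(2)[of j x] x j by auto
    then have Xj: "\<And>i. i \<in> {j - m + 1..j} \<Longrightarrow> x i = (if i \<le> j - k2 then 0 else 1)"
      using Y_eq_one_iff(1)[of j x] x j by auto
    have Xn: "\<And>i. i \<in> {n - m + 1..n} \<Longrightarrow> x i = (if i \<le> n - k2 then 0 else 1)"
      using Y_eq_one_iff(1)[OF n x] Yn by auto
    show False
    proof (cases "j \<le> n - k2")
      case True
      have "x j = 1" using Xj[of j] j m k by auto
      moreover have "x j = 0" using Xn[of j] True j m by auto
      ultimately show False by simp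
    next
      case False
      define i' where "i' = n - k2"
      have "x i' = 0" using Xn[of i'] n m k unfolding i'_def by auto
      moreover have "x i' = 1" using Xj[of i'] False j m k n unfolding i'_def by auto
      ultimately show False by simp
    qed
  qed
  then show "N_stat k1 k2 (n - 1) x = N_stat k1 k2 (n - m) x"
    unfolding N_stat_def m(1)[symmetric] using m by (intro sum.mono_neutral_right) auto
qed

text \<open>Split by Y_n. On Y_n = 1 the count is 1 plus the count up to n - m, which depends on a
  disjoint block and is independent of Y_n. On Y_n = 0 it is the count up to n - 1, and the excluded
  part is again rewritten through n - m.\<close>

lemma prob_Nn_rec:
  assumes n: "m \<le> n" and k: "1 \<le> k1" "1 \<le> k2"
  shows "prob {s \<in> space M. Nn n s = i} = prob {s \<in> space M. Nn (n - 1) s = i}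
    + a_prob k1 k2 p * (prob {s \<in> space M. Nn (n - m) s = i - 1} - prob {s \<in> space M. Nn (n - m) s = i})"
proof -
  define Yn where "Yn s = Y k1 k2 (\<lambda>i. \<eta> i s) n" for s
  let ?A = "\<lambda>i. {s \<in> space M. Nn (n - 1) s = i}" and ?B = "\<lambda>i. {s \<in> space M. Nn (n - m) s = i}"
    and ?Y1 = "{s \<in> space M. Yn s = 1}"
  have Yev: "?Y1 \<in> events" using Y_event[OF n] by (simp add: Yn_def)
  have ev [measurable]: "?A i \<in> events" "?B i \<in> events" "{s \<in> space M. Nn n s = i} \<in> events" for i
    using Nn_event by auto
  have good: "AE s in M. (Yn s = 0 \<or> Yn s = 1) \<and> Nn n s = Nn (n - 1) s + Yn s \<and>
      (Yn s = 1 \<longrightarrow> Nn (n - 1) s = Nn (n - m) s)"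
    using eta_zero_one
  proof eventually_elim
    case (elim s)
    then have x: "\<And>i. 1 \<le> i \<Longrightarrow> \<eta> i s = 0 \<or> \<eta> i s = 1" by blast
    show ?case unfolding Yn_def
      using N_stat_rec[where x = "\<lambda>i. \<eta> i s", OF n x k] Y_eq_one_iff(2)[where x = "\<lambda>i. \<eta> i s", OF n x] by blast
  qed
  have ind: "prob (?B i \<inter> ?Y1) = prob (?B i) * a_prob k1 k2 p" for i
  proof -
    have "prob {s \<in> space M. N_stat k1 k2 (n - m) (\<lambda>i. \<eta> i s) = i \<and> Y k1 k2 (\<lambda>i. \<eta> i s) n = 1} =
        prob {s \<in> space M. N_stat k1 k2 (n - m) (\<lambda>i. \<eta> i s) = i} * prob {s \<in> space M. Y k1 k2 (\<lambda>i. \<eta> i s) n = 1}"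
    proof (rule indep_blocks[where A = "{1..n - m}" and B = "{n - m + 1..n}" and F = "\<lambda>x. N_stat k1 k2 (n - m) x"
            and G = "\<lambda>x. Y k1 k2 x n"])
      show "N_stat k1 k2 (n - m) x = N_stat k1 k2 (n - m) y" if "\<And>i. i \<in> {1..n - m} \<Longrightarrow> x i = y i" for x y
        using that by (rule N_stat_cong')
      show "Y k1 k2 x n = Y k1 k2 y n" if "\<And>i. i \<in> {n - m + 1..n} \<Longrightarrow> x i = y i" for x y
        using that by (rule Y_cong)
    qed auto
    moreover have "?B i \<inter> ?Y1 = {s \<in> space M. N_stat k1 k2 (n - m) (\<lambda>i. \<eta> i s) = i \<and> Y k1 k2 (\<lambda>i. \<eta> i s) n = 1}"
      by (auto simp: Yn_def)
    ultimately show ?thesis using prob_Y[OF n] by simp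
  qed
  have "prob {s \<in> space M. Nn n s = i} = prob ((?A i - ?Y1) \<union> (?B (i - 1) \<inter> ?Y1))"
  proof (rule finite_measure_eq_AE)
    show "AE s in M. (s \<in> {s \<in> space M. Nn n s = i}) = (s \<in> (?A i - ?Y1) \<union> (?B (i - 1) \<inter> ?Y1))"
      using good by eventually_elim auto
  qed (use Yev ev in auto)
  also have "... = prob (?A i - ?Y1) + prob (?B (i - 1) \<inter> ?Y1)"
    by (intro finite_measure_Union) (use Yev ev in auto)
  also have "prob (?A i - ?Y1) = prob (?A i) - prob (?A i \<inter> ?Y1)"
    using finite_measure_Diff'[of "?A i" ?Y1] Yev ev by simp
  also have "prob (?A i \<inter> ?Y1) = prob (?B i \<inter> ?Y1)"
  proof (rule finite_measure_eq_AE)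
    show "AE s in M. (s \<in> ?A i \<inter> ?Y1) = (s \<in> ?B i \<inter> ?Y1)"
      using good by eventually_elim auto
  qed (use Yev ev in auto)
  finally show ?thesis unfolding ind by (simp add: algebra_simps)
qed

lemma prob_Nn_coeff:
  fixes G :: "nat \<Rightarrow> ell1"
  assumes k: "1 \<le> k1" "1 \<le> k2"
    and init: "\<And>j. j < m \<Longrightarrow> G j = 1"
    and rec: "\<And>n. m \<le> n \<Longrightarrow> G n = G (n - 1) + (a_prob k1 k2 p *\<^sub>R ell1_u) * G (n - m)"
  shows "prob {s \<in> space M. Nn n s = i} = (if i < 0 then 0 else coeff1 (G n) (nat i))"
proof (induction n arbitrary: i rule: less_induct)
  case (less n)
  show ?case
  proof (cases "n < m")
    case True
    then have "Nn n s = 0" for s using m by (simp add: N_stat_def)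
    then show ?thesis using True by (auto simp: init prob_space)
  next
    case False
    then have n: "m \<le> n" and l: "n - 1 < n" "n - m < n" using m by auto
    \<comment> \<open>At i = 0 both sides truncate to 0; the zero contribution of index - 1 is
      supplied by the case distinction in \<open>coeff1_u_mult\<close>.\<close>
    have "nat (i - 1) = nat i - 1" by simp
    then show ?thesis
      unfolding prob_Nn_rec[OF n k] rec[OF n] less[OF l(1)] less[OF l(2)]
      by (auto simp: coeff1_u_mult mult_scaleR_left)
  qed
qed

end

section \<open>Identification of laws on the integers with elements of \<open>ell1\<close>\<close>

lemma tv_norm_eq_norm:
  assumes "\<And>k. k < 0 \<Longrightarrow> \<mu> k = 0" "\<And>n. \<mu> (int n) = coeff1 f n"
  shows "tv_norm \<mu> = norm f"
proof -
  have "tv_norm \<mu> = (\<Sum>\<^sub>\<infinity>k\<in>range int. \<bar>\<mu> k\<bar>)"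
    unfolding tv_norm_def
  proof (rule infsum_cong_neutral)
    fix k :: int assume "k \<in> UNIV - range int"
    then have "k < 0" by (metis DiffD2 int_nat_eq not_less range_eqI nat_0_le)
    then show "\<bar>\<mu> k\<bar> = 0" using assms by simp
  qed auto
  also have "... = (\<Sum>\<^sub>\<infinity>n. \<bar>\<mu> (int n)\<bar>)"
    by (subst infsum_reindex) (auto simp: o_def)
  also have "... = (\<Sum>\<^sub>\<infinity>n. \<bar>coeff1 f n\<bar>)" by (simp add: assms)
  also have "... = norm f"
  proof (rule infsumI)
    have "summable (\<lambda>n. norm \<bar>coeff1 f n\<bar>)" using coeff1_summable[of f] by simp
    then have "((\<lambda>n. \<bar>coeff1 f n\<bar>) has_sum (\<Sum>n. \<bar>coeff1 f n\<bar>)) UNIV"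
      by (intro norm_summable_imp_has_sum summable_sums coeff1_summable)
    then show "((\<lambda>n. \<bar>coeff1 f n\<bar>) has_sum norm f) UNIV" by (simp add: norm_ell1_def)
  qed
  finally show ?thesis .
qed

lemma coeff1_binomial:
  assumes "0 \<le> q" "q \<le> 1"
  shows "coeff1 ((1 + q *\<^sub>R ell1_u) ^ N) k = pmf (binomial_pmf N q) k"
proof -
  have "1 + q *\<^sub>R ell1_u = q *\<^sub>R ell1_X + (1 - q) *\<^sub>R 1" by (simp add: ell1_u_def algebra_simps)
  then have "(1 + q *\<^sub>R ell1_u) ^ N = (\<Sum>i\<le>N. of_nat (N choose i) * (q *\<^sub>R ell1_X) ^ i * ((1 - q) *\<^sub>R 1) ^ (N - i))"
    by (simp add: binomial_ring)
  also have "... = (\<Sum>i\<le>N. (real (N choose i) * q ^ i * (1 - q) ^ (N - i)) *\<^sub>R ell1_X ^ i)"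
  proof (rule sum.cong)
    fix i
    show "of_nat (N choose i) * (q *\<^sub>R ell1_X) ^ i * ((1 - q) *\<^sub>R 1) ^ (N - i) =
        (real (N choose i) * q ^ i * (1 - q) ^ (N - i)) *\<^sub>R ell1_X ^ i"
      by (simp add: scaleR_conv_of_real power_mult_distrib)
  qed simp
  also have "coeff1 ... k = (\<Sum>i\<le>N. coeff1 ((real (N choose i) * q ^ i * (1 - q) ^ (N - i)) *\<^sub>R ell1_X ^ i) k)"
    by (rule linear_sum[OF bounded_linear.linear[OF bounded_linear_coeff1]])
  also have "... = (\<Sum>i\<le>N. if k = i then real (N choose i) * q ^ i * (1 - q) ^ (N - i) else 0)"
    by (intro sum.cong) auto
  also have "... = real (N choose k) * q ^ k * (1 - q) ^ (N - k)"
    by (subst sum.delta') (auto simp: binomial_eq_0)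
  also have "... = pmf (binomial_pmf N q) k"
    using assms by (simp add: pmf_binomial)
  finally show ?thesis .
qed

lemma measure_Bi:
  assumes "0 \<le> q" "q \<le> 1"
  shows "measure (Bi N q) {k} = (if k < 0 then 0 else coeff1 ((1 + q *\<^sub>R ell1_u) ^ N) (nat k))"
proof (cases "k < 0")
  case True
  then have "int -` {k} = {}" by auto
  then show ?thesis using True by (simp add: Bi_def measure_map_pmf)
next
  case False
  then have "pmf (map_pmf int (binomial_pmf N q)) k = pmf (binomial_pmf N q) (nat k)"
    using pmf_map_inj'[of int "binomial_pmf N q" "nat k"] by simp
  then show ?thesis using False assms by (simp add: Bi_def coeff1_binomial measure_pmf_single)
qed

text \<open>The alternative m = 0 ensures termination. The equation is taken out of the simpset
  because it would unfold forever.\<close>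

fun pgf :: "nat \<Rightarrow> real \<Rightarrow> nat \<Rightarrow> ell1" where
  "pgf m a n = (if n < m \<or> m = 0 then 1 else pgf m a (n - 1) + (a *\<^sub>R ell1_u) * pgf m a (n - m))"

declare pgf.simps [simp del]

lemma pgf_init: "n < m \<Longrightarrow> pgf m a n = 1"
  by (subst pgf.simps) simp

lemma pgf_rec: "1 \<le> m \<Longrightarrow> m \<le> n \<Longrightarrow> pgf m a n = pgf m a (n - 1) + (a *\<^sub>R ell1_u) * pgf m a (n - m)"
  by (subst pgf.simps) simp

lemma tv_norm_H_Bi:
  assumes "iid_bernoulli M \<eta> p" "1 \<le> k1" "1 \<le> k2" "0 \<le> q" "q \<le> 1"
  shows "tv_norm (\<lambda>k. measure (H M \<eta> k1 k2 n) {k} - measure (Bi N q) {k}) =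
    norm (pgf (k1 + k2) (a_prob k1 k2 p) n - (1 + q *\<^sub>R ell1_u) ^ N)"
proof (rule tv_norm_eq_norm)
  have H: "measure (H M \<eta> k1 k2 n) {k} =
      (if k < 0 then 0 else coeff1 (pgf (k1 + k2) (a_prob k1 k2 p) n) (nat k))" for k
  proof -
    have "measure (H M \<eta> k1 k2 n) {k} = measure M {s \<in> space M. N_stat k1 k2 n (\<lambda>i. \<eta> i s) = k}"
      unfolding H_def using Nn_measurable[OF assms(1), of "k1 + k2" k1 k2 n] assms
      by (subst measure_distr) (auto intro!: arg_cong[where f = "measure M"])
    also have "... = (if k < 0 then 0 else coeff1 (pgf (k1 + k2) (a_prob k1 k2 p) n) (nat k))"
      by (rule prob_Nn_coeff[OF assms(1), where m = "k1 + k2"]) (use assms in \<open>simp_all add: pgf_init pgf_rec\<close>)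
    finally show ?thesis .
  qed
  show "measure (H M \<eta> k1 k2 n) {k} - measure (Bi N q) {k} = 0" if "k < 0" for k
    using that by (simp add: H measure_Bi assms)
  show "measure (H M \<eta> k1 k2 n) {int i} - measure (Bi N q) {int i} =
      coeff1 (pgf (k1 + k2) (a_prob k1 k2 p) n - (1 + q *\<^sub>R ell1_u) ^ N) i" for i
    by (simp add: H measure_Bi assms)
qed

section \<open>The main expansion\<close>

interpretation ell1: smoothing ell1_u
  by standard (rule norm_exp_u_le norm_u_exp_u_le; assumption)+

text \<open>Powers up to 6 occur in the expansion, so 4 s <= 24 < 25 allows one constant for all of
  them: 171875 = 11 * 5^6.\<close>

lemma majorized_norm_bound:
  assumes "majorized ell1_u T Z" "0 \<le> T" "T \<le> lam / 8" "0 < lam" "s \<le> 6"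
  shows "norm (ell1_u ^ s * exp (lam *\<^sub>R ell1_u) * Z) \<le> 171875 * (1 / sqrt lam) ^ s"
proof -
  have "sqrt (4 * real s / lam) \<le> sqrt (25 / lam)"
    using assms by (intro real_sqrt_le_mono divide_right_mono) auto
  also have "... = 5 * (1 / sqrt lam)"
    using real_sqrt_mult[of 25 "1 / lam"] by (simp add: real_sqrt_divide)
  finally have "sqrt (4 * real s / lam) ^ s \<le> (5 * (1 / sqrt lam)) ^ s"
    using assms by (intro power_mono) auto
  also have "... \<le> 5 ^ 6 * (1 / sqrt lam) ^ s"
    unfolding power_mult_distrib using assms by (intro mult_right_mono power_increasing) auto
  finally have "11 * sqrt (4 * real s / lam) ^ s \<le> 11 * (5 ^ 6 * (1 / sqrt lam) ^ s)" by simp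
  then show ?thesis using ell1.majorized_smoothing[OF assms(1-4), of s] by simp
qed

lemma exp_add_comm: "exp (x + y) = exp x * exp (y :: 'a::comm_banach_algebra)"
  by (rule exp_add_commuting) (rule mult.commute)

text \<open>Brings the exponentially small error of the dominant root below a constant over n^2, the
  form in which it can be compared with a / L.\<close>

lemma geometric_times_square_bounded:
  fixes \<theta> :: real
  assumes "0 < \<theta>" "\<theta> < 1"
  shows "\<exists>K. 0 \<le> K \<and> (\<forall>n. \<theta> ^ n * (real n)\<^sup>2 \<le> K)"
proof -
  have "(\<lambda>n. real n * sqrt \<theta> ^ n) \<longlonglongrightarrow> 0"
    by (rule powser_times_n_limit_0) (use assms in auto)
  then have "Bseq (\<lambda>n. real n * sqrt \<theta> ^ n)" by (intro convergent_imp_Bseq convergentI)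
  then obtain K where K: "\<And>n. norm (real n * sqrt \<theta> ^ n) \<le> K" by (auto simp: Bseq_def)
  have "\<theta> ^ n * (real n)\<^sup>2 \<le> K\<^sup>2" for n
  proof -
    have "\<theta> ^ n * (real n)\<^sup>2 = (real n * sqrt \<theta> ^ n)\<^sup>2"
      using assms by (simp add: power_mult_distrib power2_eq_square flip: real_sqrt_power)
    also have "... \<le> K\<^sup>2" using K[of n] assms by (intro power_mono) auto
    finally show ?thesis .
  qed
  then show ?thesis by (intro exI[of _ "K\<^sup>2"]) auto
qed

lemma norm_u_le: "norm ell1_u \<le> 2"
proof -
  have "norm ell1_X \<le> 1"
    unfolding norm_ell1_def using coeff1_X_power[of 1] by (subst suminf_finite[of "{1}"]) auto
  then show ?thesis unfolding ell1_u_def using norm_triangle_ineq4[of ell1_X 1] by simp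
qed

text \<open>Here e stands for exp (lam u), e exp (u^2 zQ) for the binomial law and u^2 D for the
  difference of the logarithms. The first term replaces the binomial law by e in the leading term,
  the next four are the rest of the part linear in u^2 D, and the last three its quadratic
  remainder. Each term retains a power of u next to e, ready for smoothing.\<close>

lemma third_order_expansion:
  fixes u e zQ D F b' t :: "'a::comm_banach_algebra"
  assumes D: "u\<^sup>2 * D = d *\<^sub>R u\<^sup>2 + u ^ 3 * F"
    and F: "F = (c + g) *\<^sub>R 1 + h *\<^sub>R b' + u * t"
  shows "e * exp (u\<^sup>2 * (zQ + D)) - e * exp (u\<^sup>2 * zQ) - c *\<^sub>R (u ^ 3 * e) =
    c *\<^sub>R (u ^ 5 * e * expt 1 (u\<^sup>2 * zQ) * zQ) + d *\<^sub>R (u ^ 2 * e * exp (u\<^sup>2 * zQ))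
    + g *\<^sub>R (u ^ 3 * e * exp (u\<^sup>2 * zQ)) + h *\<^sub>R (u ^ 3 * e * exp (u\<^sup>2 * zQ) * b')
    + u ^ 4 * e * exp (u\<^sup>2 * zQ) * t
    + (d\<^sup>2 *\<^sub>R (u ^ 4 * e * (exp (u\<^sup>2 * zQ) * expt 2 (u\<^sup>2 * D)))
       + (2 * d) *\<^sub>R (u ^ 5 * e * (exp (u\<^sup>2 * zQ) * expt 2 (u\<^sup>2 * D)) * F)
       + u ^ 6 * e * (exp (u\<^sup>2 * zQ) * expt 2 (u\<^sup>2 * D)) * F\<^sup>2)"
proof -
  define Z1 where "Z1 = exp (u\<^sup>2 * zQ)"
  define E where "E = expt 2 (u\<^sup>2 * D)"
  have "exp (u\<^sup>2 * (zQ + D)) = Z1 * exp (u\<^sup>2 * D)"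
    unfolding Z1_def distrib_left by (rule exp_add_comm)
  also have "exp (u\<^sup>2 * D) = 1 + u\<^sup>2 * D + (u\<^sup>2 * D) * (u\<^sup>2 * D) * E"
    unfolding E_def by (rule exp_eq_expt2)
  finally have 1: "e * exp (u\<^sup>2 * (zQ + D)) - e * Z1 - c *\<^sub>R (u ^ 3 * e)
      = e * Z1 * (u\<^sup>2 * D) + e * Z1 * ((u\<^sup>2 * D) * (u\<^sup>2 * D) * E) - c *\<^sub>R (u ^ 3 * e)"
    by (simp add: distrib_left mult.assoc)
  have sq: "(u\<^sup>2 * D) * (u\<^sup>2 * D) = d\<^sup>2 *\<^sub>R u ^ 4 + (2 * d) *\<^sub>R (u ^ 5 * F) + u ^ 6 * F\<^sup>2"
  proof -
    have p: "u\<^sup>2 * u\<^sup>2 = u ^ 4" "u\<^sup>2 * u ^ 3 = u ^ 5" "u ^ 3 * u\<^sup>2 = u ^ 5" "u ^ 3 * u ^ 3 = u ^ 6"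
      by (simp_all flip: power_add)
    have "(u\<^sup>2 * D) * (u\<^sup>2 * D) = (d * d) *\<^sub>R (u\<^sup>2 * u\<^sup>2) + d *\<^sub>R (u\<^sup>2 * u ^ 3 * F)
        + d *\<^sub>R (u ^ 3 * u\<^sup>2 * F) + (u ^ 3 * u ^ 3) * (F * F)"
      unfolding D by (simp add: distrib_left distrib_right mult_ac scaleR_add_right)
    then show ?thesis unfolding p by (simp only: mult_2 scaleR_add_left power2_eq_square add_ac)
  qed
  have lin: "e * Z1 * (u\<^sup>2 * D) = d *\<^sub>R (u ^ 2 * e * Z1) + c *\<^sub>R (u ^ 3 * e * Z1)
      + g *\<^sub>R (u ^ 3 * e * Z1) + h *\<^sub>R (u ^ 3 * e * Z1 * b') + u ^ 4 * e * Z1 * t"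
  proof -
    have p: "u ^ 3 * u = u ^ 4" by (simp add: power_Suc2[symmetric])
    have "e * Z1 * (u\<^sup>2 * D) = d *\<^sub>R (u ^ 2 * e * Z1) + c *\<^sub>R (u ^ 3 * e * Z1)
      + g *\<^sub>R (u ^ 3 * e * Z1) + h *\<^sub>R (u ^ 3 * e * Z1 * b') + (u ^ 3 * u) * e * Z1 * t"
      unfolding D F by (simp add: distrib_left scaleR_add_left mult_ac)
    then show ?thesis unfolding p .
  qed
  have z1: "c *\<^sub>R (u ^ 3 * e * Z1) - c *\<^sub>R (u ^ 3 * e) = c *\<^sub>R (u ^ 5 * e * expt 1 (u\<^sup>2 * zQ) * zQ)"
  proof -
    have p: "u ^ 3 * u\<^sup>2 = u ^ 5" by (simp flip: power_add)
    have "u ^ 3 * e * Z1 - u ^ 3 * e = (u ^ 3 * u\<^sup>2) * e * expt 1 (u\<^sup>2 * zQ) * zQ"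
      unfolding Z1_def exp_eq_expt1[of "u\<^sup>2 * zQ"] by (simp add: distrib_left mult_ac)
    then show ?thesis unfolding p scaleR_diff_right[symmetric] by simp
  qed
  have qd: "e * Z1 * ((u\<^sup>2 * D) * (u\<^sup>2 * D) * E) = d\<^sup>2 *\<^sub>R (u ^ 4 * e * (Z1 * E))
       + (2 * d) *\<^sub>R (u ^ 5 * e * (Z1 * E) * F) + u ^ 6 * e * (Z1 * E) * F\<^sup>2"
    unfolding sq by (simp add: distrib_left distrib_right mult_ac)
  show ?thesis
    unfolding Z1_def[symmetric] E_def[symmetric] 1 lin qd z1[symmetric] by simp
qed

text \<open>v = lam^(-1/2) is what one factor u is worth after smoothing. The left-hand sides are
  the sizes of the error terms of \<open>third_order_expansion\<close>, reduced to the two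
  quantities a / L and a^(5/2) / sqrt L; relative to a^(3/2) / sqrt L these are v and a.\<close>

lemma scale_facts:
  fixes L a v :: real
  assumes L: "1 \<le> L" and a: "0 < a" "a \<le> 1" and lam: "1 \<le> L * a" and v: "v = 1 / sqrt (L * a)"
  shows "0 < v" "v \<le> 1" "a\<^sup>2 * v\<^sup>2 = a / L" "a ^ 3 * v ^ 3 \<le> a / L" "L * a ^ 4 * v ^ 4 \<le> a / L" "a ^ 4 * v ^ 4 \<le> a / L"
    "L * a ^ 5 * v ^ 5 \<le> a / L" "L\<^sup>2 * a ^ 6 * v ^ 6 \<le> a / L"
    "L * a ^ 3 * (L * a * a) * v ^ 5 = a * (a * sqrt a / sqrt L)"
    "a / L = a * sqrt a / sqrt L * v"
proof -
  have s: "1 \<le> sqrt (L * a)" using lam by simp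
  show v0: "0 < v" unfolding v using s by simp
  have "1 / sqrt (L * a) \<le> 1 / 1" using s by (intro divide_left_mono) auto
  then show v1: "v \<le> 1" unfolding v by simp
  have v2: "v\<^sup>2 = 1 / (L * a)" unfolding v using lam by (simp add: power_divide)
  show X: "a\<^sup>2 * v\<^sup>2 = a / L" unfolding v2 using a by (simp add: power2_eq_square)
  have X0: "0 \<le> a / L" using a L by simp
  have LA: "L * a * v\<^sup>2 = 1" unfolding v2 using L a by simp
  have le: "a / L * z \<le> a / L" if "z \<le> 1" for z using mult_left_mono[OF that X0] by simp
  have av: "a * v \<le> 1" using mult_mono[of a 1 v 1] a v0 v1 by simp
  have "a ^ 3 * v ^ 3 = a\<^sup>2 * v\<^sup>2 * (a * v)" by (simp add: power2_eq_square power3_eq_cube)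
  then show "a ^ 3 * v ^ 3 \<le> a / L" unfolding X using le[OF av] by simp
  have "L * a ^ 4 * v ^ 4 = a\<^sup>2 * v\<^sup>2 * (L * a * v\<^sup>2 * a)" by (simp add: power2_eq_square power4_eq_xxxx)
  then have X4: "L * a ^ 4 * v ^ 4 = a / L * a" unfolding X LA by simp
  then show "L * a ^ 4 * v ^ 4 \<le> a / L" using le a by simp
  have av2: "(a * v)\<^sup>2 \<le> 1" using av a v0 by (intro power_le_one) auto
  have "a ^ 4 * v ^ 4 = a\<^sup>2 * v\<^sup>2 * (a * v)\<^sup>2" by (simp add: power2_eq_square power4_eq_xxxx)
  then show "a ^ 4 * v ^ 4 \<le> a / L" unfolding X using le[OF av2] by simp
  have "L * a ^ 5 * v ^ 5 = L * a ^ 4 * v ^ 4 * (a * v)" by (simp add: eval_nat_numeral)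
  also have "... = a / L * (a * (a * v))" unfolding X4 by simp
  also have "... \<le> a / L" using mult_mono[of a 1 "a * v" 1] a av v0 by (intro le) auto
  finally show "L * a ^ 5 * v ^ 5 \<le> a / L" .
  have "L\<^sup>2 * a ^ 6 * v ^ 6 = a\<^sup>2 * v\<^sup>2 * ((L * a * v\<^sup>2) * (L * a * v\<^sup>2) * (a * a))"
    by (simp add: eval_nat_numeral)
  also have "... = a / L * (a * a)" unfolding X LA by simp
  also have "... \<le> a / L" using mult_mono[of a 1 a 1] a by (intro le) auto
  finally show "L\<^sup>2 * a ^ 6 * v ^ 6 \<le> a / L" .
  have "L * a ^ 3 * (L * a * a) * v ^ 5 = (L * a * v\<^sup>2) * (L * a * v\<^sup>2) * (a * a * a * v)"
    by (simp add: eval_nat_numeral)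
  also have "... = a * a * (a * v)" unfolding LA by simp
  also have avs: "a * v = sqrt a / sqrt L"
  proof -
    have "a = sqrt a * sqrt a" using a by simp
    then have "a * v = (sqrt a * sqrt a) / (sqrt L * sqrt a)" by (simp add: v real_sqrt_mult)
    also have "... = sqrt a / sqrt L" by (rule mult_divide_mult_cancel_right) (use a in simp)
    finally show ?thesis .
  qed
  finally show "L * a ^ 3 * (L * a * a) * v ^ 5 = a * (a * sqrt a / sqrt L)" by simp
  have "a * sqrt a / sqrt L * v = a * (sqrt a / sqrt L) * v" by simp
  also have "... = a\<^sup>2 * v\<^sup>2" unfolding avs[symmetric] by (simp add: power2_eq_square)
  finally show "a / L = a * sqrt a / sqrt L * v" using X by simp
qed

lemma scaleR_powers:
  fixes u :: "'a::real_normed_algebra_1"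
  assumes "w = a *\<^sub>R u"
  shows "w\<^sup>2 = a\<^sup>2 *\<^sub>R u\<^sup>2" "w ^ 3 = a ^ 3 *\<^sub>R u ^ 3" "w ^ 4 = a ^ 4 *\<^sub>R u ^ 4"
  unfolding assms by (simp_all add: scaleR_power)

text \<open>Two comparisons through P = exp (L l + (m l - l')): the generating function is
  exponentially close to P, and P differs from the binomial law by the u^3 term and smoothed
  errors.\<close>

lemma pgf_binomial_expansion:
  fixes m :: nat
  assumes m: "2 \<le> m"
  shows "\<exists>C. \<forall>n a L lam N q. m \<le> n \<longrightarrow> L = real n - real m + 1 \<longrightarrow> lam = L * a \<longrightarrow> 1 \<le> lam \<longrightarrow> real m * a \<le> 1 / 100 \<longrightarrow>
    N = nat \<lfloor>N_tilde m n\<rfloor> \<longrightarrow> q = lam / real N \<longrightarrow>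
    norm (pgf m a n - (1 + q *\<^sub>R ell1_u) ^ N - (L * a ^ 3 * (real m * (real m - 1) / 6)) *\<^sub>R (ell1_u ^ 3 * exp (lam *\<^sub>R ell1_u)))
      \<le> C * (a / L + a * (a * sqrt a / sqrt L))"
proof -
  define M where "M = real m"
  have M2: "2 \<le> M" using m by (simp add: M_def)
  obtain C1 where C1: "\<And>w::ell1. norm w * M \<le> 1 / 20 \<Longrightarrow> \<exists>l r s. exp ((M - 1) *\<^sub>R l) * (exp l - 1) = w \<and> norm l \<le> 6 / 5 * norm w \<and>
     l = w + w\<^sup>2 * r \<and> norm r \<le> 2 * M \<and>
     l = w - (M - 1/2) *\<^sub>R w\<^sup>2 + (1/3 + 3/2 * (M - 1) * M) *\<^sub>R w ^ 3 + w ^ 4 * s \<and> norm s \<le> C1"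
  proof -
    have e: "1/2 + (M - 1) = M - 1/2" "M - 1 + 1 = M" by auto
    show thesis
      using root_expansion[of "M - 1", where 'a = ell1] M2 that unfolding e by auto
  qed
  obtain C0 where C0: "\<And>w::ell1. norm w \<le> 1 / 20 \<Longrightarrow> \<exists>l r s. exp l = 1 + w \<and>
     l = w + w\<^sup>2 * r \<and> norm r \<le> 2 \<and>
     l = w - (1/2) *\<^sub>R w\<^sup>2 + (1/3) *\<^sub>R w ^ 3 + w ^ 4 * s \<and> norm s \<le> C0"
    using log_one_plus_expansion[where 'a = ell1] by blast
  obtain C2 where C2: "\<And>w l r :: ell1. norm w * M \<le> 1 / 50 \<Longrightarrow> l = w + w\<^sup>2 * r \<Longrightarrow> norm r \<le> 2 * M \<Longrightarrow>
    \<exists>l' b s. exp l' = 1 + M *\<^sub>R (exp l - 1) \<and> norm l' \<le> 1 / 10 \<and> M *\<^sub>R l - l' = w\<^sup>2 * b \<and>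
       norm b \<le> 3 * M\<^sup>2 \<and> w\<^sup>2 * b = (M * (M - 1) / 2) *\<^sub>R w\<^sup>2 + w ^ 3 * s \<and> norm s \<le> C2"
    using boundary_factor[OF M2, where 'a = ell1] by blast
  define \<theta> where "\<theta> = root m (1 / 2)"
  have \<theta>: "0 < \<theta>" "\<theta> ^ m = 1 / 2" "\<theta> < 1" using m by (auto simp: \<theta>_def)
  obtain K where K: "0 \<le> K" "\<And>n. \<theta> ^ n * (real n)\<^sup>2 \<le> K"
    using geometric_times_square_bounded[OF \<theta>(1,3)] by blast
  define A where "A = (171875 :: real)"
  \<comment> \<open>The factor 27 M^3 stems from q <= 3 M a, cubed in the remainder of the binomial
    logarithm.\<close>
  define C4 where "C4 = C1 + 27 * M ^ 3 * C0"
  define CF where "CF = M\<^sup>2 + 10 * M ^ 3 + C2 + 2 * C4"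
  define C where "C = 5 * M\<^sup>2 * K + 6 * M ^ 3 * A + 3 * M\<^sup>2 * A + 10 * M ^ 3 * A + A * C2 + A * C4
     + 9 * M ^ 4 * A + 6 * M\<^sup>2 * A * CF + A * CF\<^sup>2"
  show ?thesis
  proof (intro exI[of _ C] allI impI)
    fix n :: nat and a L lam :: real and N :: nat and q :: real
    assume n: "m \<le> n" and L: "L = real n - real m + 1" and lam: "lam = L * a" and lam1: "1 \<le> lam"
      and ma: "real m * a \<le> 1 / 100" and N: "N = nat \<lfloor>N_tilde m n\<rfloor>" and q: "q = lam / real N"
    let ?u = ell1_u
    have La: "1 \<le> (real n - real m + 1) * a" using lam1 unfolding lam L .
    have Neq: "real N = real (nat \<lfloor>L\<^sup>2 / (L * (2 * real m - 1) - real m * (real m - 1))\<rfloor>)"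
      unfolding N N_tilde_def L ..
    note pb = parameter_bounds[OF m n La ma, folded L, folded lam, folded Neq, folded q, folded M_def]
    have a0: "0 < a" and a200: "a \<le> 1 / 200" and LM: "100 * M \<le> L" and N1: "1 < real N" and Nq: "real N * q = lam"
      and q0: "0 < q" and q3: "q \<le> 3 * M * a" and q21: "q \<le> 21 / 1000"
      using pb(1-8) by auto
    have a1: "a \<le> 1" using a200 by simp
    have L1: "1 \<le> L" using LM M2 by linarith
    have ma': "M * a \<le> 1 / 100" using ma by (simp add: M_def)
    define v where "v = 1 / sqrt lam"
    note sf = scale_facts[OF L1 a0 a1 lam1[unfolded lam] v_def[unfolded lam]]
    define w where "w = a *\<^sub>R ?u"
    have "norm w = a * norm ?u" using a0 by (simp add: w_def)
    then have wn: "norm w \<le> 2 * a" using norm_u_le a0 by (simp add: mult.commute)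
    have wM: "norm w * M \<le> 1 / 50"
    proof -
      have "norm w * M \<le> 2 * a * M" using wn M2 by (intro mult_right_mono) auto
      then show ?thesis using ma' by (simp add: mult_ac)
    qed
    then have wM': "norm w * M \<le> 1 / 20" by linarith
    obtain l r s where l: "exp ((M - 1) *\<^sub>R l) * (exp l - 1) = w" "norm l \<le> 6 / 5 * norm w"
      "l = w + w\<^sup>2 * r" "norm r \<le> 2 * M"
      "l = w - (M - 1/2) *\<^sub>R w\<^sup>2 + (1/3 + 3/2 * (M - 1) * M) *\<^sub>R w ^ 3 + w ^ 4 * s" "norm s \<le> C1"
      using C1[OF wM'] by blast
    obtain l' b s' where l': "exp l' = 1 + M *\<^sub>R (exp l - 1)" "norm l' \<le> 1 / 10" "M *\<^sub>R l - l' = w\<^sup>2 * b"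
      "norm b \<le> 3 * M\<^sup>2" "w\<^sup>2 * b = (M * (M - 1) / 2) *\<^sub>R w\<^sup>2 + w ^ 3 * s'" "norm s' \<le> C2"
      using C2[OF wM l(3,4)] by blast
    define w3 where "w3 = q *\<^sub>R ?u"
    have w3n: "norm w3 \<le> 1 / 20"
    proof -
      have "norm w3 \<le> q * 2" using norm_u_le q0 by (simp add: w3_def)
      then show ?thesis using q21 by simp
    qed
    obtain l3 r3 s3 where l3: "exp l3 = 1 + w3" "l3 = w3 + w3\<^sup>2 * r3" "norm r3 \<le> 2"
      "l3 = w3 - (1/2) *\<^sub>R w3\<^sup>2 + (1/3) *\<^sub>R w3 ^ 3 + w3 ^ 4 * s3" "norm s3 \<le> C0"
      using C0[OF w3n] by blast
    define e where "e = exp (lam *\<^sub>R ?u)"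
    define zP where "zP = (L * a\<^sup>2) *\<^sub>R r + a\<^sup>2 *\<^sub>R b"
    define zQ where "zQ = (lam * q) *\<^sub>R r3"
    define D where "D = zP - zQ"
    define d where "d = - L * (M - 1/2) * a\<^sup>2 + M * (M - 1) / 2 * a\<^sup>2 + lam * q / 2"
    define c3 where "c3 = L * a ^ 3 * (M * (M - 1) / 6)"
    define g where "g = L * a ^ 3 * (1/3 + 3/2 * (M - 1) * M) - lam * q\<^sup>2 / 3 - c3"
    define t where "t = (L * a ^ 4) *\<^sub>R s - (lam * q ^ 3) *\<^sub>R s3"
    define F where "F = (c3 + g) *\<^sub>R 1 + a ^ 3 *\<^sub>R s' + ?u * t"
    note wp = scaleR_powers[OF w_def] and w3p = scaleR_powers[OF w3_def]
    have logP: "L *\<^sub>R l + (M *\<^sub>R l - l') = lam *\<^sub>R ?u + ?u\<^sup>2 * zP"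
      unfolding l'(3) by (subst l(3)) (simp add: wp zP_def lam algebra_simps w_def)
    have logQ: "real N *\<^sub>R l3 = lam *\<^sub>R ?u + ?u\<^sup>2 * zQ"
    proof -
      have "real N *\<^sub>R l3 = (real N * q) *\<^sub>R ?u + ?u\<^sup>2 * ((real N * q * q) *\<^sub>R r3)"
        by (subst l3(2)) (simp add: w3p algebra_simps w3_def power2_eq_square)
      then show ?thesis unfolding Nq zQ_def .
    qed
    have logP3: "L *\<^sub>R l + (M *\<^sub>R l - l') = lam *\<^sub>R ?u + (- L * (M - 1/2) * a\<^sup>2 + M * (M - 1) / 2 * a\<^sup>2) *\<^sub>R ?u\<^sup>2
       + (L * a ^ 3 * (1/3 + 3/2 * (M - 1) * M)) *\<^sub>R ?u ^ 3 + ?u ^ 3 * (a ^ 3 *\<^sub>R s') + ?u ^ 4 * ((L * a ^ 4) *\<^sub>R s)"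
    proof -
      have "L *\<^sub>R l = lam *\<^sub>R ?u + (- L * (M - 1/2) * a\<^sup>2) *\<^sub>R ?u\<^sup>2
         + (L * a ^ 3 * (1/3 + 3/2 * (M - 1) * M)) *\<^sub>R ?u ^ 3 + ?u ^ 4 * ((L * a ^ 4) *\<^sub>R s)"
      proof -
        have "L *\<^sub>R (a *\<^sub>R ?u - x *\<^sub>R a\<^sup>2 *\<^sub>R ?u\<^sup>2 + y *\<^sub>R a ^ 3 *\<^sub>R ?u ^ 3 + a ^ 4 *\<^sub>R ?u ^ 4 * s)
          = (L * a) *\<^sub>R ?u + (- L * x * a\<^sup>2) *\<^sub>R ?u\<^sup>2 + (L * a ^ 3 * y) *\<^sub>R ?u ^ 3 + ?u ^ 4 * ((L * a ^ 4) *\<^sub>R s)" for x y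
          by (simp add: scaleR_add_right scaleR_diff_right mult_ac)
        from this[of "M - 1/2" "1/3 + 3/2 * (M - 1) * M"] show ?thesis
          unfolding lam by (subst l(5)) (simp only: wp, simp only: w_def)
      qed
      moreover have "M *\<^sub>R l - l' = (M * (M - 1) / 2 * a\<^sup>2) *\<^sub>R ?u\<^sup>2 + ?u ^ 3 * (a ^ 3 *\<^sub>R s')"
        unfolding l'(3) unfolding l'(5) unfolding wp by simp
      ultimately show ?thesis by (simp only: scaleR_add_left add_ac)
    qed
    have logQ3: "real N *\<^sub>R l3 = lam *\<^sub>R ?u - (lam * q / 2) *\<^sub>R ?u\<^sup>2 + (lam * q\<^sup>2 / 3) *\<^sub>R ?u ^ 3 + ?u ^ 4 * ((lam * q ^ 3) *\<^sub>R s3)"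
    proof -
      have "real N *\<^sub>R (q *\<^sub>R ?u - (1/2) *\<^sub>R q\<^sup>2 *\<^sub>R ?u\<^sup>2 + (1/3) *\<^sub>R q ^ 3 *\<^sub>R ?u ^ 3 + q ^ 4 *\<^sub>R ?u ^ 4 * s3)
        = (real N * q) *\<^sub>R ?u - (real N * q * q / 2) *\<^sub>R ?u\<^sup>2 + (real N * q * q\<^sup>2 / 3) *\<^sub>R ?u ^ 3 + ?u ^ 4 * ((real N * q * q ^ 3) *\<^sub>R s3)"
        by (simp add: scaleR_add_right scaleR_diff_right eval_nat_numeral mult_ac)
      then show ?thesis unfolding Nq by (subst l3(4)) (simp only: w3p, simp only: w3_def)
    qed
    have uD: "?u\<^sup>2 * D = d *\<^sub>R ?u\<^sup>2 + ?u ^ 3 * F"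
    proof -
      have "?u\<^sup>2 * D = (L *\<^sub>R l + (M *\<^sub>R l - l')) - real N *\<^sub>R l3"
        unfolding logP logQ D_def by (simp add: right_diff_distrib)
      also have "... = d *\<^sub>R ?u\<^sup>2 + (c3 + g) *\<^sub>R ?u ^ 3 + ?u ^ 3 * (a ^ 3 *\<^sub>R s') + ?u ^ 4 * t"
        unfolding logP3 logQ3 d_def g_def t_def by (simp add: scaleR_add_left scaleR_diff_left right_diff_distrib)
      also have "?u ^ 4 * t = ?u ^ 3 * (?u * t)" by (simp add: eval_nat_numeral mult_ac)
      finally show ?thesis unfolding F_def by (simp add: distrib_left)
    qed
    have zQn: "norm zQ \<le> lam * q * 2"
      unfolding zQ_def using norm_scaleR_bound[OF l3(3), of "lam * q"] lam1 q0 by simp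
    have zPn: "norm zP \<le> lam * (21 / 1000)"
    proof -
      have "norm zP \<le> \<bar>L * a\<^sup>2\<bar> * (2 * M) + \<bar>a\<^sup>2\<bar> * (3 * M\<^sup>2)"
        unfolding zP_def by (intro norm_add_bound norm_scaleR_bound l l')
      also have "... = lam * (2 * (M * a)) + 3 * ((M * a) * (M * a))"
        using L1 by (simp add: lam power2_eq_square)
      also have "... \<le> lam * (2 * (1 / 100)) + 3 * ((1/100) * (1/100))"
        using ma' a0 M2 lam1 by (intro add_mono mult_left_mono mult_mono) auto
      also have "... \<le> lam * (21 / 1000)" using lam1 by simp
      finally show ?thesis .
    qed
    have lq: "lam * q * 2 \<le> lam * (42 / 1000)" using q21 lam1 by simp
    \<comment> \<open>The budget of smoothing: \<open>Z1\<close> uses 42 and \<open>Z2\<close> uses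
      42 + 63 = 105 thousandths of lam, while lam / 8 allows 125.\<close>
    have Dn: "norm D \<le> lam * (63 / 1000)"
      unfolding D_def using norm_triangle_ineq4[of zP zQ] zPn zQn lq by linarith
    define Z1 where "Z1 = exp (?u\<^sup>2 * zQ)"
    define Z2 where "Z2 = Z1 * expt 2 (?u\<^sup>2 * D)"
    have zQn': "norm zQ \<le> lam * (42 / 1000)" using zQn lq by linarith
    have majE: "majorized ?u (lam * (42 / 1000)) (expt j (?u\<^sup>2 * zQ))" for j
      by (rule majorized_expt[OF zQn'])
    have maj1: "majorized ?u (lam * (42 / 1000)) Z1" unfolding Z1_def using majE[of 0] by simp
    have maj2: "majorized ?u (lam * (42 / 1000) + lam * (63 / 1000)) Z2"
      unfolding Z2_def by (intro majorized_mult maj1 majorized_expt Dn)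
    have B1: "norm (?u ^ s * e * Z1) \<le> A * v ^ s" if "s \<le> 6" for s
      unfolding e_def A_def v_def by (rule majorized_norm_bound[OF maj1]) (use lam1 that in auto)
    have BE: "norm (?u ^ s * e * expt 1 (?u\<^sup>2 * zQ)) \<le> A * v ^ s" if "s \<le> 6" for s
      unfolding e_def A_def v_def by (rule majorized_norm_bound[OF majE]) (use lam1 that in auto)
    have B2: "norm (?u ^ s * e * Z2) \<le> A * v ^ s" if "s \<le> 6" for s
      unfolding e_def A_def v_def by (rule majorized_norm_bound[OF maj2]) (use lam1 that in auto)
    define X where "X = a / L"
    define X' where "X' = a * (a * sqrt a / sqrt L)"
    have X0: "0 \<le> X" "0 \<le> X'" using a0 L1 by (auto simp: X_def X'_def)
    have A0: "0 \<le> A" by (simp add: A_def)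
    have C00: "0 \<le> C0" "0 \<le> C1" "0 \<le> C2" using l3(5) l(6) l'(6) norm_ge_zero order_trans by blast+
    have C40: "0 \<le> C4" using C00 M2 by (simp add: C4_def)
    have c3b: "0 \<le> c3" "c3 \<le> L * a ^ 3 * M\<^sup>2"
    proof -
      have "0 \<le> M * (M - 1) / 6" "M * (M - 1) / 6 \<le> M\<^sup>2" using M2 by (auto simp: power2_eq_square algebra_simps)
      then show "0 \<le> c3" "c3 \<le> L * a ^ 3 * M\<^sup>2"
        unfolding c3_def using L1 a0 by (auto intro!: mult_nonneg_nonneg mult_left_mono)
    qed
    have db: "\<bar>d\<bar> \<le> 3 * M\<^sup>2 * a\<^sup>2" unfolding d_def by (rule pb(9))
    have gb: "\<bar>g\<bar> \<le> 10 * M ^ 3 * a ^ 3" unfolding g_def c3_def by (rule pb(10))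
    have tb: "norm t \<le> L * a ^ 4 * C4"
    proof -
      have "norm t \<le> \<bar>L * a ^ 4\<bar> * C1 + \<bar>lam * q ^ 3\<bar> * C0"
        unfolding t_def by (intro norm_diff_bound norm_scaleR_bound l l3)
      also have "\<bar>lam * q ^ 3\<bar> \<le> lam * (3 * M * a) ^ 3"
        using lam1 q0 q3 by (auto intro!: mult_left_mono power_mono)
      then have "\<bar>L * a ^ 4\<bar> * C1 + \<bar>lam * q ^ 3\<bar> * C0 \<le> \<bar>L * a ^ 4\<bar> * C1 + lam * (3 * M * a) ^ 3 * C0"
        using C00 by (intro add_mono mult_right_mono) auto
      also have "... = L * a ^ 4 * C4"
        using L1 a0 by (simp add: C4_def lam power_mult_distrib abs_mult eval_nat_numeral algebra_simps)
      finally show ?thesis .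
    qed
    have a43: "L * a ^ 4 \<le> L * a ^ 3" "a ^ 3 \<le> L * a ^ 3"
    proof -
      have "a ^ 4 \<le> a ^ 3" using a0 a1 by (intro power_decreasing) auto
      then show "L * a ^ 4 \<le> L * a ^ 3" using L1 by (intro mult_left_mono) auto
      show "a ^ 3 \<le> L * a ^ 3" using mult_right_mono[OF L1, of "a ^ 3"] a0 by simp
    qed
    have CF0: "0 \<le> CF" using C00 C40 M2 by (simp add: CF_def)
    have Fb: "norm F \<le> L * a ^ 3 * CF"
    proof -
      have "norm F \<le> \<bar>c3 + g\<bar> * 1 + \<bar>a ^ 3\<bar> * C2 + 2 * (L * a ^ 4 * C4)"
        unfolding F_def by (intro norm_add_bound norm_scaleR_bound norm_mult_bound l' norm_u_le tb) simp
      also have "... \<le> (L * a ^ 3 * M\<^sup>2 + 10 * M ^ 3 * (L * a ^ 3)) + (L * a ^ 3) * C2 + 2 * (L * a ^ 3 * C4)"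
      proof (intro add_mono)
        have "\<bar>g\<bar> \<le> 10 * M ^ 3 * (L * a ^ 3)"
          by (rule order_trans[OF gb]) (use M2 in \<open>intro mult_left_mono a43(2), simp\<close>)
        with c3b show "\<bar>c3 + g\<bar> * 1 \<le> L * a ^ 3 * M\<^sup>2 + 10 * M ^ 3 * (L * a ^ 3)"
          unfolding mult_1_right by (intro order_trans[OF abs_triangle_ineq] add_mono) auto
        show "\<bar>a ^ 3\<bar> * C2 \<le> L * a ^ 3 * C2" using a43 C00 a0 by (intro mult_right_mono) auto
        show "2 * (L * a ^ 4 * C4) \<le> 2 * (L * a ^ 3 * C4)"
          using mult_right_mono[OF a43(1) C40] by simp
      qed
      also have "... = L * a ^ 3 * CF" by (simp add: CF_def algebra_simps)
      finally show ?thesis .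
    qed
    have v0: "0 \<le> v" using sf(1) by simp
    \<comment> \<open>The only term of size \<open>X'\<close>: passing from the binomial to the
      Poisson law in the leading term is a relative error of order u^2 zQ, hence of order q and so
      of order a.\<close>
    have E1: "norm (c3 *\<^sub>R (?u ^ 5 * e * expt 1 (?u\<^sup>2 * zQ) * zQ)) \<le> 6 * M ^ 3 * A * X'"
    proof -
      have "norm (c3 *\<^sub>R (?u ^ 5 * e * expt 1 (?u\<^sup>2 * zQ) * zQ)) \<le> \<bar>c3\<bar> * (A * v ^ 5 * (lam * (3 * M * a) * 2))"
      proof (intro norm_scaleR_bound norm_mult_bound[OF BE])
        have "lam * q * 2 \<le> lam * (3 * M * a) * 2" using q3 lam1 by (simp add: mult_left_mono)
        then show "norm zQ \<le> lam * (3 * M * a) * 2" using zQn by linarith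
      qed simp
      also have "... \<le> (L * a ^ 3 * M\<^sup>2) * (A * v ^ 5 * (lam * (3 * M * a) * 2))"
        using c3b A0 v0 lam1 M2 a0 by (intro mult_right_mono) auto
      also have "... = 6 * M ^ 3 * A * (L * a ^ 3 * (L * a * a) * v ^ 5)"
        by (simp add: lam power2_eq_square power3_eq_cube)
      also have "... = 6 * M ^ 3 * A * X'" unfolding sf(9) X'_def ..
      finally show ?thesis .
    qed
    \<comment> \<open>The cost of rounding N: d is of order a^2, and u^2 contributes 1 /
      lam.\<close>
    have E2: "norm (d *\<^sub>R (?u ^ 2 * e * Z1)) \<le> 3 * M\<^sup>2 * A * X"
    proof -
      have "norm (d *\<^sub>R (?u ^ 2 * e * Z1)) \<le> \<bar>d\<bar> * (A * v ^ 2)" by (intro norm_scaleR_bound B1) simp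
      also have "... \<le> (3 * M\<^sup>2 * a\<^sup>2) * (A * v ^ 2)" using A0 by (intro mult_right_mono db) auto
      also have "... = 3 * M\<^sup>2 * A * (a\<^sup>2 * v\<^sup>2)" by simp
      finally show ?thesis unfolding sf(3) X_def .
    qed
    have E3: "norm (g *\<^sub>R (?u ^ 3 * e * Z1)) \<le> 10 * M ^ 3 * A * X"
    proof -
      have "norm (g *\<^sub>R (?u ^ 3 * e * Z1)) \<le> \<bar>g\<bar> * (A * v ^ 3)" by (intro norm_scaleR_bound B1) simp
      also have "... \<le> (10 * M ^ 3 * a ^ 3) * (A * v ^ 3)" using A0 v0 by (intro mult_right_mono gb) auto
      also have "... = 10 * M ^ 3 * A * (a ^ 3 * v ^ 3)" by simp
      also have "... \<le> 10 * M ^ 3 * A * X" unfolding X_def using M2 A0 by (intro mult_left_mono sf(4)) auto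
      finally show ?thesis .
    qed
    have E3': "norm (a ^ 3 *\<^sub>R (?u ^ 3 * e * Z1 * s')) \<le> A * C2 * X"
    proof -
      have "norm (a ^ 3 *\<^sub>R (?u ^ 3 * e * Z1 * s')) \<le> \<bar>a ^ 3\<bar> * (A * v ^ 3 * C2)"
        by (intro norm_scaleR_bound norm_mult_bound[OF B1] l'(6)) simp
      also have "... = A * C2 * (a ^ 3 * v ^ 3)" using a0 by simp
      also have "... \<le> A * C2 * X" unfolding X_def using A0 C00 by (intro mult_left_mono sf(4)) auto
      finally show ?thesis .
    qed
    have E4: "norm (?u ^ 4 * e * Z1 * t) \<le> A * C4 * X"
    proof -
      have "norm (?u ^ 4 * e * Z1 * t) \<le> A * v ^ 4 * (L * a ^ 4 * C4)"
        by (intro norm_mult_bound[OF B1] tb) simp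
      also have "... = A * C4 * (L * a ^ 4 * v ^ 4)" by simp
      also have "... \<le> A * C4 * X" unfolding X_def using A0 C40 by (intro mult_left_mono sf(5)) auto
      finally show ?thesis .
    qed
    have E5: "norm (d\<^sup>2 *\<^sub>R (?u ^ 4 * e * Z2)) \<le> 9 * M ^ 4 * A * X"
    proof -
      have "norm (d\<^sup>2 *\<^sub>R (?u ^ 4 * e * Z2)) \<le> \<bar>d\<^sup>2\<bar> * (A * v ^ 4)" by (intro norm_scaleR_bound B2) simp
      also have "\<bar>d\<^sup>2\<bar> \<le> (3 * M\<^sup>2 * a\<^sup>2)\<^sup>2" using db power_mono[of "\<bar>d\<bar>" "3 * M\<^sup>2 * a\<^sup>2" 2] by simp
      then have "\<bar>d\<^sup>2\<bar> * (A * v ^ 4) \<le> (3 * M\<^sup>2 * a\<^sup>2)\<^sup>2 * (A * v ^ 4)" using A0 v0 by (intro mult_right_mono) auto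
      also have "... = 9 * M ^ 4 * A * (a ^ 4 * v ^ 4)" by (simp add: power2_eq_square power4_eq_xxxx)
      also have "... \<le> 9 * M ^ 4 * A * X" unfolding X_def using A0 by (intro mult_left_mono sf(6)) auto
      finally show ?thesis .
    qed
    have E6: "norm ((2 * d) *\<^sub>R (?u ^ 5 * e * Z2 * F)) \<le> 6 * M\<^sup>2 * A * CF * X"
    proof -
      have "norm ((2 * d) *\<^sub>R (?u ^ 5 * e * Z2 * F)) \<le> \<bar>2 * d\<bar> * (A * v ^ 5 * (L * a ^ 3 * CF))"
        by (intro norm_scaleR_bound norm_mult_bound[OF B2] Fb) simp
      also have "... \<le> (6 * M\<^sup>2 * a\<^sup>2) * (A * v ^ 5 * (L * a ^ 3 * CF))"
        using db A0 v0 L1 a0 CF0 by (intro mult_right_mono) auto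
      also have "... = 6 * M\<^sup>2 * A * CF * (L * a ^ 5 * v ^ 5)" by (simp add: eval_nat_numeral)
      also have "... \<le> 6 * M\<^sup>2 * A * CF * X" unfolding X_def using A0 CF0 by (intro mult_left_mono sf(7)) auto
      finally show ?thesis .
    qed
    have E7: "norm (?u ^ 6 * e * Z2 * F\<^sup>2) \<le> A * CF\<^sup>2 * X"
    proof -
      have "norm (?u ^ 6 * e * Z2 * F\<^sup>2) \<le> A * v ^ 6 * (L * a ^ 3 * CF)\<^sup>2"
        by (intro norm_mult_bound[OF B2] norm_power_bound Fb) simp
      also have "... = A * CF\<^sup>2 * (L\<^sup>2 * a ^ 6 * v ^ 6)" by (simp add: eval_nat_numeral)
      also have "... \<le> A * CF\<^sup>2 * X" unfolding X_def using A0 by (intro mult_left_mono sf(8)) auto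
      finally show ?thesis .
    qed
    define P where "P = e * exp (?u\<^sup>2 * (zQ + D))"
    have Peq: "P = exp (L *\<^sub>R l + (M *\<^sub>R l - l'))"
      unfolding logP exp_add_comm P_def e_def D_def by simp
    have Qeq: "(1 + q *\<^sub>R ?u) ^ N = e * Z1"
    proof -
      have "(1 + q *\<^sub>R ?u) ^ N = exp (real N *\<^sub>R l3)"
        unfolding exp_scaleR_nat l3(1) w3_def ..
      then show ?thesis unfolding logQ exp_add_comm e_def Z1_def .
    qed
    have main: "norm (P - (1 + q *\<^sub>R ?u) ^ N - c3 *\<^sub>R (?u ^ 3 * e)) \<le> 6 * M ^ 3 * A * X' + 3 * M\<^sup>2 * A * X
        + 10 * M ^ 3 * A * X + A * C2 * X + A * C4 * X + (9 * M ^ 4 * A * X + 6 * M\<^sup>2 * A * CF * X + A * CF\<^sup>2 * X)"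
      unfolding P_def Qeq Z1_def third_order_expansion[OF uD F_def]
      unfolding Z1_def[symmetric] Z2_def[symmetric]
      by (intro norm_add_bound E1 E2 E3 E3' E4 E5 E6 E7)
    have GP: "norm (pgf m a n - P) \<le> 5 * M\<^sup>2 * K * X"
    proof -
      have lm: "norm l * real m \<le> 1 / 10"
      proof -
        have "norm l * M \<le> 6 / 5 * norm w * M" using l(2) M2 by (intro mult_right_mono) auto
        then show ?thesis using wM by (simp add: M_def)
      qed
      define R where "R = pgf m a n * (1 + real m *\<^sub>R (exp l - 1)) - exp (real (Suc n) *\<^sub>R l)"
      have "norm R \<le> 4 * (real m)\<^sup>2 * \<theta> ^ n"
        unfolding R_def
      proof (rule dominant_root[OF m l(1)[unfolded M_def] lm])
        show "pgf m a j = 1" if "j < m" for j using that by (rule pgf_init)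
        show "pgf m a k = pgf m a (k - 1) + w * pgf m a (k - m)" if "m \<le> k" for k
          unfolding w_def using m that by (intro pgf_rec) auto
      qed (use \<theta> n in auto)
      then have Rn: "norm R \<le> 4 * M\<^sup>2 * \<theta> ^ n" by (simp only: M_def)
      have inv: "exp l' * exp (- l') = 1" by (simp add: exp_minus_inverse)
      have "pgf m a n * exp l' = exp (real (Suc n) *\<^sub>R l) + R"
        unfolding R_def l'(1) M_def by simp
      then have "pgf m a n * (exp l' * exp (- l')) = exp (real (Suc n) *\<^sub>R l) * exp (- l') + R * exp (- l')"
        by (simp add: distrib_right mult.assoc flip: mult.assoc[of "pgf m a n"])
      moreover have "exp (real (Suc n) *\<^sub>R l) * exp (- l') = P"
      proof -
        have "real (Suc n) = L + M" by (simp add: L M_def)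
        then have "real (Suc n) *\<^sub>R l + - l' = L *\<^sub>R l + (M *\<^sub>R l - l')"
          by (simp only: scaleR_add_left) simp
        then show ?thesis unfolding Peq exp_add_comm[symmetric] by (rule arg_cong)
      qed
      ultimately have "pgf m a n - P = R * exp (- l')" unfolding inv by simp
      also have "norm ... \<le> 4 * M\<^sup>2 * \<theta> ^ n * (111 / 100)"
        using norm_expt_le'[of "- l'" "1 / 10" 0] l'(2)
        by (intro norm_mult_bound Rn) (auto simp: power2_eq_square)
      also have "... \<le> 5 * M\<^sup>2 * \<theta> ^ n" using \<theta> by simp
      \<comment> \<open>From \<theta>^n <= K / n^2 <= K / L^2 and 1 <= L a, that is 1 / L <=
        a.\<close>
      also have "\<theta> ^ n \<le> K * X"
      proof -
        have Ln: "0 < L" "L \<le> real n" using L1 L n m by auto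
        have "\<theta> ^ n * L\<^sup>2 \<le> \<theta> ^ n * (real n)\<^sup>2"
          using Ln \<theta> by (intro mult_left_mono power_mono) auto
        also have "... \<le> K" by (rule K)
        finally have "\<theta> ^ n \<le> K / L\<^sup>2" using Ln by (simp add: pos_le_divide_eq)
        also have "... = K * (1 / L / L)" by (simp add: power2_eq_square)
        also have "... \<le> K * (a / L)"
          using K(1) Ln lam1 unfolding lam
          by (intro mult_left_mono divide_right_mono) (auto simp: divide_le_eq mult.commute)
        finally show ?thesis unfolding X_def .
      qed
      then have "5 * M\<^sup>2 * \<theta> ^ n \<le> 5 * M\<^sup>2 * (K * X)" by (intro mult_left_mono) auto
      finally show ?thesis by (simp add: mult.assoc)
    qed
    have "norm (pgf m a n - (1 + q *\<^sub>R ?u) ^ N - c3 *\<^sub>R (?u ^ 3 * e))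
        = norm ((pgf m a n - P) + (P - (1 + q *\<^sub>R ?u) ^ N - c3 *\<^sub>R (?u ^ 3 * e)))"
      by (intro arg_cong[where f = norm]) (simp add: algebra_simps)
    also have "... \<le> 5 * M\<^sup>2 * K * X + (6 * M ^ 3 * A * X' + 3 * M\<^sup>2 * A * X
        + 10 * M ^ 3 * A * X + A * C2 * X + A * C4 * X + (9 * M ^ 4 * A * X + 6 * M\<^sup>2 * A * CF * X + A * CF\<^sup>2 * X))"
      by (intro norm_add_bound GP main)
    also have "... = C * X - 6 * M ^ 3 * A * X + 6 * M ^ 3 * A * X'"
      unfolding C_def by (simp add: algebra_simps)
    also have "... \<le> C * X + C * X'"
    proof -
      have "6 * M ^ 3 * A \<le> C"
        unfolding C_def using M2 A0 K(1) C00 C40 CF0 by (simp add: add_nonneg_nonneg)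
      then have "6 * M ^ 3 * A * X' \<le> C * X'" using X0 by (intro mult_right_mono) auto
      moreover have "0 \<le> 6 * M ^ 3 * A * X" using M2 A0 X0 by simp
      ultimately show ?thesis by linarith
    qed
    finally show "norm (pgf m a n - (1 + q *\<^sub>R ell1_u) ^ N - (L * a ^ 3 * (real m * (real m - 1) / 6)) *\<^sub>R (ell1_u ^ 3 * exp (lam *\<^sub>R ell1_u)))
      \<le> C * (a / L + a * (a * sqrt a / sqrt L))"
      unfolding c3_def M_def e_def X_def X'_def by (simp only: distrib_left)
  qed
qed

text \<open>Two triangle inequalities: from the distance of the laws to the norm of c3 u^3 exp (lam
  u), and from that norm to its Gaussian value. The factor m (m - 1) >= 1 is inserted into the
  errors to give them the required shape.\<close>

theorem theorem4p3:
  fixes m :: nat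
  assumes "2 \<le> m"
  shows "\<exists>C::real. 0 < C \<and>
    (\<forall>(k1::nat) (k2::nat) (p::real) (n::nat) (M::'a measure) (\<eta>::nat \<Rightarrow> 'a \<Rightarrow> int).
      1 \<le> k1 \<and> 1 \<le> k2 \<and> k1 + k2 = m \<and> 0 < p \<and> p < 1 \<and> m \<le> n \<and>
      iid_bernoulli M \<eta> p \<and>
      1 \<le> (real n - real m + 1) * a_prob k1 k2 p \<and>
      real m * a_prob k1 k2 p \<le> 0.01 \<longrightarrow>
      (let L = real n - real m + 1;
           a = a_prob k1 k2 p;
           N = nat \<lfloor>N_tilde m n\<rfloor>;
           pbar = L * a / real N
       in \<bar>tv_norm (\<lambda>k. measure (H M \<eta> k1 k2 n) {k} - measure (Bi N pbar) {k})
            - C_TV * (a powr (3 / 2) * real m * (real m - 1) / (2 * sqrt L))\<bar>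
          \<le> C * (a powr (3 / 2) * real m * (real m - 1) / sqrt L)
              * (1 / sqrt (L * a) + 1 / (N_tilde m n - 1) + a)))"
proof -
  define \<kappa> where "\<kappa> = sqrt (2 / pi) * (1 + 4 * exp (- 3 / 2))"
  obtain C1 where C1: "\<And>n a L lam N q. m \<le> n \<Longrightarrow> L = real n - real m + 1 \<Longrightarrow> lam = L * a \<Longrightarrow> 1 \<le> lam \<Longrightarrow>
    real m * a \<le> 1 / 100 \<Longrightarrow> N = nat \<lfloor>N_tilde m n\<rfloor> \<Longrightarrow> q = lam / real N \<Longrightarrow>
    norm (pgf m a n - (1 + q *\<^sub>R ell1_u) ^ N - (L * a ^ 3 * (real m * (real m - 1) / 6)) *\<^sub>R (ell1_u ^ 3 * exp (lam *\<^sub>R ell1_u)))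
      \<le> C1 * (a / L + a * (a * sqrt a / sqrt L))"
    using pgf_binomial_expansion[OF assms] by blast
  obtain C2 where C2: "\<And>t. 1 \<le> t \<Longrightarrow> \<bar>norm (ell1_u ^ 3 * exp (t *\<^sub>R ell1_u)) - \<kappa> / (t * sqrt t)\<bar> \<le> C2 / t\<^sup>2"
    using norm_u3_exp_asymp unfolding \<kappa>_def by blast
  have "0 \<le> C2" using C2[of 1] abs_ge_zero order_trans by fastforce
  define C where "C = \<bar>C1\<bar> + C2 + 1"
  show ?thesis
  proof (intro exI[of _ C] conjI allI impI)
    show "0 < C" using \<open>0 \<le> C2\<close> by (simp add: C_def)
    fix k1 k2 :: nat and p :: real and n :: nat and M :: "'a measure" and \<eta> :: "nat \<Rightarrow> 'a \<Rightarrow> int"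
    assume asm: "1 \<le> k1 \<and> 1 \<le> k2 \<and> k1 + k2 = m \<and> 0 < p \<and> p < 1 \<and> m \<le> n \<and>
      iid_bernoulli M \<eta> p \<and>
      1 \<le> (real n - real m + 1) * a_prob k1 k2 p \<and>
      real m * a_prob k1 k2 p \<le> 0.01"
    define L a N where "L = real n - real m + 1" and "a = a_prob k1 k2 p" and "N = nat \<lfloor>N_tilde m n\<rfloor>"
    define lam q where "lam = L * a" and "q = lam / real N"
    define mm where "mm = real m * (real m - 1)"
    define B where "B = a * sqrt a / sqrt L"
    have n: "m \<le> n" and lam1: "1 \<le> lam" and ma: "real m * a \<le> 1 / 100" and La: "1 \<le> (real n - real m + 1) * a"
      using asm by (auto simp: lam_def L_def a_def)
    have Nt: "1 < \<lfloor>N_tilde m n\<rfloor>" and q01: "q \<in> {0..1}"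
      using binomial_parameter_in_unit_interval[OF assms n, of a] La ma
      unfolding q_def lam_def L_def N_def by auto
    note pb = parameter_bounds[OF assms n La ma, folded L_def]
    have a0: "0 < a" and a1: "a \<le> 1" using pb(1,2) by auto
    have L1: "1 \<le> L" using n by (simp add: L_def)
    have mm1: "1 \<le> mm" using mult_mono[of 1 "real m" 1 "real m - 1"] assms by (simp add: mm_def)
    define v where "v = 1 / sqrt lam"
    note sf = scale_facts[OF L1 a0 a1 lam1[unfolded lam_def] v_def[unfolded lam_def]]
    define c3 where "c3 = L * a ^ 3 * (mm / 6)"
    define T where "T = norm (pgf m a n - (1 + q *\<^sub>R ell1_u) ^ N)"
    have tv: "tv_norm (\<lambda>k. measure (H M \<eta> k1 k2 n) {k} - measure (Bi N q) {k}) = T"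
      unfolding T_def a_def using tv_norm_H_Bi[of M \<eta> p k1 k2 q n N] asm q01 by auto
    have 1: "\<bar>T - norm (c3 *\<^sub>R (ell1_u ^ 3 * exp (lam *\<^sub>R ell1_u)))\<bar> \<le> C1 * (a / L + a * B)"
      unfolding T_def
      by (rule order_trans[OF norm_triangle_ineq3])
         (use C1[OF n L_def lam_def lam1 ma N_def q_def] in \<open>simp add: c3_def mm_def B_def\<close>)
    have c30: "0 \<le> c3" using L1 a0 mm1 by (simp add: c3_def)
    have 2: "\<bar>norm (c3 *\<^sub>R (ell1_u ^ 3 * exp (lam *\<^sub>R ell1_u))) - c3 * (\<kappa> / (lam * sqrt lam))\<bar> \<le> c3 * (C2 / lam\<^sup>2)"
    proof -
      have "\<bar>norm (c3 *\<^sub>R x) - c3 * k\<bar> = c3 * \<bar>norm x - k\<bar>" for x :: ell1 and k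
      proof -
        have "norm (c3 *\<^sub>R x) - c3 * k = c3 * (norm x - k)" using c30 by (simp add: right_diff_distrib)
        then show ?thesis using c30 by (simp add: abs_mult)
      qed
      then show ?thesis using C2[OF lam1] c30 by (simp only: mult_left_mono)
    qed
    have 3: "c3 * (C2 / lam\<^sup>2) \<le> C2 * (mm * (a / L))"
    proof -
      have "c3 * (C2 / lam\<^sup>2) = C2 * (mm * (a / L)) / 6"
        using L1 a0 by (simp add: c3_def lam_def power2_eq_square power3_eq_cube mult_ac)
      also have "... \<le> C2 * (mm * (a / L))"
      proof -
        have "0 \<le> C2 * (mm * (a / L))" using \<open>0 \<le> C2\<close> mm1 a0 L1 by (intro mult_nonneg_nonneg) auto
        moreover have "x / 6 \<le> x" if "0 \<le> x" for x :: real using that by simp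
        ultimately show ?thesis by blast
      qed
      finally show ?thesis .
    qed
    have powr: "a powr (3 / 2) = a * sqrt a"
    proof -
      have "a powr (3 / 2) = a powr (1 + 1 / 2)" by simp
      also have "... = a * sqrt a" unfolding powr_add using a0 by (simp add: powr_half_sqrt)
      finally show ?thesis .
    qed
    \<comment> \<open>L a^3 / lam^(3/2) = a^(3/2) / sqrt L, and \<kappa> = 3 \<open>C_TV\<close>
      turns the 1/6 in \<open>c3\<close> into 1/2.\<close>
    have lead: "c3 * (\<kappa> / (lam * sqrt lam)) = C_TV * (a powr (3 / 2) * real m * (real m - 1) / (2 * sqrt L))"
    proof -
      have sL: "sqrt L * sqrt L = L" "sqrt a * sqrt a = a" "sqrt L \<noteq> 0" "sqrt a \<noteq> 0" using L1 a0 by auto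
      have "L * a ^ 3 / (lam * sqrt lam) = a * a / (sqrt L * sqrt a)"
        using L1 a0 by (simp add: lam_def real_sqrt_mult power3_eq_cube)
      also have "... = a * (sqrt a * sqrt a) / (sqrt L * sqrt a)" unfolding sL ..
      also have "... = a * sqrt a / sqrt L" using sL(3,4) by (simp only: mult.assoc[symmetric]) (rule mult_divide_mult_cancel_right)
      finally have "L * a ^ 3 / (lam * sqrt lam) = a * sqrt a / sqrt L" .
      then have "c3 * (\<kappa> / (lam * sqrt lam)) = (a * sqrt a / sqrt L) * (mm / 6 * \<kappa>)"
        unfolding c3_def by (metis (no_types, opaque_lifting) mult.commute mult.left_commute times_divide_eq_left times_divide_eq_right)
      also have "... = C_TV * (a * sqrt a * real m * (real m - 1) / (2 * sqrt L))"
        unfolding C_TV_def \<kappa>_def mm_def by (simp add: mult_ac)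
      finally show ?thesis unfolding powr .
    qed
    have X: "a / L = B * v" unfolding B_def by (rule sf(10))
    have B0: "0 \<le> B" using a0 L1 by (simp add: B_def)
    have Nt1: "0 \<le> 1 / (N_tilde m n - 1)" using Nt by (simp add: less_floor_iff)
    have v0: "0 < v" by (rule sf(1))
    have "\<bar>T - C_TV * (a powr (3 / 2) * real m * (real m - 1) / (2 * sqrt L))\<bar>
        \<le> C1 * (a / L + a * B) + C2 * (mm * (a / L))"
      using 1 2 3 unfolding lead by linarith
    also have "... \<le> \<bar>C1\<bar> * (mm * (a / L + a * B)) + C2 * (mm * (a / L + a * B))"
    proof -
      have nn: "0 \<le> a / L + a * B" using a0 L1 B0 by simp
      have "a / L + a * B \<le> mm * (a / L + a * B)" using mult_right_mono[OF mm1 nn] by simp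
      then have "C1 * (a / L + a * B) \<le> \<bar>C1\<bar> * (mm * (a / L + a * B))"
        using nn by (intro mult_mono) auto
      moreover have "mm * (a / L) \<le> mm * (a / L + a * B)" using mm1 a0 B0 by (intro mult_left_mono) auto
      then have "C2 * (mm * (a / L)) \<le> C2 * (mm * (a / L + a * B))"
        using \<open>0 \<le> C2\<close> by (rule mult_left_mono)
      ultimately show ?thesis by (rule add_mono)
    qed
    \<comment> \<open>As a / L = B v, the two error sizes combine to B (v + a), which exhibits 1 /
      sqrt (L a) and a inside the bracket.\<close>
    also have "... = (\<bar>C1\<bar> + C2) * (mm * B * (v + a))"
      unfolding X by (simp add: algebra_simps)
    also have "... \<le> C * (mm * B * (v + 1 / (N_tilde m n - 1) + a))"
      using \<open>0 \<le> C2\<close> mm1 B0 v0 a0 Nt1 unfolding C_def by (intro mult_mono) auto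
    also have "... = C * (a powr (3 / 2) * real m * (real m - 1) / sqrt L) * (1 / sqrt (L * a) + 1 / (N_tilde m n - 1) + a)"
      unfolding powr mm_def B_def v_def lam_def by simp
    finally have fin: "\<bar>T - C_TV * (a powr (3 / 2) * real m * (real m - 1) / (2 * sqrt L))\<bar>
        \<le> C * (a powr (3 / 2) * real m * (real m - 1) / sqrt L) * (1 / sqrt (L * a) + 1 / (N_tilde m n - 1) + a)" .
    show "let L = real n - real m + 1;
           a = a_prob k1 k2 p;
           N = nat \<lfloor>N_tilde m n\<rfloor>;
           pbar = L * a / real N
       in \<bar>tv_norm (\<lambda>k. measure (H M \<eta> k1 k2 n) {k} - measure (Bi N pbar) {k})
            - C_TV * (a powr (3 / 2) * real m * (real m - 1) / (2 * sqrt L))\<bar>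
          \<le> C * (a powr (3 / 2) * real m * (real m - 1) / sqrt L)
              * (1 / sqrt (L * a) + 1 / (N_tilde m n - 1) + a)"
      unfolding Let_def L_def[symmetric] a_def[symmetric] N_def[symmetric] lam_def[symmetric] q_def[symmetric] tv
      using fin unfolding lam_def .
  qed
qed

end
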